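(* Let $(Q,g)$ be a complete connected Riemannian manifold, $T>0$, $(q_0,v_0),(q_T,v_T)\in TQ$, $P\subset Q$ a totally bounded subset (the obstacle), and $h>0$. Suppose that obstacle avoidance for $P$ is feasible with tolerance $0<R\le h$. Then for all $0<r<\frac R2$ there exist $r^\ast<R$, $\tau>0$, $k\in\mathbb{N}$, and a finite collection of points $\{p_i\}\subset P$ such that any minimizer of $J$ on $\Omega$ corresponding to the potential $V(q)=\sum_iV_i(q)$, where $$V_i(q)=\begin{cases} e\,\tau\exp\left(-\dfrac{1}{1-(d(p_i,q)/R)^{2k}}\right) & d(p_i,q)<R,\\ 0 & \text{otherwise,}\end{cases}$$ avoids $P$ with tolerance $r$.
   Context: $Q$ is finite-dimensional, $d$ is the Riemannian distance, and for $m\in Q$, $d(m,P):=\inf_{p\in P}d(m,p)$. The constant $h$ is a given sensing radius (potentials are required to vanish where the distance to the obstacle exceeds $h$). $\frac{D^2q}{dt^2}=\frac{D}{dt}\dot q$ is the covariant derivative of $\dot q$ along $q$ (Levi-Civita connection), and $\|\cdot\|$ is the norm induced by $g$. $H^2([0,T];Q)$ is the set of curves $q:[0,T]\to Q$ whose local chart expressions (on closed subintervals mapped into a chart domain) are of Sobolev class $H^2=W^{2,2}$. $\Omega$ is the set of $q\in H^2([0,T];Q)$ with $q(0)=q_0$, $q(T)=q_T$, $\dot q(0)=v_0$, $\dot q(T)=v_T$. For a potential $V:Q\to\mathbb{R}$, the functional $J:\Omega\to\mathbb{R}$ is $$J(q)=\frac12\int_0^T\left(\left\|\frac{D^2q}{dt^2}(t)\right\|^2+V(q(t))\right)dt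 .$$ A minimizer of $J$ is a curve $q^\ast\in\Omega$ with $J(q^\ast)\le J(\tilde q)$ for all $\tilde q\in\Omega$. A curve $q\in\Omega$ avoids $P$ with tolerance $s$ if $d(q(t),P)>s$ for all $t\in[0,T]$; obstacle avoidance with tolerance $s$ is feasible if such a curve in $\Omega$ exists. *)

theory Defs
  imports "HOL-Analysis.Analysis"
begin

section \<open>Smooth manifolds and tangent vectors\<close>

primrec Ck_on :: "nat \<Rightarrow> 'a set \<Rightarrow> ('a::real_normed_vector \<Rightarrow> 'b::real_normed_vector) \<Rightarrow> bool" where
  "Ck_on 0 S f \<longleftrightarrow> continuous_on S f"
| "Ck_on (Suc k) S f \<longleftrightarrow>
     (\<forall>x\<in>S. f differentiable (at x)) \<and> (\<forall>v. Ck_on k S (\<lambda>x. frechet_derivative f (at x) v))"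

(* Only used for open S. *)
definition smooth_on :: "'a set \<Rightarrow> ('a::real_normed_vector \<Rightarrow> 'b::real_normed_vector) \<Rightarrow> bool" where
  "smooth_on S f \<longleftrightarrow> (\<forall>k. Ck_on k S f)"

(* A chart is a pair of its domain and its coordinate map; the values of the coordinate map
   outside the domain are irrelevant. *)
type_synonym ('q, 'e) chart = "'q set \<times> ('q \<Rightarrow> 'e)"

definition chart_inv :: "('q, 'e) chart \<Rightarrow> 'e \<Rightarrow> 'q" where
  "chart_inv c = inv_into (fst c) (snd c)"

(* The points of the manifold are all the elements of the type 'q; A need not be maximal. *)
definition smooth_atlas ::
  "('q::{t2_space,second_countable_topology}, 'e::euclidean_space) chart set \<Rightarrow> bool" where
  "smooth_atlas A \<longleftrightarrow>
     (\<forall>c\<in>A. open (fst c) \<and> open (snd c ` fst c) \<and>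
            homeomorphism (fst c) (snd c ` fst c) (snd c) (chart_inv c)) \<and>
     (\<Union>c\<in>A. fst c) = UNIV \<and>
     (\<forall>c\<in>A. \<forall>d\<in>A. smooth_on (snd c ` (fst c \<inter> fst d)) (snd d \<circ> chart_inv c))"

definition charts_at :: "('q, 'e) chart set \<Rightarrow> 'q \<Rightarrow> ('q, 'e) chart set" where
  "charts_at A p = {c \<in> A. p \<in> fst c}"

(* A tangent vector at p is the family of its components in all the charts at p; these
   are related by the Jacobians of the chart changes. *)
type_synonym ('q, 'e) tvec = "('q, 'e) chart \<Rightarrow> 'e"

(* The tangent vector at p with components u in the chart c. *)
definition tvec_of ::
  "('q, 'e::euclidean_space) chart set \<Rightarrow> ('q, 'e) chart \<Rightarrow> 'q \<Rightarrow> 'e \<Rightarrow> ('q, 'e) tvec" where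
  "tvec_of A c p u =
     (\<lambda>d\<in>charts_at A p. frechet_derivative (snd d \<circ> chart_inv c) (at (snd c p)) u)"

definition tangent_space ::
  "('q, 'e::euclidean_space) chart set \<Rightarrow> 'q \<Rightarrow> ('q, 'e) tvec set" where
  "tangent_space A p =
     {X \<in> extensional (charts_at A p). \<forall>c\<in>charts_at A p. X = tvec_of A c p (X c)}"


section \<open>Riemannian metrics and the Levi-Civita connection\<close>

type_synonym ('q, 'e) metric_tensor = "'q \<Rightarrow> ('q, 'e) tvec \<Rightarrow> ('q, 'e) tvec \<Rightarrow> real"

definition metric_comp ::
  "('q, 'e::euclidean_space) chart set \<Rightarrow> ('q, 'e) metric_tensor \<Rightarrow> ('q, 'e) chart \<Rightarrow> 'q
     \<Rightarrow> 'e \<Rightarrow> 'e \<Rightarrow> real" where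
  "metric_comp A g c p u v = g p (tvec_of A c p u) (tvec_of A c p v)"

(* For c in charts_at A p, tvec_of A c p is the linear isomorphism from 'e onto the tangent
   space at p, so the first part says that each g p is an inner product on the tangent space. *)
definition riemannian_manifold ::
  "('q::{t2_space,second_countable_topology}, 'e::euclidean_space) chart set
     \<Rightarrow> ('q, 'e) metric_tensor \<Rightarrow> bool" where
  "riemannian_manifold A g \<longleftrightarrow>
     smooth_atlas A \<and>
     (\<forall>p. \<forall>c\<in>charts_at A p.
        bilinear (metric_comp A g c p) \<and>
        (\<forall>u v. metric_comp A g c p u v = metric_comp A g c p v u) \<and>
        (\<forall>u. u \<noteq> 0 \<longrightarrow> metric_comp A g c p u u > 0)) \<and>
     (\<forall>c\<in>A. \<forall>u v. smooth_on (snd c ` fst c) (\<lambda>x. metric_comp A g c (chart_inv c x) u v))"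

definition tnorm :: "('q, 'e) metric_tensor \<Rightarrow> 'q \<Rightarrow> ('q, 'e) tvec \<Rightarrow> real" where
  "tnorm g p X = sqrt (g p X X)"

(* Derivative of the component g(u, v) of the metric at p in the coordinate direction w. *)
definition metric_comp_deriv ::
  "('q, 'e::euclidean_space) chart set \<Rightarrow> ('q, 'e) metric_tensor \<Rightarrow> ('q, 'e) chart \<Rightarrow> 'q
     \<Rightarrow> 'e \<Rightarrow> 'e \<Rightarrow> 'e \<Rightarrow> real" where
  "metric_comp_deriv A g c p w u v =
     frechet_derivative (\<lambda>x. metric_comp A g c (chart_inv c x) u v) (at (snd c p)) w"

(* Christoffel symbols: levi_civita A g c p u v has the k-th coordinate
   \<Sum>i j. \<Gamma>^k_ij(p) u^i v^j, i.e. it is the covariant derivative along u of the vector field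
   with constant components v in the chart c.  As such fields commute, symmetry is freedom of
   torsion; the last condition is compatibility with the metric. *)
definition levi_civita ::
  "('q, 'e::euclidean_space) chart set \<Rightarrow> ('q, 'e) metric_tensor \<Rightarrow> ('q, 'e) chart \<Rightarrow> 'q
     \<Rightarrow> 'e \<Rightarrow> 'e \<Rightarrow> 'e" where
  "levi_civita A g c p =
     (THE \<Gamma>. bilinear \<Gamma> \<and>
        (\<forall>u v. \<Gamma> u v = \<Gamma> v u) \<and>
        (\<forall>u v w. metric_comp_deriv A g c p w u v =
                  metric_comp A g c p (\<Gamma> w u) v + metric_comp A g c p u (\<Gamma> w v)))"


section \<open>Curves\<close>

(* In this section I is the parameter interval of the curve q; values of q outside I are
   irrelevant.  At an endpoint of I the derivatives are one-sided. *)
definition velocity ::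
  "('q, 'e::euclidean_space) chart set \<Rightarrow> real set \<Rightarrow> (real \<Rightarrow> 'q) \<Rightarrow> real \<Rightarrow> ('q, 'e) tvec" where
  "velocity A I q t = (\<lambda>c\<in>charts_at A (q t). vector_derivative (snd c \<circ> q) (at t within I))"

(* DX/dt for a vector field X along q. *)
definition cov_deriv ::
  "('q, 'e::euclidean_space) chart set \<Rightarrow> ('q, 'e) metric_tensor \<Rightarrow> real set \<Rightarrow> (real \<Rightarrow> 'q)
     \<Rightarrow> (real \<Rightarrow> ('q, 'e) tvec) \<Rightarrow> real \<Rightarrow> ('q, 'e) tvec" where
  "cov_deriv A g I q X t =
     (\<lambda>c\<in>charts_at A (q t). vector_derivative (\<lambda>s. X s c) (at t within I) +
                             levi_civita A g c (q t) (velocity A I q t c) (X t c))"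

definition C1_on :: "real \<Rightarrow> real \<Rightarrow> (real \<Rightarrow> 'e::euclidean_space) \<Rightarrow> bool" where
  "C1_on a b x \<longleftrightarrow>
     (\<exists>x'. continuous_on {a..b} x' \<and>
           (\<forall>t\<in>{a..b}. (x has_vector_derivative x' t) (at t within {a..b})))"

(* W^{2,2} on [a,b], by the continuous representatives: x is C^1 and its derivative is the
   indefinite integral of a square integrable function x'', the weak second derivative of x. *)
definition H2_on :: "real \<Rightarrow> real \<Rightarrow> (real \<Rightarrow> 'e::euclidean_space) \<Rightarrow> bool" where
  "H2_on a b x \<longleftrightarrow>
     (\<exists>x' x''. (\<forall>t\<in>{a..b}. (x has_vector_derivative x' t) (at t within {a..b})) \<and>
        set_borel_measurable lebesgue {a..b} x'' \<and>
        set_integrable lebesgue {a..b} (\<lambda>t. (norm (x'' t))\<^sup>2) \<and>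
        (\<forall>t\<in>{a..b}. x' t = x' a + (LINT s:{a..t}|lebesgue. x'' s)))"

definition C1_curve ::
  "('q::topological_space, 'e::euclidean_space) chart set \<Rightarrow> real \<Rightarrow> real \<Rightarrow> (real \<Rightarrow> 'q) \<Rightarrow> bool" where
  "C1_curve A a b q \<longleftrightarrow>
     continuous_on {a..b} q \<and>
     (\<forall>c\<in>A. \<forall>s t. a \<le> s \<and> s < t \<and> t \<le> b \<and> q ` {s..t} \<subseteq> fst c \<longrightarrow> C1_on s t (snd c \<circ> q))"

definition H2_curve ::
  "('q::topological_space, 'e::euclidean_space) chart set \<Rightarrow> real \<Rightarrow> real \<Rightarrow> (real \<Rightarrow> 'q) \<Rightarrow> bool" where
  "H2_curve A a b q \<longleftrightarrow>
     continuous_on {a..b} q \<and>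
     (\<forall>c\<in>A. \<forall>s t. a \<le> s \<and> s < t \<and> t \<le> b \<and> q ` {s..t} \<subseteq> fst c \<longrightarrow> H2_on s t (snd c \<circ> q))"

(* C^1 on each of the closed intervals into which the finite set D divides [a,b]. *)
definition piecewise_C1_curve ::
  "('q::topological_space, 'e::euclidean_space) chart set \<Rightarrow> real \<Rightarrow> real \<Rightarrow> (real \<Rightarrow> 'q) \<Rightarrow> bool" where
  "piecewise_C1_curve A a b q \<longleftrightarrow>
     continuous_on {a..b} q \<and>
     (\<exists>D. finite D \<and>
        (\<forall>s t. a \<le> s \<and> s < t \<and> t \<le> b \<and> {s<..<t} \<inter> D = {} \<longrightarrow> C1_curve A s t q))"

definition curve_length ::
  "('q, 'e::euclidean_space) chart set \<Rightarrow> ('q, 'e) metric_tensor \<Rightarrow> real \<Rightarrow> real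
     \<Rightarrow> (real \<Rightarrow> 'q) \<Rightarrow> real" where
  "curve_length A g a b q = (LINT t:{a..b}|lebesgue. tnorm g (q t) (velocity A {a..b} q t))"

definition riem_dist ::
  "('q::topological_space, 'e::euclidean_space) chart set \<Rightarrow> ('q, 'e) metric_tensor
     \<Rightarrow> 'q \<Rightarrow> 'q \<Rightarrow> real" where
  "riem_dist A g p p' =
     Inf {curve_length A g 0 1 q | q. piecewise_C1_curve A 0 1 q \<and> q 0 = p \<and> q 1 = p'}"

(* Extended-valued, so that the distance to the empty set is \<infinity>. *)
definition riem_setdist ::
  "('q::topological_space, 'e::euclidean_space) chart set \<Rightarrow> ('q, 'e) metric_tensor
     \<Rightarrow> 'q \<Rightarrow> 'q set \<Rightarrow> ereal" where
  "riem_setdist A g m P = (INF p\<in>P. ereal (riem_dist A g m p))"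


section \<open>The variational obstacle avoidance problem\<close>

definition admissible_curves ::
  "('q::topological_space, 'e::euclidean_space) chart set \<Rightarrow> real
     \<Rightarrow> 'q \<Rightarrow> ('q, 'e) tvec \<Rightarrow> 'q \<Rightarrow> ('q, 'e) tvec \<Rightarrow> (real \<Rightarrow> 'q) set" where
  "admissible_curves A T q0 v0 qT vT =
     {q. H2_curve A 0 T q \<and> q 0 = q0 \<and> q T = qT \<and>
         velocity A {0..T} q 0 = v0 \<and> velocity A {0..T} q T = vT}"

(* For an H2 curve the second derivatives exist, and equal the weak ones, for almost all t only;
   hence the integral is with respect to the completed measure. *)
definition action ::
  "('q, 'e::euclidean_space) chart set \<Rightarrow> ('q, 'e) metric_tensor \<Rightarrow> real \<Rightarrow> ('q \<Rightarrow> real)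
     \<Rightarrow> (real \<Rightarrow> 'q) \<Rightarrow> real" where
  "action A g T V q =
     1 / 2 * (LINT t:{0..T}|lebesgue.
       (tnorm g (q t) (cov_deriv A g {0..T} q (velocity A {0..T} q) t))\<^sup>2 + V (q t))"

definition is_minimizer_on :: "('a \<Rightarrow> real) \<Rightarrow> 'a set \<Rightarrow> 'a \<Rightarrow> bool" where
  "is_minimizer_on J S x \<longleftrightarrow> x \<in> S \<and> (\<forall>y\<in>S. J x \<le> J y)"

definition avoids ::
  "('q::topological_space, 'e::euclidean_space) chart set \<Rightarrow> ('q, 'e) metric_tensor \<Rightarrow> real
     \<Rightarrow> 'q set \<Rightarrow> real \<Rightarrow> (real \<Rightarrow> 'q) \<Rightarrow> bool" where
  "avoids A g T P s q \<longleftrightarrow> (\<forall>t\<in>{0..T}. riem_setdist A g (q t) P > ereal s)"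

definition bump_potential ::
  "('q::topological_space, 'e::euclidean_space) chart set \<Rightarrow> ('q, 'e) metric_tensor
     \<Rightarrow> real \<Rightarrow> real \<Rightarrow> nat \<Rightarrow> 'q \<Rightarrow> 'q \<Rightarrow> real" where
  "bump_potential A g R \<tau> k p q =
     (if riem_dist A g p q < R
      then exp 1 * \<tau> * exp (- (1 / (1 - (riem_dist A g p q / R) ^ (2 * k))))
      else 0)"

end

theory Submission
  imports Defs
begin

text \<open>
  Along a curve that avoids \<open>P\<close> with tolerance \<open>R\<close> the potential vanishes, whatever the centres
  \<open>p\<^sub>i \<in> P\<close> and the height \<open>\<tau>\<close> are. Its action is therefore a number \<open>E / 2\<close> that depends on the
  acceleration of this curve only, and a minimizer \<open>q\<close> satisfies both
  \<open>\<integral>\<parallel>D\<^sup>2q/dt\<^sup>2\<parallel>\<^sup>2 \<le> E\<close> and \<open>\<integral>V(q(t)) dt \<le> E\<close>. The first inequality, together with the prescribed initial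
  velocity, bounds the speed of \<open>q\<close> by a constant \<open>M\<close> that does not depend on \<open>\<tau>\<close>
  (lemma \<open>H2_curve_speed_bound\<close>), so \<open>q\<close> is \<open>M\<close>-Lipschitz for the Riemannian distance
  (lemma \<open>C1_curve_lipschitz\<close>). Now let the centres form an \<open>R/8\<close>-net of \<open>P\<close>. If \<open>q\<close> came within \<open>r < R/2\<close> of
  \<open>P\<close>, it would come within \<open>5R/8\<close> of a centre, and would stay within \<open>3R/4\<close> of it during a time \<open>\<delta>\<close> that depends
  on \<open>M\<close>, \<open>R\<close> and \<open>T\<close> only. There the bump around this centre is at least a fixed multiple of \<open>\<tau>\<close>, and for
  large \<open>\<tau>\<close> this contradicts the second inequality. The exponent \<open>k = 1\<close> is enough.

  The speed bound rests on the compatibility of the Levi-Civita connection with the metric: the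
  squared speed has derivative twice the inner product of velocity and acceleration. For an \<open>H\<^sup>2\<close> curve
  the velocity is only absolutely continuous, so this identity is proved for indefinite integrals
  (lemma \<open>primitive_on_mult\<close>), and Lebesgue's differentiation theorem relates it to the pointwise
  acceleration in the action. As this acceleration is defined by its components in all charts, the
  transformation law of the Christoffel symbols (lemma \<open>levi_civita_change\<close>) is needed to evaluate its norm in a chart.
  The same local computation shows that the squared acceleration is integrable.

  The Riemannian distance is a metric (lemma \<open>Metric_space_riem_dist\<close>): connectedness provides the
  joining curves, concatenation gives the triangle inequality, and distinct points have positive distance because
  a curve must cross a coordinate ball in which the metric is comparable to the Euclidean one. This gives total
  boundedness of \<open>P\<close> its meaning as the existence of finite nets.
\<close>

section \<open>Indefinite Lebesgue integrals on the line\<close>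

text \<open>
  The points of this set are covered, in the sense of Vitali, by small intervals on which the
  increment of \<open>u\<close> differs from \<open>f t\<close> times the length by more than a
  fixed multiple of the length. A disjoint finite family of such intervals, tagged at these points,
  is a fine partial division, and Henstock's lemma makes its total error, hence its total length,
  arbitrarily small.
\<close>

lemma negligible_diff_quotient_gap:
  fixes f :: "real \<Rightarrow> 'e::euclidean_space"
  assumes f: "f integrable_on {a..b}"
    and u: "\<And>s t. a \<le> s \<Longrightarrow> s \<le> t \<Longrightarrow> t \<le> b \<Longrightarrow> (f has_integral (u t - u s)) {s..t}"
    and e: "e > 0"
  shows "negligible {t\<in>{a<..<b}. \<forall>d>0. \<exists>y\<in>{a<..<b}. y \<noteq> t \<and> \<bar>y - t\<bar> < d \<and>
            e * \<bar>y - t\<bar> < norm (u y - u t - (y - t) *\<^sub>R f t)}" (is "negligible ?E")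
  unfolding negligible_outer_le
proof (intro allI impI)
  fix \<eta> :: real assume "\<eta> > 0"
  let ?B = "\<lambda>i. cball (fst i) \<bar>snd i - fst i\<bar>"
  define e' where "e' = e * \<eta> / 2"
  have "e' > 0" using e \<open>\<eta> > 0\<close> by (simp add: e'_def)
  obtain \<gamma> where \<gamma>: "gauge \<gamma>" and
    hen: "\<And>p. \<lbrakk>p tagged_partial_division_of cbox a b; \<gamma> fine p\<rbrakk>
           \<Longrightarrow> (\<Sum>(x, k)\<in>p. norm (Henstock_Kurzweil_Integration.content k *\<^sub>R f x - integral k f)) < e'"
    using Henstock_lemma[of f a b e'] f \<open>e' > 0\<close> by (auto simp: cbox_interval)
  define bad where "bad = (\<lambda>(t, y). t \<in> {a<..<b} \<and> y \<in> {a<..<b} \<and> y \<noteq> t \<and>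
      cball t \<bar>y - t\<bar> \<subseteq> \<gamma> t \<and> e * \<bar>y - t\<bar> < norm (u y - u t - (y - t) *\<^sub>R f t))"
  obtain C where C: "countable C" "C \<subseteq> Collect bad"
    and disj: "pairwise (\<lambda>i j. disjnt (?B i) (?B j)) C"
    and neg: "negligible (?E - (\<Union>i\<in>C. ?B i))"
  proof (rule Vitali_covering_theorem_cballs[of "Collect bad" "\<lambda>i. \<bar>snd i - fst i\<bar>" ?E fst])
    show "0 < \<bar>snd i - fst i\<bar>" if "i \<in> Collect bad" for i
      using that by (auto simp: bad_def)
    fix x d :: real assume x: "x \<in> ?E" and "d > 0"
    obtain \<rho> where \<rho>: "\<rho> > 0" "ball x \<rho> \<subseteq> \<gamma> x"
      using \<gamma> openE unfolding gauge_def by metis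
    have "0 < min d \<rho>" using \<open>d > 0\<close> \<rho> by auto
    then obtain y where y: "y \<in> {a<..<b}" "y \<noteq> x" "\<bar>y - x\<bar> < min d \<rho>"
       "e * \<bar>y - x\<bar> < norm (u y - u x - (y - x) *\<^sub>R f x)"
      using x by blast
    have "cball x \<bar>y - x\<bar> \<subseteq> ball x \<rho>" using y by auto
    then have "bad (x, y)" using x y \<rho> by (auto simp: bad_def)
    then show "\<exists>i. i \<in> Collect bad \<and> x \<in> ?B i \<and> \<bar>snd i - fst i\<bar> < d"
      using y by (intro exI[of _ "(x, y)"]) auto
  qed
  define K where "K = (\<lambda>(t, y). cbox (min t y) (max t (y::real)))"
  have Ksub: "K i \<subseteq> ?B i" for i
    by (auto simp: K_def dist_real_def split: prod.splits)
  \<comment> \<open>each bad interval contributes at least \<open>e\<close> times its length to the Henstock sum\<close>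
  have gap: "e * \<bar>snd i - fst i\<bar> \<le> norm (Henstock_Kurzweil_Integration.content (K i) *\<^sub>R f (fst i) - integral (K i) f)"
    if "i \<in> C" for i
  proof -
    obtain t y where i: "i = (t, y)" by force
    have b: "bad (t, y)" using that C i by auto
    show ?thesis
    proof (cases "t < y")
      case True
      have "integral {t..y} f = u y - u t"
        using u[of t y] True b by (intro integral_unique) (auto simp: bad_def)
      then show ?thesis using b True unfolding i K_def bad_def
        by (simp add: norm_minus_commute cbox_interval min_def max_def)
    next
      case False
      have "integral {y..t} f = u t - u y"
        using u[of y t] False b by (intro integral_unique) (auto simp: bad_def)
      moreover have "norm ((t - y) *\<^sub>R f t - (u t - u y)) = norm (u y - u t - (y - t) *\<^sub>R f t)"
        by (simp add: algebra_simps)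
      ultimately show ?thesis using b False unfolding i K_def bad_def
        by (simp add: cbox_interval min_def max_def)
    qed
  qed
  let ?T = "\<Union>i\<in>C. ?B i"
  have fin: "measure lebesgue (\<Union>i\<in>C'. ?B i) \<le> \<eta>"
    if C': "C' \<subseteq> C" "finite C'" for C'
  proof -
    have inj: "inj_on (\<lambda>i. (fst i, K i)) C'"
    proof (rule inj_onI)
      fix i j assume ij: "i \<in> C'" "j \<in> C'" "(fst i, K i) = (fst j, K j)"
      show "i = j"
      proof (rule ccontr)
        assume "i \<noteq> j"
        then have "disjnt (?B i) (?B j)"
          using disj ij C' by (meson pairwiseD subsetD)
        moreover have "fst i \<in> ?B i" "fst i \<in> ?B j"
          using ij by auto
        ultimately show False by (meson disjnt_iff)
      qed
    qed
    have "(\<lambda>i. (fst i, K i)) ` C' tagged_partial_division_of cbox a b"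
      unfolding tagged_partial_division_of_def
    proof (intro conjI allI impI)
      show "finite ((\<lambda>i. (fst i, K i)) ` C')" using C' by simp
    next
      fix x L assume "(x, L) \<in> (\<lambda>i. (fst i, K i)) ` C'"
      then obtain t y where ty: "(t, y) \<in> C'" "x = t" "L = K (t, y)" by force
      then have b: "bad (t, y)" using C C' by auto
      show "x \<in> L" using ty by (auto simp: K_def)
      show "L \<subseteq> cbox a b" using ty b by (auto simp: K_def bad_def)
      show "\<exists>a b. L = cbox a b" using ty by (auto simp: K_def)
    next
      fix x1 K1 x2 K2
      assume *: "(x1, K1) \<in> (\<lambda>i. (fst i, K i)) ` C' \<and> (x2, K2) \<in> (\<lambda>i. (fst i, K i)) ` C' \<and>
         (x1, K1) \<noteq> (x2, K2)"
      then obtain i j where ij: "i \<in> C'" "j \<in> C'" "K1 = K i" "K2 = K j" "i \<noteq> j" by auto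
      then have "disjnt (?B i) (?B j)"
        using disj C' by (meson pairwiseD subsetD)
      then have "K1 \<inter> K2 = {}" using Ksub[of i] Ksub[of j] ij by (auto simp: disjnt_def)
      then show "interior K1 \<inter> interior K2 = {}" using interior_subset by blast
    qed
    moreover have "\<gamma> fine (\<lambda>i. (fst i, K i)) ` C'"
      using C C' Ksub by (fastforce simp: fine_def bad_def)
    ultimately have "(\<Sum>(x, k)\<in>(\<lambda>i. (fst i, K i)) ` C'. norm (Henstock_Kurzweil_Integration.content k *\<^sub>R f x - integral k f)) < e'"
      by (rule hen)
    then have "(\<Sum>i\<in>C'. norm (Henstock_Kurzweil_Integration.content (K i) *\<^sub>R f (fst i) - integral (K i) f)) < e'"
      by (simp add: sum.reindex[OF inj])
    moreover have "(\<Sum>i\<in>C'. e * \<bar>snd i - fst i\<bar>)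
        \<le> (\<Sum>i\<in>C'. norm (Henstock_Kurzweil_Integration.content (K i) *\<^sub>R f (fst i) - integral (K i) f))"
      using gap C' by (intro sum_mono) auto
    ultimately have "e * (\<Sum>i\<in>C'. \<bar>snd i - fst i\<bar>) < e'" by (simp add: sum_distrib_left)
    then have s: "2 * (\<Sum>i\<in>C'. \<bar>snd i - fst i\<bar>) < \<eta>"
      using e by (simp add: e'_def field_simps)
    have "measure lebesgue (\<Union>i\<in>C'. ?B i)
       \<le> (\<Sum>i\<in>C'. measure lebesgue (?B i))"
      using C' by (intro measure_UNION_le) auto
    also have "\<dots> = (\<Sum>i\<in>C'. 2 * \<bar>snd i - fst i\<bar>)"
      by (intro sum.cong) (auto simp: cball_eq_atLeastAtMost)
    finally show ?thesis using s by (simp add: sum_distrib_left)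
  qed
  have T: "?T \<in> lmeasurable" "measure lebesgue ?T \<le> \<eta>"
    using fmeasurable_UN_bound[OF C(1) _ fin] measure_UN_bound[OF C(1) _ fin] by auto
  let ?N = "?E - ?T"
  have "?T \<union> ?N \<in> lmeasurable"
    using T negligible_imp_measurable[OF neg] by (intro fmeasurable.Un) auto
  moreover have "measure lebesgue (?T \<union> ?N) \<le> \<eta>"
    using measure_Un_le[of ?T lebesgue ?N] T negligible_imp_measure0[OF neg]
      negligible_imp_measurable[OF neg] by (auto simp: fmeasurableD)
  ultimately show "\<exists>T. ?E \<subseteq> T \<and> T \<in> lmeasurable \<and> measure lebesgue T \<le> \<eta>"
    by (intro exI[of _ "?T \<union> ?N"]) auto
qed

text \<open>
  Absolute continuity of \<open>u\<close> with derivative \<open>f\<close>, stated through integrals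
  over subintervals. This is the form in which the velocity of an \<open>H\<^sup>2\<close> curve is
  given, and it is stable under the algebra below without any reference to points of
  differentiability.
\<close>

definition primitive_on :: "real \<Rightarrow> real \<Rightarrow> (real \<Rightarrow> 'e::euclidean_space) \<Rightarrow> (real \<Rightarrow> 'e) \<Rightarrow> bool" where
  "primitive_on a b u f \<longleftrightarrow> f absolutely_integrable_on {a..b} \<and>
     (\<forall>s t. a \<le> s \<and> s \<le> t \<and> t \<le> b \<longrightarrow> (f has_integral (u t - u s)) {s..t})"

text \<open>
  The covariant acceleration in the action is made of pointwise derivatives of the velocity, whereas
  an \<open>H\<^sup>2\<close> curve comes with a weak second derivative; this theorem identifies the
  two almost everywhere.
\<close>

lemma lebesgue_differentiation:
  fixes f :: "real \<Rightarrow> 'e::euclidean_space"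
  assumes "primitive_on a b u f"
  shows "negligible {t\<in>{a..b}. \<not> (u has_vector_derivative f t) (at t within {a..b})}"
proof -
  define E where "E e = {t\<in>{a<..<b}. \<forall>d>0. \<exists>y\<in>{a<..<b}. y \<noteq> t \<and> \<bar>y - t\<bar> < d \<and>
            e * \<bar>y - t\<bar> < norm (u y - u t - (y - t) *\<^sub>R f t)}" for e
  have "negligible (E (1 / Suc n))" for n
    unfolding E_def using assms
    by (intro negligible_diff_quotient_gap) (auto simp: primitive_on_def set_lebesgue_integral_eq_integral(1))
  then have "negligible ({a, b} \<union> (\<Union>n. E (1 / Suc n)))"
    by (intro negligible_Un negligible_countable_Union) auto
  moreover have "{t\<in>{a..b}. \<not> (u has_vector_derivative f t) (at t within {a..b})}
     \<subseteq> {a, b} \<union> (\<Union>n. E (1 / Suc n))"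
  proof
    fix t assume "t \<in> {t\<in>{a..b}. \<not> (u has_vector_derivative f t) (at t within {a..b})}"
    then have t: "t \<in> {a..b}" and nd: "\<not> (u has_vector_derivative f t) (at t within {a..b})" by auto
    show "t \<in> {a, b} \<union> (\<Union>n. E (1 / Suc n))"
    proof (rule ccontr)
      assume "t \<notin> {a, b} \<union> (\<Union>n. E (1 / Suc n))"
      then have tn: "t \<in> {a<..<b}" and nE: "\<And>n. t \<notin> E (1 / Suc n)" using t by auto
      have "(u has_vector_derivative f t) (at t within {a<..<b})"
        unfolding has_vector_derivative_def has_derivative_within_alt
      proof (intro conjI allI impI bounded_linear_scaleR_left)
        fix e :: real assume "e > 0"
        then obtain n where n: "1 / Suc n < e" using nat_approx_posE by blast
        obtain d where d: "d > 0" "\<And>y. y \<in> {a<..<b} \<Longrightarrow> y \<noteq> t \<Longrightarrow> \<bar>y - t\<bar> < d \<Longrightarrow>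
             norm (u y - u t - (y - t) *\<^sub>R f t) \<le> 1 / Suc n * \<bar>y - t\<bar>"
          using nE[of n] tn unfolding E_def mem_Collect_eq not_le[symmetric] by blast
        show "\<exists>d>0. \<forall>y\<in>{a<..<b}. norm (y - t) < d \<longrightarrow>
             norm (u y - u t - (y - t) *\<^sub>R f t) \<le> e * norm (y - t)"
        proof (intro exI[of _ d] conjI ballI impI d)
          fix y assume y: "y \<in> {a<..<b}" "norm (y - t) < d"
          have "1 / Suc n * \<bar>y - t\<bar> \<le> e * \<bar>y - t\<bar>" using n by (intro mult_right_mono) auto
          then show "norm (u y - u t - (y - t) *\<^sub>R f t) \<le> e * norm (y - t)"
            using d(2)[of y] y by (cases "y = t") auto
        qed
      qed
      then have "(u has_vector_derivative f t) (at t)"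
        using tn by (simp add: at_within_open[of t "{a<..<b}"])
      then show False using nd has_vector_derivative_at_within by blast
    qed
  qed
  ultimately show ?thesis by (rule negligible_subset)
qed

lemma primitive_on_cong:
  assumes "primitive_on a b u f" "\<And>t. t \<in> {a..b} \<Longrightarrow> u t = v t" "\<And>t. t \<in> {a..b} \<Longrightarrow> f t = g t"
  shows "primitive_on a b v g"
  unfolding primitive_on_def
proof (intro conjI allI impI)
  show "g absolutely_integrable_on {a..b}"
    using assms(1,3) set_integrable_cong[OF refl refl, of "{a..b}" f g] by (auto simp: primitive_on_def)
  fix s t assume st: "a \<le> s \<and> s \<le> t \<and> t \<le> b"
  then have "(f has_integral (v t - v s)) {s..t}" using assms(1,2) by (auto simp: primitive_on_def)
  then show "(g has_integral (v t - v s)) {s..t}"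
    by (rule has_integral_eq[rotated]) (use st assms(3) in auto)
qed

lemma primitive_on_continuous:
  assumes "primitive_on a b u f"
  shows "continuous_on {a..b} u"
proof -
  have "f integrable_on {a..b}"
    using assms by (auto simp: primitive_on_def set_lebesgue_integral_eq_integral(1))
  then have "continuous_on {a..b} (\<lambda>t. u a + integral {a..t} f)"
    by (intro continuous_intros indefinite_integral_continuous_1)
  moreover have "u a + integral {a..t} f = u t" if "t \<in> {a..b}" for t
    using assms that integral_unique[of f "u t - u a" "{a..t}"] by (auto simp: primitive_on_def)
  ultimately show ?thesis by (rule continuous_on_eq)
qed

lemma primitive_on_C1:
  assumes "\<And>t. t \<in> {a..b} \<Longrightarrow> (u has_vector_derivative f t) (at t within {a..b})"
    and "continuous_on {a..b} f"
  shows "primitive_on a b u f"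
  unfolding primitive_on_def
proof (intro conjI allI impI)
  show "f absolutely_integrable_on {a..b}"
    by (rule absolutely_integrable_continuous_real) fact
  fix s t assume "a \<le> s \<and> s \<le> t \<and> t \<le> b"
  then show "(f has_integral (u t - u s)) {s..t}"
    by (intro fundamental_theorem_of_calculus has_vector_derivative_within_subset[OF assms(1)]) auto
qed

lemma primitive_on_sum:
  assumes "finite I" "\<And>i. i \<in> I \<Longrightarrow> primitive_on a b (u i) (f i)"
  shows "primitive_on a b (\<lambda>t. \<Sum>i\<in>I. u i t) (\<lambda>t. \<Sum>i\<in>I. f i t)"
  using assms unfolding primitive_on_def
  by (auto simp: sum_subtractf[symmetric] intro!: absolutely_integrable_sum has_integral_sum)

lemma primitive_on_inner:
  assumes "primitive_on a b u f"
  shows "primitive_on a b (\<lambda>t. u t \<bullet> v) (\<lambda>t. f t \<bullet> v)"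
  unfolding primitive_on_def
proof (intro conjI allI impI)
  have "f absolutely_integrable_on {a..b}" using assms by (simp add: primitive_on_def)
  then have "((\<lambda>x. x \<bullet> v) \<circ> f) absolutely_integrable_on {a..b}"
    by (rule absolutely_integrable_linear) (rule bounded_linear_inner_left)
  then show "(\<lambda>t. f t \<bullet> v) absolutely_integrable_on {a..b}" by (simp add: o_def)
  fix s t assume "a \<le> s \<and> s \<le> t \<and> t \<le> b"
  then have "(f has_integral (u t - u s)) {s..t}" using assms by (auto simp: primitive_on_def)
  from has_integral_linear[OF this bounded_linear_inner_left[of v]]
  show "((\<lambda>t. f t \<bullet> v) has_integral u t \<bullet> v - u s \<bullet> v) {s..t}" by (simp add: o_def inner_diff_left)
qed

lemma absolutely_integrable_times_continuous:
  fixes f g :: "real \<Rightarrow> real"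
  assumes "f absolutely_integrable_on {a..b}" "continuous_on {a..b} g"
  shows "(\<lambda>t. f t * g t) absolutely_integrable_on {a..b}" "(\<lambda>t. g t * f t) absolutely_integrable_on {a..b}"
proof -
  have "(\<lambda>t. g t * f t) absolutely_integrable_on {a..b}"
    using assms
    by (intro absolutely_integrable_bounded_measurable_product_real)
       (auto intro: borel_measurable_continuous_on_indicator continuous_imp_measurable_on_sets_lebesgue compact_imp_bounded compact_continuous_image)
  then show "(\<lambda>t. g t * f t) absolutely_integrable_on {a..b}" "(\<lambda>t. f t * g t) absolutely_integrable_on {a..b}"
    by (simp_all add: mult.commute)
qed

text \<open>
  On a short interval \<open>[p,q]\<close> the increment of \<open>u v\<close> is exactly the
  integral of \<open>f v(q) + u(p) g\<close>, which by continuity of \<open>u\<close> and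
  \<open>v\<close> differs from the integral of \<open>f v + u g\<close> by at most \<open>e\<close>
  times the integral of \<open>\<bar>f\<bar> + \<bar>g\<bar>\<close>. Both this error bound and the
  increment are additive over adjacent intervals, so Bolzano's bisection principle spreads the bound
  to the whole interval; then \<open>e\<close> tends to 0.
\<close>

lemma primitive_on_mult:
  fixes u v :: "real \<Rightarrow> real"
  assumes u: "primitive_on a b u f" and v: "primitive_on a b v g"
  shows "primitive_on a b (\<lambda>t. u t * v t) (\<lambda>t. f t * v t + u t * g t)"
proof -
  have uc: "continuous_on {a..b} u" and vc: "continuous_on {a..b} v"
    using u v by (auto intro: primitive_on_continuous)
  have fi: "f absolutely_integrable_on {a..b}" and gi: "g absolutely_integrable_on {a..b}"
    using u v by (auto simp: primitive_on_def)
  define h where "h t = f t * v t + u t * g t" for t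
  have hi: "h absolutely_integrable_on {a..b}"
    unfolding h_def using absolutely_integrable_times_continuous fi gi uc vc
    by (intro set_integral_add) auto
  define k where "k t = \<bar>f t\<bar> + \<bar>g t\<bar>" for t
  have ki: "k integrable_on {a..b}"
    unfolding k_def using fi gi by (intro integrable_add) (auto simp: absolutely_integrable_on_def)
  have sub: "F integrable_on {s..t}" if "F integrable_on {a..b}" "a \<le> s" "t \<le> b" for F :: "real \<Rightarrow> real" and s t
    using that integrable_subinterval_real[of F a b s t] by auto
  have hi': "h integrable_on {a..b}" using hi by (simp add: set_lebesgue_integral_eq_integral(1))
  have int: "integral {s..t} h = u t * v t - u s * v s" if st: "a \<le> s" "s \<le> t" "t \<le> b" for s t
  proof -
    have bd: "\<bar>u t * v t - u s * v s - integral {s..t} h\<bar> \<le> e * integral {s..t} k"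
      if e: "e > 0" for e
    proof -
      define P where "P s' t' \<longleftrightarrow> (s \<le> s' \<and> t' \<le> t \<longrightarrow>
         \<bar>u t' * v t' - u s' * v s' - integral {s'..t'} h\<bar> \<le> e * integral {s'..t'} k)" for s' t'
      have "P s t"
      proof (rule Bolzano)
        show "s \<le> t" by fact
      next
        fix x y z assume P: "P x y" "P y z" and xyz: "x \<le> y" "y \<le> z"
        show "P x z" unfolding P_def
        proof
          assume b: "s \<le> x \<and> z \<le> t"
          have h: "integral {x..y} h + integral {y..z} h = integral {x..z} h"
            using xyz b st by (intro Henstock_Kurzweil_Integration.integral_combine sub[OF hi']) auto
          have k: "integral {x..y} k + integral {y..z} k = integral {x..z} k"
            using xyz b st by (intro Henstock_Kurzweil_Integration.integral_combine sub[OF ki]) auto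
          have "\<bar>u y * v y - u x * v x - integral {x..y} h\<bar> \<le> e * integral {x..y} k"
             "\<bar>u z * v z - u y * v y - integral {y..z} h\<bar> \<le> e * integral {y..z} k"
            using P b xyz by (auto simp: P_def)
          then show "\<bar>u z * v z - u x * v x - integral {x..z} h\<bar> \<le> e * integral {x..z} k"
            unfolding h[symmetric] k[symmetric] by (simp add: algebra_simps abs_le_iff)
        qed
      next
        fix x assume x: "s \<le> x" "x \<le> t"
        have xab: "x \<in> {a..b}" using x st by auto
        obtain d1 where d1: "d1 > 0" "\<And>y. y \<in> {a..b} \<Longrightarrow> dist y x < d1 \<Longrightarrow> dist (u y) (u x) < e / 2"
          using uc xab half_gt_zero[OF e] unfolding continuous_on_iff by blast
        obtain d2 where d2: "d2 > 0" "\<And>y. y \<in> {a..b} \<Longrightarrow> dist y x < d2 \<Longrightarrow> dist (v y) (v x) < e / 2"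
          using vc xab half_gt_zero[OF e] unfolding continuous_on_iff by blast
        have "P p q" if pq: "p \<le> x" "x \<le> q" "q - p < min d1 d2" for p q
          unfolding P_def
        proof
          assume b: "s \<le> p \<and> q \<le> t"
          have uu: "\<bar>u y - u z\<bar> < e" "\<bar>v y - v z\<bar> < e" if "y \<in> {p..q}" "z \<in> {p..q}" for y z
          proof -
            have "y \<in> {a..b}" "z \<in> {a..b}" "dist y x < d1" "dist z x < d1" "dist y x < d2" "dist z x < d2"
              using that pq b st by (auto simp: dist_real_def)
            then have "dist (u y) (u x) < e / 2" "dist (u z) (u x) < e / 2"
              "dist (v y) (v x) < e / 2" "dist (v z) (v x) < e / 2"
              using d1(2) d2(2) by blast+
            then show "\<bar>u y - u z\<bar> < e" "\<bar>v y - v z\<bar> < e" unfolding dist_real_def by linarith+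
          qed
          have F: "(f has_integral (u q - u p)) {p..q}" "(g has_integral (v q - v p)) {p..q}"
            using u v pq b st by (auto simp: primitive_on_def)
          have "((\<lambda>r. f r * v q + u p * g r) has_integral ((u q - u p) * v q + u p * (v q - v p))) {p..q}"
            by (intro has_integral_add has_integral_mult_left has_integral_mult_right F)
          then have "((\<lambda>r. f r * v q + u p * g r - h r) has_integral
             ((u q - u p) * v q + u p * (v q - v p) - integral {p..q} h)) {p..q}"
            using b st by (intro has_integral_diff integrable_integral sub[OF hi']) auto
          then have I: "((\<lambda>r. f r * v q + u p * g r - h r) has_integral
             (u q * v q - u p * v p - integral {p..q} h)) {p..q}" by (simp add: algebra_simps)
          have kk: "((\<lambda>r. e * k r) has_integral (e * integral {p..q} k)) {p..q}"
            using b st by (intro has_integral_mult_right integrable_integral sub[OF ki]) auto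
          have le: "norm (f r * v q + u p * g r - h r) \<le> e * k r" if r: "r \<in> {p..q}" for r
          proof -
            have "f r * v q + u p * g r - h r = f r * (v q - v r) + (u p - u r) * g r"
              by (simp add: h_def algebra_simps)
            also have "\<bar>\<dots>\<bar> \<le> \<bar>f r\<bar> * \<bar>v q - v r\<bar> + \<bar>u p - u r\<bar> * \<bar>g r\<bar>"
              by (metis abs_mult abs_triangle_ineq)
            also have "\<dots> \<le> \<bar>f r\<bar> * e + e * \<bar>g r\<bar>"
              using uu[of q r] uu[of p r] r pq by (intro add_mono mult_mono) auto
            finally show ?thesis by (simp add: k_def algebra_simps)
          qed
          show "\<bar>u q * v q - u p * v p - integral {p..q} h\<bar> \<le> e * integral {p..q} k"
            using integral_norm_bound_integral[OF has_integral_integrable[OF I] has_integral_integrable[OF kk] le]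
            by (simp add: integral_unique[OF I] integral_unique[OF kk] del: integral_mult_right)
        qed
        then show "\<exists>d>0. \<forall>p q. p \<le> x \<and> x \<le> q \<and> q - p < d \<longrightarrow> P p q"
          using d1 d2 by (intro exI[of _ "min d1 d2"]) auto
      qed
      then show ?thesis by (simp add: P_def)
    qed
    have "\<bar>u t * v t - u s * v s - integral {s..t} h\<bar> \<le> 0 + e" if "e > 0" for e
    proof -
      define I where "I = integral {s..t} k"
      have "I \<ge> 0" unfolding I_def using sub[OF ki] st
        by (intro Henstock_Kurzweil_Integration.integral_nonneg) (auto simp: k_def)
      have "\<bar>u t * v t - u s * v s - integral {s..t} h\<bar> \<le> e / (I + 1) * I"
        using bd[of "e / (I + 1)"] that \<open>I \<ge> 0\<close> by (simp add: I_def)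
      also have "\<dots> \<le> e" using that \<open>I \<ge> 0\<close> by (simp add: field_simps)
      finally show ?thesis by simp
    qed
    then have "\<bar>u t * v t - u s * v s - integral {s..t} h\<bar> \<le> 0" by (rule field_le_epsilon)
    then show ?thesis by simp
  qed
  show ?thesis unfolding primitive_on_def h_def[symmetric]
  proof (intro conjI allI impI hi)
    fix s t assume st: "a \<le> s \<and> s \<le> t \<and> t \<le> b"
    then show "(h has_integral u t * v t - u s * v s) {s..t}"
      using int[of s t] sub[OF hi', of s t] by (metis integrable_integral)
  qed
qed


section \<open>Smooth maps and fields of bilinear forms\<close>

lemma smooth_on_has_derivative:
  assumes "smooth_on S f" "x \<in> S"
  shows "(f has_derivative frechet_derivative f (at x)) (at x)"
proof -
  have "Ck_on (Suc 0) S f" using assms by (simp add: smooth_on_def del: Ck_on.simps)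
  then show ?thesis using assms by (auto simp: frechet_derivative_works)
qed

lemma smooth_on_frechet_derivative:
  assumes "smooth_on S f"
  shows "smooth_on S (\<lambda>x. frechet_derivative f (at x) v)"
  unfolding smooth_on_def
proof
  fix k
  have "Ck_on (Suc k) S f" using assms by (simp add: smooth_on_def del: Ck_on.simps)
  then show "Ck_on k S (\<lambda>x. frechet_derivative f (at x) v)" by auto
qed

lemma smooth_on_continuous_on:
  assumes "smooth_on S f"
  shows "continuous_on S f"
  using assms Ck_on.simps(1)[of S f] unfolding smooth_on_def by blast

lemma linear_frechet_derivative:
  assumes "smooth_on S f" "x \<in> S"
  shows "linear (frechet_derivative f (at x))"
  using smooth_on_has_derivative[OF assms] has_derivative_linear by blast

lemma linear_basis_expansion:
  fixes f :: "'a::euclidean_space \<Rightarrow> 'b::real_vector"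
  assumes "linear f"
  shows "f w = (\<Sum>b\<in>Basis. (w \<bullet> b) *\<^sub>R f b)"
proof -
  have "f w = f (\<Sum>b\<in>Basis. (w \<bullet> b) *\<^sub>R b)" by (simp add: euclidean_representation)
  also have "\<dots> = (\<Sum>b\<in>Basis. (w \<bullet> b) *\<^sub>R f b)"
    by (simp add: linear_sum[OF assms] linear_scale[OF assms])
  finally show ?thesis .
qed

lemma has_vector_derivative_chain:
  assumes "(x has_vector_derivative x') (at t within I)"
    and "(f has_derivative f') (at (x t))"
  shows "((\<lambda>s. f (x s)) has_vector_derivative f' x') (at t within I)"
proof -
  have "((\<lambda>s. f (x s)) has_derivative (\<lambda>h. f' (h *\<^sub>R x'))) (at t within I)"
    using assms(1)[unfolded has_vector_derivative_def] assms(2) by (rule has_derivative_compose)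
  moreover have "f' (h *\<^sub>R x') = h *\<^sub>R f' x'" for h
    using has_derivative_linear[OF assms(2)] by (rule linear_scale)
  ultimately show ?thesis by (simp add: has_vector_derivative_def)
qed

text \<open>
  The mean value theorem, applied in the direction \<open>u\<close> and then in the direction
  \<open>v\<close>.
\<close>

lemma second_difference_mean_value:
  fixes \<phi> :: "'a::real_normed_vector \<Rightarrow> real"
  assumes D: "\<And>y. y \<in> S \<Longrightarrow> (\<phi> has_derivative D y) (at y)"
    and E: "\<And>y. y \<in> S \<Longrightarrow> ((\<lambda>z. D z u) has_derivative E y) (at y)"
    and S: "\<And>s t. 0 \<le> s \<Longrightarrow> s \<le> h \<Longrightarrow> 0 \<le> t \<Longrightarrow> t \<le> h \<Longrightarrow> x + s *\<^sub>R u + t *\<^sub>R v \<in> S"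
    and h: "h > 0"
  obtains \<xi> \<eta> where "0 < \<xi>" "\<xi> < h" "0 < \<eta>" "\<eta> < h"
    "\<phi> (x + h *\<^sub>R u + h *\<^sub>R v) - \<phi> (x + h *\<^sub>R u) - \<phi> (x + h *\<^sub>R v) + \<phi> x
       = h * h * E (x + \<xi> *\<^sub>R u + \<eta> *\<^sub>R v) v"
proof -
  have Su: "x + s *\<^sub>R u \<in> S" if "0 \<le> s" "s \<le> h" for s using S[of s 0] that h by auto
  define g where "g s = \<phi> (x + s *\<^sub>R u + h *\<^sub>R v) - \<phi> (x + s *\<^sub>R u)" for s
  have line: "((\<lambda>s. y + s *\<^sub>R w) has_vector_derivative w) (at s)" for y w :: 'a and s
    by (auto intro!: derivative_eq_intros simp: has_vector_derivative_def)
  have line': "((\<lambda>s. x + s *\<^sub>R u + h *\<^sub>R v) has_vector_derivative u) (at s)" for s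
    using line[of "x + h *\<^sub>R v" u s] by (simp add: algebra_simps)
  have g: "(g has_real_derivative (D (x + s *\<^sub>R u + h *\<^sub>R v) u - D (x + s *\<^sub>R u) u)) (at s)"
    if "0 \<le> s" "s \<le> h" for s
    unfolding g_def has_real_derivative_iff_has_vector_derivative
    using that h
    by (intro has_vector_derivative_diff has_vector_derivative_chain[OF line' D]
        has_vector_derivative_chain[OF line D] S Su) auto
  obtain \<xi> where \<xi>: "0 < \<xi>" "\<xi> < h"
    and gx: "g h - g 0 = (h - 0) * (D (x + \<xi> *\<^sub>R u + h *\<^sub>R v) u - D (x + \<xi> *\<^sub>R u) u)"
    using MVT2[OF h g] by auto
  have d: "((\<lambda>t. D (x + \<xi> *\<^sub>R u + t *\<^sub>R v) u) has_real_derivative E (x + \<xi> *\<^sub>R u + t *\<^sub>R v) v) (at t)"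
    if "0 \<le> t" "t \<le> h" for t
    unfolding has_real_derivative_iff_has_vector_derivative
    using that \<xi> by (intro has_vector_derivative_chain[OF line E] S) auto
  obtain \<eta> where \<eta>: "0 < \<eta>" "\<eta> < h"
    and "D (x + \<xi> *\<^sub>R u + h *\<^sub>R v) u - D (x + \<xi> *\<^sub>R u + 0 *\<^sub>R v) u = (h - 0) * E (x + \<xi> *\<^sub>R u + \<eta> *\<^sub>R v) v"
    using MVT2[OF h d] by auto
  with gx have "g h - g 0 = h * (h * E (x + \<xi> *\<^sub>R u + \<eta> *\<^sub>R v) v)" by simp
  then show thesis using \<xi> \<eta> by (intro that[of \<xi> \<eta>]) (auto simp: g_def)
qed

text \<open>
  The second difference is symmetric in \<open>u\<close> and \<open>v\<close>, and divided by
  \<open>h\<^sup>2\<close> it tends to either of the mixed derivatives.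
\<close>

lemma second_derivatives_commute_real:
  fixes \<phi> :: "'a::real_normed_vector \<Rightarrow> real"
  assumes S: "open S" "x \<in> S"
    and D: "\<And>y. y \<in> S \<Longrightarrow> (\<phi> has_derivative D y) (at y)"
    and E: "\<And>y. y \<in> S \<Longrightarrow> ((\<lambda>z. D z u) has_derivative E y) (at y)"
    and F: "\<And>y. y \<in> S \<Longrightarrow> ((\<lambda>z. D z v) has_derivative F y) (at y)"
    and cE: "continuous_on S (\<lambda>y. E y v)" and cF: "continuous_on S (\<lambda>y. F y u)"
  shows "E x v = F x u"
proof -
  have "\<bar>E x v - F x u\<bar> \<le> 0 + e" if "e > 0" for e
  proof -
    have "\<forall>\<^sub>F y in nhds x. y \<in> S" using S by (rule eventually_nhds_in_open)
    moreover have "\<forall>\<^sub>F y in nhds x. dist (E y v) (E x v) < e / 2"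
      using cE S half_gt_zero[OF that]
      by (auto simp: continuous_on_eq_continuous_at continuous_at_eps_delta eventually_nhds_metric simp del: less_divide_eq_numeral1)
    moreover have "\<forall>\<^sub>F y in nhds x. dist (F y u) (F x u) < e / 2"
      using cF S half_gt_zero[OF that]
      by (auto simp: continuous_on_eq_continuous_at continuous_at_eps_delta eventually_nhds_metric simp del: less_divide_eq_numeral1)
    ultimately have "\<forall>\<^sub>F y in nhds x. y \<in> S \<and> dist (E y v) (E x v) < e / 2 \<and> dist (F y u) (F x u) < e / 2"
      by eventually_elim auto
    then obtain d where d: "d > 0"
      "\<And>y. dist y x < d \<Longrightarrow> y \<in> S \<and> dist (E y v) (E x v) < e / 2 \<and> dist (F y u) (F x u) < e / 2"
      by (auto simp: eventually_nhds_metric)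
    define h where "h = d / (norm u + norm v + 1)"
    have pos: "norm u + norm v + 1 > 0" by (simp add: add_nonneg_pos)
    then have h: "h > 0" using d by (simp add: h_def)
    have near: "dist (x + s *\<^sub>R u + t *\<^sub>R v) x < d" if "0 \<le> s" "s \<le> h" "0 \<le> t" "t \<le> h" for s t
    proof -
      have "dist (x + s *\<^sub>R u + t *\<^sub>R v) x = norm (s *\<^sub>R u + t *\<^sub>R v)" by (simp add: dist_norm)
      also have "\<dots> \<le> s * norm u + t * norm v" using norm_triangle_ineq[of "s *\<^sub>R u" "t *\<^sub>R v"] that by simp
      also have "\<dots> \<le> h * norm u + h * norm v" using that by (intro add_mono mult_right_mono) auto
      also have "\<dots> < h * (norm u + norm v + 1)" using h by (simp add: algebra_simps)
      also have "\<dots> = d" using pos by (simp add: h_def)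
      finally show ?thesis .
    qed
    then have near': "dist (x + s *\<^sub>R v + t *\<^sub>R u) x < d" if "0 \<le> s" "s \<le> h" "0 \<le> t" "t \<le> h" for s t
      using near[of t s] that by (simp add: add.commute add.left_commute)
    obtain \<xi> \<eta> where 1: "0 < \<xi>" "\<xi> < h" "0 < \<eta>" "\<eta> < h"
      "\<phi> (x + h *\<^sub>R u + h *\<^sub>R v) - \<phi> (x + h *\<^sub>R u) - \<phi> (x + h *\<^sub>R v) + \<phi> x = h * h * E (x + \<xi> *\<^sub>R u + \<eta> *\<^sub>R v) v"
      by (rule second_difference_mean_value[of S \<phi> D u E h x v]) (use D E d(2) near h in auto)
    obtain \<xi>' \<eta>' where 2: "0 < \<xi>'" "\<xi>' < h" "0 < \<eta>'" "\<eta>' < h"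
      "\<phi> (x + h *\<^sub>R v + h *\<^sub>R u) - \<phi> (x + h *\<^sub>R v) - \<phi> (x + h *\<^sub>R u) + \<phi> x = h * h * F (x + \<xi>' *\<^sub>R v + \<eta>' *\<^sub>R u) u"
      by (rule second_difference_mean_value[of S \<phi> D v F h x u]) (use D F d(2) near' h in auto)
    have "x + h *\<^sub>R v + h *\<^sub>R u = x + h *\<^sub>R u + h *\<^sub>R v" by (simp add: algebra_simps)
    from 1(5) 2(5)[unfolded this] have "h * h * E (x + \<xi> *\<^sub>R u + \<eta> *\<^sub>R v) v = h * h * F (x + \<xi>' *\<^sub>R v + \<eta>' *\<^sub>R u) u"
      by linarith
    then have "E (x + \<xi> *\<^sub>R u + \<eta> *\<^sub>R v) v = F (x + \<xi>' *\<^sub>R v + \<eta>' *\<^sub>R u) u" using h by simp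
    moreover have "dist (E (x + \<xi> *\<^sub>R u + \<eta> *\<^sub>R v) v) (E x v) < e / 2"
      using 1 d(2)[OF near[of \<xi> \<eta>]] by simp
    moreover have "dist (F (x + \<xi>' *\<^sub>R v + \<eta>' *\<^sub>R u) u) (F x u) < e / 2"
      using 2 d(2)[OF near'[of \<xi>' \<eta>']] by simp
    ultimately show ?thesis unfolding dist_real_def by linarith
  qed
  then have "\<bar>E x v - F x u\<bar> \<le> 0" by (rule field_le_epsilon)
  then show ?thesis by simp
qed

lemma second_derivatives_commute:
  fixes f :: "'a::real_normed_vector \<Rightarrow> 'b::euclidean_space"
  assumes f: "smooth_on S f" and S: "open S" "x \<in> S"
  shows "frechet_derivative (\<lambda>y. frechet_derivative f (at y) u) (at x) v =
         frechet_derivative (\<lambda>y. frechet_derivative f (at y) v) (at x) u"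
proof (rule euclidean_eqI)
  fix b :: 'b assume "b \<in> Basis"
  let ?D2 = "\<lambda>u x. frechet_derivative (\<lambda>y. frechet_derivative f (at y) u) (at x)"
  have D2: "((\<lambda>z. frechet_derivative f (at z) u \<bullet> b) has_derivative (\<lambda>w. ?D2 u y w \<bullet> b)) (at y)"
    if "y \<in> S" for y u
    using smooth_on_has_derivative[OF smooth_on_frechet_derivative[OF f] that]
    by (rule has_derivative_inner_left)
  have c: "continuous_on S (\<lambda>y. ?D2 u y v \<bullet> b)" for u v
    by (intro continuous_intros smooth_on_continuous_on smooth_on_frechet_derivative f)
  show "?D2 u x v \<bullet> b = ?D2 v x u \<bullet> b"
    using S by (rule second_derivatives_commute_real[OF _ _ has_derivative_inner_left D2 D2 c c])
      (rule smooth_on_has_derivative[OF f])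
qed

text \<open>
  The derivative in the direction \<open>z\<close> is linear in \<open>z\<close>; as the mixed
  derivatives commute, the slot of \<open>w\<close> is linear too.
\<close>

lemma frechet_derivative_second_linear:
  fixes f :: "'a::euclidean_space \<Rightarrow> 'b::euclidean_space"
  assumes f: "smooth_on S f" and S: "open S" "x \<in> S"
  shows "frechet_derivative (\<lambda>y. frechet_derivative f (at y) w) (at x) z =
     (\<Sum>b\<in>Basis. (w \<bullet> b) *\<^sub>R frechet_derivative (\<lambda>y. frechet_derivative f (at y) b) (at x) z)"
proof -
  have "linear (frechet_derivative (\<lambda>y. frechet_derivative f (at y) z) (at x))"
    by (rule linear_frechet_derivative[OF smooth_on_frechet_derivative[OF f] S(2)])
  from linear_basis_expansion[OF this, of w] show ?thesis
    by (simp add: second_derivatives_commute[OF f S, of z])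
qed

lemma bilinear_second_derivative:
  fixes f :: "'a::euclidean_space \<Rightarrow> 'b::euclidean_space"
  assumes f: "smooth_on S f" and S: "open S" "x \<in> S"
  shows "bilinear (\<lambda>u v. frechet_derivative (\<lambda>y. frechet_derivative f (at y) u) (at x) v)"
proof -
  let ?D2 = "\<lambda>u v. frechet_derivative (\<lambda>y. frechet_derivative f (at y) u) (at x) v"
  have l: "linear (?D2 u)" for u
    by (rule linear_frechet_derivative[OF smooth_on_frechet_derivative[OF f] S(2)])
  have "(\<lambda>u. ?D2 u v) = ?D2 v" for v
    by (rule ext) (rule second_derivatives_commute[OF f S])
  then have "linear (\<lambda>u. ?D2 u v)" for v using l by simp
  with l show ?thesis unfolding bilinear_def by blast
qed

text \<open>
  The product rule for a derivative evaluated at a moving point on a moving vector. It gives the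
  second derivative of a change of coordinates along a curve.
\<close>

lemma has_vector_derivative_frechet_derivative_along:
  fixes f :: "'a::euclidean_space \<Rightarrow> 'b::euclidean_space"
  assumes f: "smooth_on S f" and S: "open S" "x t \<in> S" and t: "t \<in> I"
    and x: "(x has_vector_derivative x') (at t within I)"
    and w: "(w has_vector_derivative w') (at t within I)"
  shows "((\<lambda>s. frechet_derivative f (at (x s)) (w s)) has_vector_derivative
     (frechet_derivative f (at (x t)) w' +
      frechet_derivative (\<lambda>y. frechet_derivative f (at y) (w t)) (at (x t)) x')) (at t within I)"
proof -
  let ?D = "\<lambda>x. frechet_derivative f (at x)"
  let ?D2 = "\<lambda>u x. frechet_derivative (\<lambda>y. frechet_derivative f (at y) u) (at x)"
  have "((\<lambda>s. \<Sum>b\<in>Basis. (w s \<bullet> b) *\<^sub>R ?D (x s) b) has_vector_derivative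
     (\<Sum>b\<in>Basis. (w t \<bullet> b) *\<^sub>R ?D2 b (x t) x' + (w' \<bullet> b) *\<^sub>R ?D (x t) b)) (at t within I)"
    by (intro has_vector_derivative_sum has_vector_derivative_scaleR
         has_vector_derivative_chain[OF x] smooth_on_has_derivative[OF smooth_on_frechet_derivative[OF f]] S
         bounded_linear.has_vector_derivative[OF bounded_linear_inner_left, THEN has_real_derivative_iff_has_vector_derivative[THEN iffD2]] w)
  moreover have "(\<Sum>b\<in>Basis. (w t \<bullet> b) *\<^sub>R ?D2 b (x t) x' + (w' \<bullet> b) *\<^sub>R ?D (x t) b) = ?D (x t) w' + ?D2 (w t) (x t) x'"
    unfolding sum.distrib frechet_derivative_second_linear[OF f S, of "w t"]
      linear_basis_expansion[OF linear_frechet_derivative[OF f S(2)], of w'] by simp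
  moreover obtain d where d: "d > 0" "\<And>s. s \<in> I \<Longrightarrow> dist s t < d \<Longrightarrow> x s \<in> S"
  proof -
    have "continuous (at t within I) x" using x by (rule has_vector_derivative_continuous)
    then have "\<forall>\<^sub>F s in at t within I. x s \<in> S"
      using S unfolding continuous_within by (blast dest: topological_tendstoD)
    then show thesis using that S unfolding eventually_at by (metis)
  qed
  ultimately show ?thesis
    unfolding has_vector_derivative_def
    by (auto elim!: has_derivative_transform_within[OF _ d(1) t]
          simp: linear_basis_expansion[OF linear_frechet_derivative[OF f d(2)], symmetric])
qed

lemma continuous_on_frechet_derivative_along:
  fixes f :: "'a::euclidean_space \<Rightarrow> 'b::euclidean_space"
  assumes f: "smooth_on S f" and "continuous_on I x" "continuous_on I w" "\<And>t. t \<in> I \<Longrightarrow> x t \<in> S"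
  shows "continuous_on I (\<lambda>s. frechet_derivative f (at (x s)) (w s))"
proof -
  have "continuous_on I (\<lambda>s. frechet_derivative f (at (x s)) b)" for b
    using assms(4)
    by (intro continuous_on_compose2[OF smooth_on_continuous_on[OF smooth_on_frechet_derivative[OF f]] assms(2)]) auto
  then have "continuous_on I (\<lambda>s. \<Sum>b\<in>Basis. (w s \<bullet> b) *\<^sub>R frechet_derivative f (at (x s)) b)"
    by (intro continuous_intros assms)
  then show ?thesis
    by (rule continuous_on_eq)
       (simp add: linear_basis_expansion[OF linear_frechet_derivative[OF f assms(4)], symmetric])
qed

text \<open>
  The coordinate expression of a Riemannian metric is such a field.
\<close>

definition smooth_forms_on :: "'a set \<Rightarrow> ('a \<Rightarrow> 'a::euclidean_space \<Rightarrow> 'a \<Rightarrow> real) \<Rightarrow> bool" where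
  "smooth_forms_on S B \<longleftrightarrow> open S \<and> (\<forall>x\<in>S. bilinear (B x)) \<and> (\<forall>u v. smooth_on S (\<lambda>x. B x u v))"

abbreviation form_deriv :: "('a \<Rightarrow> 'a::euclidean_space \<Rightarrow> 'a \<Rightarrow> real) \<Rightarrow> 'a \<Rightarrow> 'a \<Rightarrow> 'a \<Rightarrow> 'a \<Rightarrow> real" where
  "form_deriv B x w u v \<equiv> frechet_derivative (\<lambda>y. B y u v) (at x) w"

lemma bilinear_basis_expansion:
  fixes B :: "'a::euclidean_space \<Rightarrow> 'a \<Rightarrow> 'b::real_vector"
  assumes "bilinear B"
  shows "B u v = (\<Sum>i\<in>Basis. \<Sum>j\<in>Basis. ((u \<bullet> i) * (v \<bullet> j)) *\<^sub>R B i j)"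
proof -
  have "linear (\<lambda>u. B u v)" "\<And>u. linear (B u)" using assms by (auto simp: bilinear_def)
  then have "B u v = (\<Sum>i\<in>Basis. (u \<bullet> i) *\<^sub>R B i v)" "B i v = (\<Sum>j\<in>Basis. (v \<bullet> j) *\<^sub>R B i j)" for i
    by (auto intro: linear_basis_expansion)
  then show ?thesis by (simp add: scaleR_right.sum)
qed

lemma bilinearI_of_expansion:
  fixes B :: "'a::euclidean_space \<Rightarrow> 'a \<Rightarrow> 'b::real_vector"
  assumes "\<And>u v. B u v = (\<Sum>i\<in>Basis. \<Sum>j\<in>Basis. ((u \<bullet> i) * (v \<bullet> j)) *\<^sub>R C i j)"
  shows "bilinear B"
proof -
  have "linear (\<lambda>u. \<Sum>i\<in>Basis. \<Sum>j\<in>Basis. ((u \<bullet> i) * (v \<bullet> j)) *\<^sub>R C i j)" for v :: 'a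
    by (intro linear_compose_sum ballI linearI)
       (simp_all add: inner_add_left distrib_right scaleR_add_left)
  moreover have "linear (\<lambda>v. \<Sum>i\<in>Basis. \<Sum>j\<in>Basis. ((u \<bullet> i) * (v \<bullet> j)) *\<^sub>R C i j)" for u :: 'a
    by (intro linear_compose_sum ballI linearI)
       (simp_all add: inner_add_left distrib_left scaleR_add_left mult.left_commute)
  moreover have "B = (\<lambda>u v. \<Sum>i\<in>Basis. \<Sum>j\<in>Basis. ((u \<bullet> i) * (v \<bullet> j)) *\<^sub>R C i j)"
    using assms by blast
  ultimately show ?thesis by (simp add: bilinear_def)
qed

lemma form_deriv_expansion:
  assumes B: "smooth_forms_on S B" and x: "x \<in> S"
  shows "form_deriv B x w u v = (\<Sum>i\<in>Basis. \<Sum>j\<in>Basis. ((u \<bullet> i) * (v \<bullet> j)) *\<^sub>R form_deriv B x w i j)"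
proof -
  have "((\<lambda>y. \<Sum>i\<in>Basis. \<Sum>j\<in>Basis. ((u \<bullet> i) * (v \<bullet> j)) *\<^sub>R B y i j) has_derivative
     (\<lambda>w. \<Sum>i\<in>Basis. \<Sum>j\<in>Basis. ((u \<bullet> i) * (v \<bullet> j)) *\<^sub>R form_deriv B x w i j)) (at x)"
    using B x by (intro has_derivative_sum has_derivative_scaleR_right smooth_on_has_derivative[of S])
      (auto simp: smooth_forms_on_def)
  then have "((\<lambda>y. B y u v) has_derivative
     (\<lambda>w. \<Sum>i\<in>Basis. \<Sum>j\<in>Basis. ((u \<bullet> i) * (v \<bullet> j)) *\<^sub>R form_deriv B x w i j)) (at x)"
  proof (rule has_derivative_transform_within_open)
    show "open S" "x \<in> S" using B x by (auto simp: smooth_forms_on_def)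
    fix y assume "y \<in> S"
    then have "bilinear (B y)" using B by (auto simp: smooth_forms_on_def)
    from bilinear_basis_expansion[OF this, of u v]
    show "(\<Sum>i\<in>Basis. \<Sum>j\<in>Basis. ((u \<bullet> i) * (v \<bullet> j)) *\<^sub>R B y i j) = B y u v" by (rule sym)
  qed
  from fun_cong[OF frechet_derivative_at[OF this], of w] show ?thesis by (rule sym)
qed

lemma bilinear_form_deriv:
  assumes "smooth_forms_on S B" and "x \<in> S"
  shows "bilinear (form_deriv B x w)"
  by (rule bilinearI_of_expansion) (rule form_deriv_expansion[OF assms])

lemma linear_form_deriv:
  assumes "smooth_forms_on S B" and "x \<in> S"
  shows "linear (\<lambda>w. form_deriv B x w u v)"
  using assms by (intro linear_frechet_derivative[of S]) (auto simp: smooth_forms_on_def)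

lemma continuous_on_smooth_form:
  assumes B: "smooth_forms_on S B" and "continuous_on I x" "continuous_on I u" "continuous_on I v"
    "\<And>t. t \<in> I \<Longrightarrow> x t \<in> S"
  shows "continuous_on I (\<lambda>t. B (x t) (u t) (v t))"
proof -
  have "smooth_on S (\<lambda>x. B x i j)" for i j using B by (auto simp: smooth_forms_on_def)
  then have "continuous_on I (\<lambda>t. B (x t) i j)" for i j
    by (rule continuous_on_compose2[OF smooth_on_continuous_on assms(2)]) (use assms(5) in auto)
  then have "continuous_on I (\<lambda>t. \<Sum>i\<in>Basis. \<Sum>j\<in>Basis. ((u t \<bullet> i) * (v t \<bullet> j)) *\<^sub>R B (x t) i j)"
    by (intro continuous_intros assms)
  moreover have "(\<Sum>i\<in>Basis. \<Sum>j\<in>Basis. ((u t \<bullet> i) * (v t \<bullet> j)) *\<^sub>R B (x t) i j) = B (x t) (u t) (v t)"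
    if "t \<in> I" for t
    using B assms(5)[OF that] by (intro bilinear_basis_expansion[symmetric]) (auto simp: smooth_forms_on_def)
  ultimately show ?thesis by (rule continuous_on_eq)
qed

lemma primitive_on_smooth_form:
  assumes B: "smooth_forms_on S B"
    and x: "\<And>t. t \<in> {a..b} \<Longrightarrow> (x has_vector_derivative x' t) (at t within {a..b})"
    and x': "continuous_on {a..b} x'" and xS: "\<And>t. t \<in> {a..b} \<Longrightarrow> x t \<in> S"
    and u: "primitive_on a b u f" and v: "primitive_on a b v g"
  shows "primitive_on a b (\<lambda>t. B (x t) (u t) (v t))
     (\<lambda>t. form_deriv B (x t) (x' t) (u t) (v t) + B (x t) (f t) (v t) + B (x t) (u t) (g t))"
proof -
  have Bs: "smooth_on S (\<lambda>x. B x i j)" for i j using B by (auto simp: smooth_forms_on_def)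
  have xc: "continuous_on {a..b} x"
    unfolding continuous_on_eq_continuous_within using has_vector_derivative_continuous[OF x] by blast
  have p: "primitive_on a b (\<lambda>t. B (x t) i j) (\<lambda>t. form_deriv B (x t) (x' t) i j)" for i j
    by (intro primitive_on_C1 has_vector_derivative_chain[OF x] smooth_on_has_derivative[OF Bs] xS
        continuous_on_frechet_derivative_along[OF Bs] xc x')
  have "primitive_on a b (\<lambda>t. \<Sum>i\<in>Basis. \<Sum>j\<in>Basis. ((u t \<bullet> i) * (v t \<bullet> j)) * B (x t) i j)
     (\<lambda>t. \<Sum>i\<in>Basis. \<Sum>j\<in>Basis. ((f t \<bullet> i) * (v t \<bullet> j) + (u t \<bullet> i) * (g t \<bullet> j)) * B (x t) i j
            + ((u t \<bullet> i) * (v t \<bullet> j)) * form_deriv B (x t) (x' t) i j)"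
    by (intro primitive_on_sum primitive_on_mult primitive_on_inner u v p finite_Basis)
  then show ?thesis
  proof (rule primitive_on_cong)
    fix t assume t: "t \<in> {a..b}"
    have bl: "bilinear (B (x t))" using B xS[OF t] by (auto simp: smooth_forms_on_def)
    show "(\<Sum>i\<in>Basis. \<Sum>j\<in>Basis. u t \<bullet> i * (v t \<bullet> j) * B (x t) i j) = B (x t) (u t) (v t)"
      by (simp add: bilinear_basis_expansion[OF bl, of "u t" "v t"])
    show "(\<Sum>i\<in>Basis. \<Sum>j\<in>Basis. (f t \<bullet> i * (v t \<bullet> j) + u t \<bullet> i * (g t \<bullet> j)) * B (x t) i j +
             u t \<bullet> i * (v t \<bullet> j) * form_deriv B (x t) (x' t) i j) =
         form_deriv B (x t) (x' t) (u t) (v t) + B (x t) (f t) (v t) + B (x t) (u t) (g t)"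
      unfolding form_deriv_expansion[OF B xS[OF t], where u="u t" and v="v t"]
        bilinear_basis_expansion[OF bl, of "f t" "v t"] bilinear_basis_expansion[OF bl, of "u t" "g t"]
      by (simp add: algebra_simps sum.distrib)
  qed
qed


section \<open>Positive definite forms and the Koszul formula\<close>

definition pos_def_form :: "('a::euclidean_space \<Rightarrow> 'a \<Rightarrow> real) \<Rightarrow> bool" where
  "pos_def_form B \<longleftrightarrow> bilinear B \<and> (\<forall>u v. B u v = B v u) \<and> (\<forall>u. u \<noteq> 0 \<longrightarrow> B u u > 0)"

lemma pos_def_form_nonneg:
  assumes "pos_def_form B"
  shows "B u u \<ge> 0"
  using assms bilinear_lzero[of B 0] by (cases "u = 0") (auto simp: pos_def_form_def intro: less_imp_le)

lemma pos_def_form_cauchy_schwarz: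
  assumes B: "pos_def_form B"
  shows "\<bar>B u v\<bar> \<le> sqrt (B u u) * sqrt (B v v)"
proof -
  have bl: "bilinear B" and sym: "B v u = B u v" using B by (auto simp: pos_def_form_def)
  show ?thesis
  proof (cases "v = 0")
    case True
    then show ?thesis using bilinear_rzero[OF bl] by simp
  next
    case False
    then have vv: "B v v > 0" using B by (auto simp: pos_def_form_def)
    define c where "c = B u v / B v v"
    have "0 \<le> B (u - c *\<^sub>R v) (u - c *\<^sub>R v)" by (rule pos_def_form_nonneg[OF B])
    also have "\<dots> = B u u - 2 * c * B u v + c * c * B v v"
      by (simp add: bilinear_lsub[OF bl] bilinear_rsub[OF bl] bilinear_lmul[OF bl] bilinear_rmul[OF bl] sym algebra_simps)
    also have "\<dots> = B u u - (B u v)\<^sup>2 / B v v"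
      using vv by (simp add: c_def field_simps power2_eq_square)
    finally have "(B u v)\<^sup>2 \<le> B u u * B v v" using vv by (simp add: field_simps)
    then have "sqrt ((B u v)\<^sup>2) \<le> sqrt (B u u * B v v)" by (rule real_sqrt_le_mono)
    then show ?thesis by (simp add: real_sqrt_mult)
  qed
qed

lemma pos_def_form_eqI:
  assumes B: "pos_def_form B" and "\<And>v. B z v = B z' v"
  shows "z = z'"
proof (rule ccontr)
  assume "z \<noteq> z'"
  then have "B (z - z') (z - z') > 0" using B by (auto simp: pos_def_form_def)
  moreover have "B (z - z') (z - z') = 0"
    using B assms(2)[of "z - z'"] by (simp add: pos_def_form_def bilinear_lsub[of B])
  ultimately show False by simp
qed

text \<open>
  A positive definite form is injective as a map into the dual space, hence bijective by dimension.
\<close>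

lemma pos_def_form_riesz:
  assumes B: "pos_def_form B" and \<phi>: "linear \<phi>"
  shows "\<exists>z. \<forall>v. B z v = \<phi> v"
proof -
  have bl: "bilinear B" using B by (simp add: pos_def_form_def)
  define L where "L z = (\<Sum>b\<in>Basis. B z b *\<^sub>R b)" for z
  have L: "L z \<bullet> b = B z b" if "b \<in> Basis" for z b using that by (simp add: L_def)
  have "linear L"
    unfolding L_def
    by (auto intro!: linearI simp: bilinear_ladd[OF bl] bilinear_lmul[OF bl] scaleR_add_left sum.distrib scaleR_right.sum)
  moreover have "inj L"
  proof (rule injI)
    fix z z' assume "L z = L z'"
    then have "B z b = B z' b" if "b \<in> Basis" for b using L that by metis
    then have "B z = B z'" using bl by (intro linear_eq_stdbasis) (auto simp: bilinear_def)
    then show "z = z'" using pos_def_form_eqI[OF B] by metis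
  qed
  ultimately have "surj L" by (rule linear_inj_imp_surj)
  then obtain z where "L z = (\<Sum>b\<in>Basis. \<phi> b *\<^sub>R b)" by (metis surjD)
  then have "B z b = \<phi> b" if "b \<in> Basis" for b
    using that L[of b z] by simp
  then have "B z = \<phi>" using bl \<phi> by (intro linear_eq_stdbasis) (auto simp: bilinear_def)
  then show ?thesis by auto
qed

text \<open>
  The conditions that characterize the Christoffel symbols in a chart, where \<open>D w u v\<close>
  is the derivative of the metric component \<open>B u v\<close> in the direction \<open>w\<close>:
  symmetry means absence of torsion, and the last clause is compatibility with the metric.
\<close>

definition koszul_map ::
  "('a::euclidean_space \<Rightarrow> 'a \<Rightarrow> real) \<Rightarrow> ('a \<Rightarrow> 'a \<Rightarrow> 'a \<Rightarrow> real) \<Rightarrow> ('a \<Rightarrow> 'a \<Rightarrow> 'a) \<Rightarrow> bool" where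
  "koszul_map B D \<Gamma> \<longleftrightarrow> bilinear \<Gamma> \<and> (\<forall>u v. \<Gamma> u v = \<Gamma> v u) \<and>
     (\<forall>u v w. D w u v = B (\<Gamma> w u) v + B u (\<Gamma> w v))"

text \<open>
  In the alternating sum of the three cyclic instances of metric compatibility everything but
  \<open>\<Gamma> u v\<close> cancels by symmetry. Uniqueness follows, and the right-hand side also
  serves to construct the connection.
\<close>

lemma koszul_formula:
  assumes B: "pos_def_form B" and \<Gamma>: "koszul_map B D \<Gamma>"
  shows "B (\<Gamma> u v) w = (D u v w + D v u w - D w u v) / 2"
proof -
  have D: "D w u v = B (\<Gamma> w u) v + B u (\<Gamma> w v)" and \<Gamma>s: "\<Gamma> u v = \<Gamma> v u" for u v w
    using \<Gamma> by (auto simp: koszul_map_def)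
  have Bs: "B u v = B v u" for u v using B by (auto simp: pos_def_form_def)
  have "D u v w = B (\<Gamma> u v) w + B v (\<Gamma> u w)" by (rule D)
  moreover have "D v u w = B (\<Gamma> u v) w + B u (\<Gamma> v w)" by (metis D \<Gamma>s)
  moreover have "D w u v = B v (\<Gamma> u w) + B u (\<Gamma> v w)" by (metis D \<Gamma>s Bs)
  ultimately show ?thesis by simp
qed

lemma koszul_map_unique:
  assumes B: "pos_def_form B" and "koszul_map B D \<Gamma>" "koszul_map B D \<Gamma>'"
  shows "\<Gamma> = \<Gamma>'"
proof (intro ext)
  fix u v
  show "\<Gamma> u v = \<Gamma>' u v"
    by (rule pos_def_form_eqI[OF B]) (simp add: koszul_formula[OF B assms(2)] koszul_formula[OF B assms(3)])
qed

lemma koszul_map_exists: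
  assumes B: "pos_def_form B"
    and D1: "\<And>u v. linear (\<lambda>w. D w u v)" and D2: "\<And>w. bilinear (D w)"
    and Ds: "\<And>u v w. D w u v = D w v u"
  shows "\<exists>\<Gamma>. koszul_map B D \<Gamma>"
proof -
  have bl: "bilinear B" and Bs: "B u v = B v u" for u v using B by (auto simp: pos_def_form_def)
  have "linear (\<lambda>w. (D u v w + D v u w - D w u v) / 2)" for u v
    using D1[of u v] D2[of u] D2[of v] unfolding bilinear_def
    by (auto simp: linear_iff algebra_simps add_divide_distrib diff_divide_distrib)
  then have "\<exists>z. \<forall>w. B z w = (D u v w + D v u w - D w u v) / 2" for u v
    by (rule pos_def_form_riesz[OF B])
  then obtain \<Gamma> where \<Gamma>: "\<And>u v w. B (\<Gamma> u v) w = (D u v w + D v u w - D w u v) / 2" by metis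
  have sym: "\<Gamma> u v = \<Gamma> v u" for u v
    by (rule pos_def_form_eqI[OF B]) (simp add: \<Gamma> Ds[of _ u v] add.commute)
  have lin: "linear (\<lambda>u. \<Gamma> u v)" for v
  proof (rule linearI)
    fix a b show "\<Gamma> (a + b) v = \<Gamma> a v + \<Gamma> b v"
      by (rule pos_def_form_eqI[OF B])
         (simp add: \<Gamma> bilinear_ladd[OF bl] linear_add[OF D1] bilinear_ladd[OF D2] bilinear_radd[OF D2] field_simps)
    fix c show "\<Gamma> (c *\<^sub>R a) v = c *\<^sub>R \<Gamma> a v"
      by (rule pos_def_form_eqI[OF B])
         (simp add: \<Gamma> bilinear_lmul[OF bl] linear_scale[OF D1] bilinear_lmul[OF D2] bilinear_rmul[OF D2] field_simps)
  qed
  have "linear (\<Gamma> u)" for u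
  proof -
    have "(\<lambda>v. \<Gamma> v u) = \<Gamma> u" using sym by blast
    then show ?thesis using lin[of u] by (rule subst[where P = linear])
  qed
  with lin have "bilinear \<Gamma>" unfolding bilinear_def by blast
  moreover have "D w u v = B (\<Gamma> w u) v + B u (\<Gamma> w v)" for u v w
    unfolding Bs[of u] \<Gamma> using Ds[of u w v] Ds[of v w u] Ds[of w u v] by (simp add: field_simps)
  ultimately show ?thesis using sym by (auto simp: koszul_map_def)
qed

text \<open>
  The form is continuous and positive on the compact product of a closed ball with the unit sphere,
  so it has a positive minimum there.
\<close>

lemma smooth_form_locally_coercive:
  assumes B: "smooth_forms_on S B" and pd: "\<And>x. x \<in> S \<Longrightarrow> pos_def_form (B x)" and x0: "x0 \<in> S"
  obtains \<rho> l where "\<rho> > 0" "l > 0" "cball x0 \<rho> \<subseteq> S"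
    "\<And>x w. x \<in> cball x0 \<rho> \<Longrightarrow> l * (norm w)\<^sup>2 \<le> B x w w"
proof -
  have "open S" using B by (simp add: smooth_forms_on_def)
  then obtain \<rho> where \<rho>: "\<rho> > 0" "cball x0 \<rho> \<subseteq> S" using x0 open_contains_cball by blast
  let ?K = "cball x0 \<rho> \<times> sphere (0::'a) 1"
  have cont: "continuous_on ?K (\<lambda>p. B (fst p) (snd p) (snd p))"
    using \<rho> by (intro continuous_on_smooth_form[OF B] continuous_intros) auto
  have K: "compact ?K" by (intro compact_Times) auto
  obtain b :: 'a where "b \<in> Basis" using nonempty_Basis by blast
  then have "(x0, b) \<in> ?K" using \<rho> by auto
  then have "?K \<noteq> {}" by blast
  then obtain p where p: "p \<in> ?K" "\<And>q. q \<in> ?K \<Longrightarrow> B (fst p) (snd p) (snd p) \<le> B (fst q) (snd q) (snd q)"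
    using continuous_attains_inf[OF K _ cont] by blast
  define l where "l = B (fst p) (snd p) (snd p)"
  have "fst p \<in> S" "snd p \<noteq> 0" using p(1) \<rho> by auto
  then have "l > 0" using pd by (auto simp: l_def pos_def_form_def)
  moreover have "l * (norm w)\<^sup>2 \<le> B x w w" if x: "x \<in> cball x0 \<rho>" for x w
  proof (cases "w = 0")
    case True
    then show ?thesis using pos_def_form_nonneg[of "B x"] pd x \<rho> by (simp add: subset_iff)
  next
    case False
    have bl: "bilinear (B x)" using B x \<rho> by (auto simp: smooth_forms_on_def)
    have "l \<le> B x (w /\<^sub>R norm w) (w /\<^sub>R norm w)"
      using p(2)[of "(x, w /\<^sub>R norm w)"] x False by (auto simp: l_def)
    also have "\<dots> = B x w w / (norm w)\<^sup>2"
      by (simp add: bilinear_lmul[OF bl] bilinear_rmul[OF bl] power2_eq_square divide_simps)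
    finally show ?thesis using False by (simp add: field_simps)
  qed
  ultimately show thesis using that \<rho> by blast
qed

text \<open>
  Applied to the Koszul formula this shows that the Christoffel symbols are continuous. The
  difference \<open>z x - z x0\<close> represents a functional whose components tend to 0 as
  \<open>x\<close> tends to \<open>x0\<close>, and coercivity of the form bounds the representing
  vector by those components.
\<close>

lemma continuous_on_riesz_representative:
  assumes B: "smooth_forms_on S B" and pd: "\<And>x. x \<in> S \<Longrightarrow> pos_def_form (B x)"
    and K: "\<And>w. continuous_on S (\<lambda>x. K x w)" and z: "\<And>x w. x \<in> S \<Longrightarrow> B x (z x) w = K x w"
  shows "continuous_on S z"
proof -
  have S: "open S" using B by (simp add: smooth_forms_on_def)
  have "(z \<longlongrightarrow> z x0) (at x0)" if x0: "x0 \<in> S" for x0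
  proof -
    obtain \<rho> l where \<rho>: "\<rho> > 0" "l > 0" "cball x0 \<rho> \<subseteq> S"
      and co: "\<And>x w. x \<in> cball x0 \<rho> \<Longrightarrow> l * (norm w)\<^sup>2 \<le> B x w w"
      using smooth_form_locally_coercive[OF B pd x0] by blast
    define e where "e x = (\<Sum>b\<in>Basis. \<bar>K x b - B x (z x0) b\<bar>)" for x
    have le: "norm (z x - z x0) \<le> e x / l" if x: "x \<in> cball x0 \<rho>" for x
    proof -
      let ?w = "z x - z x0"
      have xS: "x \<in> S" using x \<rho> by auto
      have bl: "bilinear (B x)" using B xS by (auto simp: smooth_forms_on_def)
      have "l * (norm ?w)\<^sup>2 \<le> B x ?w ?w" using co[OF x] .
      also have "B x ?w ?w = (\<Sum>b\<in>Basis. (?w \<bullet> b) *\<^sub>R B x ?w b)"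
        using bl by (intro linear_basis_expansion) (simp add: bilinear_def)
      also have "\<dots> = (\<Sum>b\<in>Basis. (?w \<bullet> b) * (K x b - B x (z x0) b))"
        by (simp add: bilinear_lsub[OF bl] z[OF xS])
      also have "\<dots> \<le> (\<Sum>b\<in>Basis. norm ?w * \<bar>K x b - B x (z x0) b\<bar>)"
      proof (rule sum_mono)
        fix b :: 'a assume "b \<in> Basis"
        have "(?w \<bullet> b) * (K x b - B x (z x0) b) \<le> \<bar>?w \<bullet> b\<bar> * \<bar>K x b - B x (z x0) b\<bar>"
          by (metis abs_ge_self abs_mult)
        also have "\<dots> \<le> norm ?w * \<bar>K x b - B x (z x0) b\<bar>"
          using Basis_le_norm[OF \<open>b \<in> Basis\<close>, of ?w] by (intro mult_right_mono) auto
        finally show "(?w \<bullet> b) * (K x b - B x (z x0) b) \<le> norm ?w * \<bar>K x b - B x (z x0) b\<bar>" .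
      qed
      also have "\<dots> = norm ?w * e x" by (simp add: e_def sum_distrib_left)
      finally have "norm ?w * (l * norm ?w) \<le> norm ?w * e x" by (simp add: power2_eq_square mult_ac)
      moreover have "e x \<ge> 0" by (simp add: e_def sum_nonneg)
      ultimately have "l * norm ?w \<le> e x" by (cases "norm ?w = 0") (auto simp: mult_le_cancel_left)
      then show ?thesis using \<rho> by (simp add: field_simps)
    qed
    have "continuous_on S e"
      unfolding e_def using B
      by (intro continuous_intros K continuous_on_smooth_form[OF B]) auto
    then have "(e \<longlongrightarrow> e x0) (at x0)"
      using S x0 by (auto simp: continuous_on_eq_continuous_at continuous_at)
    moreover have "e x0 = 0" by (simp add: e_def z[OF x0])
    ultimately have e0: "((\<lambda>x. e x / l) \<longlongrightarrow> 0) (at x0)"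
      using tendsto_divide[of e 0 "at x0" "\<lambda>_. l" l] \<rho> by auto
    have "\<forall>\<^sub>F x in at x0. norm (z x - z x0) \<le> e x / l"
      unfolding eventually_at using \<rho> le by (intro exI[of _ \<rho>]) (auto simp: dist_commute)
    then have "((\<lambda>x. z x - z x0) \<longlongrightarrow> 0) (at x0)" using e0 by (rule Lim_null_comparison)
    then show ?thesis using LIM_zero_iff by blast
  qed
  then show ?thesis using S by (simp add: continuous_on_eq_continuous_at continuous_at)
qed


section \<open>Charts, metric and Levi-Civita connection\<close>

lemma has_vector_derivative_smooth_form:
  assumes B: "smooth_forms_on S B" and t: "t \<in> I"
    and x: "(x has_vector_derivative x') (at t within I)" and xS: "\<And>s. s \<in> I \<Longrightarrow> x s \<in> S"
    and u: "(u has_vector_derivative u') (at t within I)"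
    and v: "(v has_vector_derivative v') (at t within I)"
  shows "((\<lambda>t. B (x t) (u t) (v t)) has_real_derivative
     (form_deriv B (x t) x' (u t) (v t) + B (x t) u' (v t) + B (x t) (u t) v')) (at t within I)"
proof -
  have Bs: "smooth_on S (\<lambda>x. B x i j)" for i j using B by (auto simp: smooth_forms_on_def)
  have p: "((\<lambda>t. B (x t) i j) has_real_derivative form_deriv B (x t) x' i j) (at t within I)" for i j
    unfolding has_real_derivative_iff_has_vector_derivative
    by (intro has_vector_derivative_chain[OF x] smooth_on_has_derivative[OF Bs] xS t)
  have uv: "((\<lambda>t. u t \<bullet> i) has_real_derivative u' \<bullet> i) (at t within I)"
    "((\<lambda>t. v t \<bullet> i) has_real_derivative v' \<bullet> i) (at t within I)" for i
    unfolding has_real_derivative_iff_has_vector_derivative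
    by (rule bounded_linear.has_vector_derivative[OF bounded_linear_inner_left], rule u v)+
  have bl: "bilinear (B (x s))" if "s \<in> I" for s using B xS that by (auto simp: smooth_forms_on_def)
  have "((\<lambda>t. \<Sum>i\<in>Basis. \<Sum>j\<in>Basis. ((u t \<bullet> i) * (v t \<bullet> j)) * B (x t) i j) has_real_derivative
     (\<Sum>i\<in>Basis. \<Sum>j\<in>Basis. ((u' \<bullet> i) * (v t \<bullet> j) + (v' \<bullet> j) * (u t \<bullet> i)) * B (x t) i j
            + form_deriv B (x t) x' i j * ((u t \<bullet> i) * (v t \<bullet> j)))) (at t within I)"
    by (intro DERIV_sum DERIV_mult uv p)
  then have "((\<lambda>t. B (x t) (u t) (v t)) has_real_derivative
     (\<Sum>i\<in>Basis. \<Sum>j\<in>Basis. ((u' \<bullet> i) * (v t \<bullet> j) + (v' \<bullet> j) * (u t \<bullet> i)) * B (x t) i j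
            + form_deriv B (x t) x' i j * ((u t \<bullet> i) * (v t \<bullet> j)))) (at t within I)"
    by (rule has_field_derivative_transform_within[OF _ zero_less_one t])
       (simp add: bilinear_basis_expansion[OF bl, symmetric, unfolded real_scaleR_def])
  moreover have "(\<Sum>i\<in>Basis. \<Sum>j\<in>Basis. ((u' \<bullet> i) * (v t \<bullet> j) + (v' \<bullet> j) * (u t \<bullet> i)) * B (x t) i j
            + form_deriv B (x t) x' i j * ((u t \<bullet> i) * (v t \<bullet> j))) =
      form_deriv B (x t) x' (u t) (v t) + B (x t) u' (v t) + B (x t) (u t) v'"
    unfolding form_deriv_expansion[OF B xS[OF t], where u = "u t" and v = "v t"]
      bilinear_basis_expansion[OF bl[OF t], of u' "v t"] bilinear_basis_expansion[OF bl[OF t], of "u t" v']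
    by (simp add: algebra_simps sum.distrib)
  ultimately show ?thesis by simp
qed

lemma mem_charts_at: "c \<in> charts_at A p \<longleftrightarrow> c \<in> A \<and> p \<in> fst c"
  by (simp add: charts_at_def)

locale riemannian =
  fixes A :: "('q::{t2_space,second_countable_topology}, 'e::euclidean_space) chart set"
    and g :: "('q, 'e) metric_tensor"
  assumes riemannian: "riemannian_manifold A g"
begin

lemma atlas: "smooth_atlas A"
  using riemannian by (simp add: riemannian_manifold_def)

lemma open_chart_domain: "c \<in> A \<Longrightarrow> open (fst c)"
  and open_chart_image: "c \<in> A \<Longrightarrow> open (snd c ` fst c)"
  and chart_homeomorphism: "c \<in> A \<Longrightarrow> homeomorphism (fst c) (snd c ` fst c) (snd c) (chart_inv c)"
  using atlas by (auto simp: smooth_atlas_def)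

lemma ex_chart: "\<exists>c. c \<in> charts_at A p"
proof -
  have "(\<Union>c\<in>A. fst c) = UNIV" using atlas by (simp add: smooth_atlas_def)
  then have "p \<in> (\<Union>c\<in>A. fst c)" by blast
  then show ?thesis unfolding mem_charts_at by blast
qed

lemma chart_inv_chart [simp]: "c \<in> A \<Longrightarrow> p \<in> fst c \<Longrightarrow> chart_inv c (snd c p) = p"
  and chart_chart_inv [simp]: "c \<in> A \<Longrightarrow> x \<in> snd c ` fst c \<Longrightarrow> snd c (chart_inv c x) = x"
  and chart_inv_in_domain: "c \<in> A \<Longrightarrow> x \<in> snd c ` fst c \<Longrightarrow> chart_inv c x \<in> fst c"
  and continuous_on_chart: "c \<in> A \<Longrightarrow> continuous_on (fst c) (snd c)"
  and continuous_on_chart_inv: "c \<in> A \<Longrightarrow> continuous_on (snd c ` fst c) (chart_inv c)"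
  using chart_homeomorphism[of c] by (auto simp: homeomorphism_def)

abbreviation overlap :: "('q, 'e) chart \<Rightarrow> ('q, 'e) chart \<Rightarrow> 'e set" where
  "overlap c d \<equiv> snd c ` (fst c \<inter> fst d)"

abbreviation transition :: "('q, 'e) chart \<Rightarrow> ('q, 'e) chart \<Rightarrow> 'e \<Rightarrow> 'e" where
  "transition c d \<equiv> snd d \<circ> chart_inv c"

lemma smooth_transition: "c \<in> A \<Longrightarrow> d \<in> A \<Longrightarrow> smooth_on (overlap c d) (transition c d)"
  using atlas by (simp add: smooth_atlas_def)

lemma open_overlap: "c \<in> A \<Longrightarrow> d \<in> A \<Longrightarrow> open (overlap c d)"
proof -
  assume c: "c \<in> A" and d: "d \<in> A"
  have "openin (top_of_set (snd c ` fst c)) (snd c ` (fst c \<inter> fst d))"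
    using open_chart_domain[OF d] homeomorphism_imp_open_map[OF chart_homeomorphism[OF c], of "fst c \<inter> fst d"]
    by (auto simp: openin_open)
  then show ?thesis using open_chart_image[OF c] openin_open_trans by blast
qed

lemma tvec_of_apply:
  "d \<in> charts_at A p \<Longrightarrow> tvec_of A c p u d = frechet_derivative (transition c d) (at (snd c p)) u"
  by (simp add: tvec_of_def)

lemma transition_has_derivative:
  assumes "c \<in> charts_at A p" "d \<in> charts_at A p"
  shows "(transition c d has_derivative (\<lambda>u. tvec_of A c p u d)) (at (snd c p))"
proof -
  have "(transition c d has_derivative frechet_derivative (transition c d) (at (snd c p))) (at (snd c p))"
    using assms by (intro smooth_on_has_derivative[OF smooth_transition]) (auto simp: mem_charts_at)
  then show ?thesis using assms by (simp add: tvec_of_apply)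
qed

lemma linear_tvec_of:
  "c \<in> charts_at A p \<Longrightarrow> d \<in> charts_at A p \<Longrightarrow> linear (\<lambda>u. tvec_of A c p u d)"
  by (rule has_derivative_linear[OF transition_has_derivative])

lemma tvec_of_self:
  assumes c: "c \<in> charts_at A p"
  shows "tvec_of A c p u c = u"
proof -
  have cA: "c \<in> A" "p \<in> fst c" using c by (auto simp: mem_charts_at)
  have "(transition c c has_derivative (\<lambda>u. u)) (at (snd c p))"
    by (rule has_derivative_transform_within_open[OF has_derivative_ident open_chart_image[OF cA(1)]])
       (use cA in auto)
  from has_derivative_unique[OF this transition_has_derivative[OF c c]] show ?thesis by metis
qed

text \<open>
  The chain rule for coordinate changes: the tangent vector defined by components in one chart does
  not depend on the chart in which they are read off.
\<close>

lemma tvec_of_change: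
  assumes c: "c \<in> charts_at A p" and d: "d \<in> charts_at A p"
  shows "tvec_of A d p (tvec_of A c p u d) = tvec_of A c p u"
proof
  fix e
  show "tvec_of A d p (tvec_of A c p u d) e = tvec_of A c p u e"
  proof (cases "e \<in> charts_at A p")
    case False
    then show ?thesis by (simp add: tvec_of_def)
  next
    case e: True
    have A: "c \<in> A" "d \<in> A" "e \<in> A" "p \<in> fst c" "p \<in> fst d" "p \<in> fst e"
      using c d e by (auto simp: mem_charts_at)
    have "(transition c d has_derivative (\<lambda>u. tvec_of A c p u d)) (at (snd c p))"
      by (rule transition_has_derivative[OF c d])
    moreover have "(transition d e has_derivative (\<lambda>u. tvec_of A d p u e)) (at (transition c d (snd c p)))"
      using transition_has_derivative[OF d e] A by simp
    ultimately have "(transition d e \<circ> transition c d has_derivative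
        (\<lambda>u. tvec_of A d p u e) \<circ> (\<lambda>u. tvec_of A c p u d)) (at (snd c p))"
      by (rule diff_chain_at)
    then have "(transition c e has_derivative
        (\<lambda>u. tvec_of A d p u e) \<circ> (\<lambda>u. tvec_of A c p u d)) (at (snd c p))"
      by (rule has_derivative_transform_within_open[OF _ open_overlap[OF A(1,2)]])
         (use A in auto)
    from has_derivative_unique[OF this transition_has_derivative[OF c e]] show ?thesis
      by (metis comp_apply)
  qed
qed

lemma transition_has_vector_derivative:
  assumes "c \<in> charts_at A (q t)" "d \<in> charts_at A (q t)"
    and x: "(snd c \<circ> q has_vector_derivative u) (at t within I)" and q: "continuous (at t within I) q" and t: "t \<in> I"
  shows "(snd d \<circ> q has_vector_derivative tvec_of A c (q t) u d) (at t within I)"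
proof -
  have A: "c \<in> A" "d \<in> A" "q t \<in> fst c" "q t \<in> fst d" using assms by (auto simp: mem_charts_at)
  have "((\<lambda>s. transition c d ((snd c \<circ> q) s)) has_vector_derivative tvec_of A c (q t) u d) (at t within I)"
    by (rule has_vector_derivative_chain[OF x]) (use transition_has_derivative[OF assms(1,2)] in \<open>simp add: o_def\<close>)
  moreover have "\<forall>\<^sub>F s in at t within I. q s \<in> fst c"
    using q A open_chart_domain[OF A(1)] unfolding continuous_within by (blast dest: topological_tendstoD)
  then obtain \<delta> where "\<delta> > 0" "\<And>s. s \<in> I \<Longrightarrow> dist s t < \<delta> \<Longrightarrow> q s \<in> fst c"
    using A unfolding eventually_at by metis
  ultimately show ?thesis
    using A t unfolding has_vector_derivative_def
    by (elim has_derivative_transform_within) auto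
qed

lemma metric_comp_pos_def: "c \<in> charts_at A p \<Longrightarrow> pos_def_form (metric_comp A g c p)"
  using riemannian by (simp add: riemannian_manifold_def pos_def_form_def)

lemma metric_comp_change:
  assumes "c \<in> charts_at A p" "d \<in> charts_at A p"
  shows "metric_comp A g c p u v = metric_comp A g d p (tvec_of A c p u d) (tvec_of A c p v d)"
  by (simp add: metric_comp_def tvec_of_change[OF assms])

abbreviation metric_form :: "('q, 'e) chart \<Rightarrow> 'e \<Rightarrow> 'e \<Rightarrow> 'e \<Rightarrow> real" where
  "metric_form c x \<equiv> metric_comp A g c (chart_inv c x)"

lemma smooth_metric_form: "c \<in> A \<Longrightarrow> smooth_forms_on (snd c ` fst c) (metric_form c)"
  using riemannian open_chart_image chart_inv_in_domain
  unfolding smooth_forms_on_def riemannian_manifold_def by (auto simp: mem_charts_at)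

lemma metric_form_pos_def: "c \<in> A \<Longrightarrow> x \<in> snd c ` fst c \<Longrightarrow> pos_def_form (metric_form c x)"
  using metric_comp_pos_def chart_inv_in_domain by (auto simp: mem_charts_at)

lemma koszul_levi_civita:
  assumes c: "c \<in> charts_at A p"
  shows "koszul_map (metric_comp A g c p) (metric_comp_deriv A g c p) (levi_civita A g c p)"
proof -
  let ?x = "snd c p" and ?D = "metric_comp_deriv A g c p"
  have A: "c \<in> A" "?x \<in> snd c ` fst c" using c by (auto simp: mem_charts_at)
  have D: "?D = (\<lambda>w u v. form_deriv (metric_form c) ?x w u v)"
    by (simp add: metric_comp_deriv_def fun_eq_iff)
  have "linear (\<lambda>w. ?D w u v)" for u v
    unfolding D by (rule linear_form_deriv[OF smooth_metric_form[OF A(1)] A(2)])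
  moreover have "bilinear (?D w)" for w
    using bilinear_form_deriv[OF smooth_metric_form[OF A(1)] A(2), of w] by (simp add: D)
  moreover have "?D w u v = ?D w v u" for u v w
  proof -
    have "((\<lambda>x. metric_form c x u v) has_derivative (\<lambda>w. ?D w u v)) (at ?x)"
      unfolding D using smooth_metric_form[OF A(1)] A(2)
      by (intro smooth_on_has_derivative[of "snd c ` fst c"]) (auto simp: smooth_forms_on_def)
    then have "((\<lambda>x. metric_form c x v u) has_derivative (\<lambda>w. ?D w u v)) (at ?x)"
      by (rule has_derivative_transform_within_open[OF _ open_chart_image[OF A(1)] A(2)])
         (use metric_form_pos_def[OF A(1)] in \<open>auto simp: pos_def_form_def\<close>)
    from fun_cong[OF frechet_derivative_at[OF this], of w] show ?thesis
      by (simp add: metric_comp_deriv_def)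
  qed
  ultimately obtain \<Gamma> where \<Gamma>: "koszul_map (metric_comp A g c p) ?D \<Gamma>"
    using koszul_map_exists[OF metric_comp_pos_def[OF c]] by blast
  have "levi_civita A g c p = (THE \<Gamma>. koszul_map (metric_comp A g c p) ?D \<Gamma>)"
    by (simp add: levi_civita_def koszul_map_def)
  also have "\<dots> = \<Gamma>"
    using \<Gamma> koszul_map_unique[OF metric_comp_pos_def[OF c]] by (intro the_equality) auto
  finally show ?thesis using \<Gamma> by simp
qed

abbreviation transition_hessian :: "('q, 'e) chart \<Rightarrow> ('q, 'e) chart \<Rightarrow> 'q \<Rightarrow> 'e \<Rightarrow> 'e \<Rightarrow> 'e" where
  "transition_hessian c d p u v \<equiv>
     frechet_derivative (\<lambda>y. frechet_derivative (transition c d) (at y) u) (at (snd c p)) v"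

text \<open>
  The transformation law of the Christoffel symbols. The connection of the chart \<open>d\<close>,
  pulled back to the chart \<open>c\<close> with the Hessian of the coordinate change added, is
  symmetric because mixed derivatives commute, and is compatible with the metric by differentiating
  the change of coordinates of the metric. By uniqueness it is the connection of the chart
  \<open>c\<close>.
\<close>

lemma levi_civita_change:
  assumes c: "c \<in> charts_at A p" and d: "d \<in> charts_at A p"
  shows "levi_civita A g d p (tvec_of A c p u d) (tvec_of A c p v d) + transition_hessian c d p u v =
     tvec_of A c p (levi_civita A g c p u v) d"
proof -
  let ?x = "snd c p" and ?S = "overlap c d" and ?f = "transition c d" and ?H = "transition_hessian c d p"
  let ?J = "\<lambda>u. tvec_of A c p u d" and ?K = "\<lambda>u. tvec_of A d p u c"
  let ?Gc = "metric_comp A g c p" and ?Gd = "metric_comp A g d p"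
  have A: "c \<in> A" "d \<in> A" "p \<in> fst c" "p \<in> fst d" using c d by (auto simp: mem_charts_at)
  have S: "open ?S" "?x \<in> ?S" using open_overlap A by auto
  have f: "smooth_on ?S ?f" by (rule smooth_transition[OF A(1,2)])
  have JK: "?J (?K u) = u" for u
    using tvec_of_change[OF d c] tvec_of_self[OF d] by simp
  have J: "linear ?J" and K: "linear ?K" using linear_tvec_of c d by auto
  have Hb: "bilinear ?H" by (rule bilinear_second_derivative[OF f S])
  have Hs: "?H u v = ?H v u" for u v by (rule second_derivatives_commute[OF f S])
  have \<Gamma>d: "koszul_map ?Gd (metric_comp_deriv A g d p) (levi_civita A g d p)" by (rule koszul_levi_civita[OF d])
  have bl: "bilinear ?Gd" using metric_comp_pos_def[OF d] by (simp add: pos_def_form_def)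
  define \<Gamma>' where "\<Gamma>' u v = ?K (levi_civita A g d p (?J u) (?J v) + ?H u v)" for u v
  have "koszul_map ?Gc (metric_comp_deriv A g c p) \<Gamma>'"
    unfolding koszul_map_def
  proof (intro conjI allI)
    have lb: "bilinear (levi_civita A g d p)" using \<Gamma>d by (simp add: koszul_map_def)
    show "bilinear \<Gamma>'"
      unfolding bilinear_def \<Gamma>'_def
      by (auto intro!: linearI simp: linear_add[OF J] linear_scale[OF J] linear_add[OF K] linear_scale[OF K]
        bilinear_ladd[OF lb] bilinear_radd[OF lb] bilinear_lmul[OF lb] bilinear_rmul[OF lb]
        bilinear_ladd[OF Hb] bilinear_radd[OF Hb] bilinear_lmul[OF Hb] bilinear_rmul[OF Hb] scaleR_add_right)
    show "\<Gamma>' u v = \<Gamma>' v u" for u v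
      using \<Gamma>d Hs[of u v] unfolding \<Gamma>'_def koszul_map_def by metis
    fix u v w
    let ?l = "\<lambda>s::real. ?x + s *\<^sub>R w"
    let ?D = "\<lambda>s. frechet_derivative ?f (at (?l s))"
    \<comment> \<open>differentiate the change of coordinates of the metric along the line through x in direction w\<close>
    obtain \<epsilon> where \<epsilon>: "\<epsilon> > 0" "ball ?x \<epsilon> \<subseteq> ?S" using S openE by blast
    define I where "I = {s::real. ?l s \<in> ball ?x \<epsilon>}"
    have "I = ?l -` ball ?x \<epsilon>" by (auto simp: I_def)
    moreover have "open (?l -` ball ?x \<epsilon>)"
      by (intro open_vimage open_ball continuous_intros)
    ultimately have I: "open I" "0 \<in> I" using \<epsilon> by (auto simp: I_def)
    have IS: "?l s \<in> ?S" if "s \<in> I" for s using that \<epsilon> by (auto simp: I_def)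
    have line: "(?l has_vector_derivative w) (at s within I)" for s
      by (auto intro!: derivative_eq_intros simp: has_vector_derivative_def)
    have Jd: "((\<lambda>s. ?D s u) has_vector_derivative ?H u w) (at 0 within I)" for u
      using has_vector_derivative_chain[OF line[of 0], where f = "\<lambda>y. frechet_derivative ?f (at y) u"]
        smooth_on_has_derivative[OF smooth_on_frechet_derivative[OF f] S(2)] by simp
    have fd: "((\<lambda>s. ?f (?l s)) has_vector_derivative ?J w) (at 0 within I)"
      using has_vector_derivative_chain[OF line[of 0], where f = ?f] transition_has_derivative[OF c d] by simp
    have fx: "?f ?x = snd d p" using A by simp
    have J0: "frechet_derivative ?f (at ?x) u = ?J u" for u using d by (simp add: tvec_of_apply)
    have "((\<lambda>s. metric_form d (?f (?l s)) (?D s u)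
        (?D s v)) has_real_derivative
       (form_deriv (metric_form d) (?f (?l 0)) (?J w) (?D 0 u)
          (?D 0 v)
        + metric_form d (?f (?l 0)) (?H u w) (?D 0 v)
        + metric_form d (?f (?l 0)) (?D 0 u) (?H v w))) (at 0 within I)"
    proof (rule has_vector_derivative_smooth_form[OF smooth_metric_form[OF A(2)] I(2) fd _ Jd Jd])
      fix s assume "s \<in> I"
      then show "?f (?l s) \<in> snd d ` fst d" using IS[of s] A by auto
    qed
    then have 1: "((\<lambda>s. metric_form d (?f (?l s)) (?D s u)
        (?D s v)) has_real_derivative
       (metric_comp_deriv A g d p (?J w) (?J u) (?J v) + ?Gd (?H u w) (?J v) + ?Gd (?J u) (?H v w))) (at 0 within I)"
      using A fx by (simp only: J0 scaleR_zero_left add_0_right metric_comp_deriv_def chart_inv_chart)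
    have 2: "((\<lambda>s. metric_form c (?l s) u v) has_real_derivative
       (metric_comp_deriv A g d p (?J w) (?J u) (?J v) + ?Gd (?H u w) (?J v) + ?Gd (?J u) (?H v w))) (at 0 within I)"
    proof (rule has_field_derivative_transform_within[OF 1 zero_less_one I(2)])
      fix s assume "s \<in> I"
      then obtain p' where p': "p' \<in> fst c" "p' \<in> fst d" "?l s = snd c p'" using IS[of s] by auto
      then have cd: "c \<in> charts_at A p'" "d \<in> charts_at A p'" using A by (auto simp: mem_charts_at)
      show "metric_form d (?f (?l s)) (?D s u)
        (?D s v) = metric_form c (?l s) u v"
        using A p' metric_comp_change[OF cd, of u v] by (simp add: tvec_of_apply[OF cd(2)])
    qed
    have 3: "((\<lambda>s. metric_form c (?l s) u v) has_real_derivative metric_comp_deriv A g c p w u v) (at 0 within I)"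
    proof -
      have "((\<lambda>x. metric_form c x u v) has_derivative (\<lambda>w. metric_comp_deriv A g c p w u v)) (at (?l 0))"
        using smooth_on_has_derivative[of "snd c ` fst c" "\<lambda>x. metric_form c x u v" ?x] smooth_metric_form[OF A(1)] A
        by (simp add: smooth_forms_on_def metric_comp_deriv_def)
      from has_vector_derivative_chain[OF line this] show ?thesis
        by (simp add: has_real_derivative_iff_has_vector_derivative)
    qed
    have at0: "at 0 within I = at 0" by (rule at_within_open[OF I(2,1)])
    have "metric_comp_deriv A g c p w u v =
       metric_comp_deriv A g d p (?J w) (?J u) (?J v) + ?Gd (?H u w) (?J v) + ?Gd (?J u) (?H v w)"
      by (rule DERIV_unique[OF 3[unfolded at0] 2[unfolded at0]])
    also have "metric_comp_deriv A g d p (?J w) (?J u) (?J v) =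
       ?Gd (levi_civita A g d p (?J w) (?J u)) (?J v) + ?Gd (?J u) (levi_civita A g d p (?J w) (?J v))"
      using \<Gamma>d by (simp add: koszul_map_def)
    also have "\<dots> + ?Gd (?H u w) (?J v) + ?Gd (?J u) (?H v w) =
       ?Gd (?J (\<Gamma>' w u)) (?J v) + ?Gd (?J u) (?J (\<Gamma>' w v))"
      unfolding \<Gamma>'_def JK by (simp add: bilinear_ladd[OF bl] bilinear_radd[OF bl] Hs[of _ w])
    finally show "metric_comp_deriv A g c p w u v = ?Gc (\<Gamma>' w u) v + ?Gc u (\<Gamma>' w v)"
      by (simp add: metric_comp_change[OF c d])
  qed
  then have "\<Gamma>' = levi_civita A g c p"
    using koszul_map_unique[OF metric_comp_pos_def[OF c]] koszul_levi_civita[OF c] by blast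
  then have "?J (\<Gamma>' u v) = ?J (levi_civita A g c p u v)" by simp
  then show ?thesis by (simp add: \<Gamma>'_def JK)
qed

lemma continuous_on_levi_civita:
  assumes c: "c \<in> A" and x: "continuous_on I x" "\<And>t. t \<in> I \<Longrightarrow> x t \<in> snd c ` fst c"
    and u: "continuous_on I u" and v: "continuous_on I v"
  shows "continuous_on I (\<lambda>t. levi_civita A g c (chart_inv c (x t)) (u t) (v t))"
proof -
  let ?U = "snd c ` fst c" and ?B = "metric_form c"
  have B: "smooth_forms_on ?U ?B" by (rule smooth_metric_form[OF c])
  have ch: "c \<in> charts_at A (chart_inv c y)" if "y \<in> ?U" for y
    using c chart_inv_in_domain[OF c that] by (simp add: mem_charts_at)
  have D: "continuous_on ?U (\<lambda>y. form_deriv ?B y w u v)" for u v w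
    using B by (intro smooth_on_continuous_on smooth_on_frechet_derivative) (auto simp: smooth_forms_on_def)
  have "continuous_on ?U (\<lambda>y. levi_civita A g c (chart_inv c y) u v)" for u v
  proof (rule continuous_on_riesz_representative[OF B metric_form_pos_def[OF c]])
    show "continuous_on ?U (\<lambda>y. (form_deriv ?B y u v w + form_deriv ?B y v u w - form_deriv ?B y w u v) / 2)" for w
      by (intro continuous_intros D) auto
    fix y w assume y: "y \<in> ?U"
    show "?B y (levi_civita A g c (chart_inv c y) u v) w = (form_deriv ?B y u v w + form_deriv ?B y v u w - form_deriv ?B y w u v) / 2"
      using koszul_formula[OF metric_form_pos_def[OF c y] koszul_levi_civita[OF ch[OF y]]] c y
      by (simp add: metric_comp_deriv_def)
  qed
  then have "continuous_on I (\<lambda>t. levi_civita A g c (chart_inv c (x t)) i j)" for i j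
    by (rule continuous_on_compose2[OF _ x(1)]) (use x(2) in auto)
  then have "continuous_on I (\<lambda>t. \<Sum>i\<in>Basis. \<Sum>j\<in>Basis. ((u t \<bullet> i) * (v t \<bullet> j)) *\<^sub>R levi_civita A g c (chart_inv c (x t)) i j)"
    by (intro continuous_intros u v)
  moreover have "(\<Sum>i\<in>Basis. \<Sum>j\<in>Basis. ((u t \<bullet> i) * (v t \<bullet> j)) *\<^sub>R levi_civita A g c (chart_inv c (x t)) i j) =
     levi_civita A g c (chart_inv c (x t)) (u t) (v t)" if "t \<in> I" for t
    using koszul_levi_civita[OF ch[OF x(2)[OF that]]]
    by (intro bilinear_basis_expansion[symmetric]) (simp add: koszul_map_def)
  ultimately show ?thesis by (rule continuous_on_eq)
qed

end


section \<open>Speed and acceleration of curves\<close>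

lemma set_integrable_union_adjacent:
  fixes f :: "real \<Rightarrow> 'b::{banach, second_countable_topology}"
  assumes "f absolutely_integrable_on {s..t}" "f absolutely_integrable_on {t..u}" "s \<le> t" "t \<le> u"
  shows "f absolutely_integrable_on {s..u}"
proof -
  have "f absolutely_integrable_on {s..t} \<union> {t..u}"
    using assms by (intro set_integrable_Un) auto
  moreover have "{s..t} \<union> {t..u} = {s..u}" using assms by auto
  ultimately show ?thesis by simp
qed

lemma absolutely_integrable_sqrt:
  fixes f :: "real \<Rightarrow> real"
  assumes "f absolutely_integrable_on {a..b}"
  shows "(\<lambda>t. sqrt (f t)) absolutely_integrable_on {a..b}"
proof (rule set_integrable_bound)
  show "(\<lambda>t. 1 + \<bar>f t\<bar>) absolutely_integrable_on {a..b}"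
    by (intro set_integral_add(1) set_integrable_abs assms absolutely_integrable_continuous_real continuous_on_const)
  have "(\<lambda>t. sqrt (indicator {a..b} t *\<^sub>R f t)) \<in> borel_measurable lebesgue"
    using assms unfolding set_integrable_def
    by (intro measurable_compose[OF borel_measurable_integrable borel_measurable_continuous_onI] continuous_intros)
  moreover have "(\<lambda>t. sqrt (indicator {a..b} t *\<^sub>R f t)) = (\<lambda>t. indicator {a..b} t *\<^sub>R sqrt (f t))"
    by (auto simp: indicator_def)
  ultimately show "set_borel_measurable lebesgue {a..b} (\<lambda>t. sqrt (f t))"
    by (simp add: set_borel_measurable_def)
  have "\<bar>sqrt y\<bar> \<le> 1 + \<bar>y\<bar>" for y :: real
  proof -
    have "\<bar>sqrt y\<bar> = sqrt \<bar>y\<bar>" by (simp add: abs_if real_sqrt_minus)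
    also have "\<dots> \<le> 1 + \<bar>y\<bar>" by (rule real_le_lsqrt) (auto simp: power2_eq_square distrib_left distrib_right)
    finally show ?thesis .
  qed
  then show "AE t in lebesgue. t \<in> {a..b} \<longrightarrow> norm (sqrt (f t)) \<le> norm (1 + \<bar>f t\<bar>)" by simp
qed

lemma absolutely_integrable_spike:
  fixes f :: "'a::euclidean_space \<Rightarrow> 'b::euclidean_space"
  assumes "f absolutely_integrable_on S" "negligible N" "\<And>x. x \<in> S - N \<Longrightarrow> g x = f x"
  shows "g absolutely_integrable_on S"
  using assms absolutely_integrable_spike_eq[of N S f g] by metis

text \<open>
  Instead of \<open>norm (x'' t)\<^sup>2\<close> the conclusion has products of components, since
  these are what the energy density in a chart is made of.
\<close>

lemma H2_on_primitive:
  fixes x :: "real \<Rightarrow> 'e::euclidean_space"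
  assumes "H2_on a b x"
  obtains x' x'' where "\<And>t. t \<in> {a..b} \<Longrightarrow> (x has_vector_derivative x' t) (at t within {a..b})"
    "primitive_on a b x' x''"
    "\<And>i j. i \<in> Basis \<Longrightarrow> j \<in> Basis \<Longrightarrow> (\<lambda>t. (x'' t \<bullet> i) * (x'' t \<bullet> j)) absolutely_integrable_on {a..b}"
proof -
  obtain x' x'' where x': "\<And>t. t \<in> {a..b} \<Longrightarrow> (x has_vector_derivative x' t) (at t within {a..b})"
    and m: "set_borel_measurable lebesgue {a..b} x''"
    and n: "(\<lambda>t. (norm (x'' t))\<^sup>2) absolutely_integrable_on {a..b}"
    and int: "\<And>t. t \<in> {a..b} \<Longrightarrow> x' t = x' a + (LINT s:{a..t}|lebesgue. x'' s)"
    using assms unfolding H2_on_def by blast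
  have i: "x'' absolutely_integrable_on {a..b}"
  proof (rule set_integrable_bound[OF _ m])
    show "(\<lambda>t. 1 + (norm (x'' t))\<^sup>2) absolutely_integrable_on {a..b}"
      by (intro set_integral_add(1) n absolutely_integrable_continuous_real continuous_on_const)
    have "y \<le> 1 + y\<^sup>2" for y :: real
    proof -
      have "0 \<le> (y - 1)\<^sup>2 + y\<^sup>2 + 1" by simp
      then show ?thesis by (simp add: power2_eq_square algebra_simps)
    qed
    then show "AE t in lebesgue. t \<in> {a..b} \<longrightarrow> norm (x'' t) \<le> norm (1 + (norm (x'' t))\<^sup>2)" by simp
  qed
  have ii: "x'' integrable_on {s..t}" if "a \<le> s" "t \<le> b" for s t
    using i that integrable_subinterval_real[of x'' a b s t] by (auto simp: set_lebesgue_integral_eq_integral(1))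
  have int': "x' t = x' a + integral {a..t} x''" if "t \<in> {a..b}" for t
  proof -
    have "x'' absolutely_integrable_on {a..t}"
      using absolutely_integrable_on_subinterval[OF i] that by auto
    then show ?thesis using int[OF that] set_lebesgue_integral_eq_integral(2) by metis
  qed
  have "primitive_on a b x' x''"
    unfolding primitive_on_def
  proof (intro conjI allI impI i)
    fix s t assume st: "a \<le> s \<and> s \<le> t \<and> t \<le> b"
    then have "integral {a..s} x'' + integral {s..t} x'' = integral {a..t} x''"
      using ii by (intro Henstock_Kurzweil_Integration.integral_combine) auto
    then have "integral {s..t} x'' = x' t - x' s"
      using int'[of s] int'[of t] st by (simp add: algebra_simps)
    then show "(x'' has_integral x' t - x' s) {s..t}" using ii[of s t] st by (metis integrable_integral)
  qed
  moreover have "(\<lambda>t. (x'' t \<bullet> i) * (x'' t \<bullet> j)) absolutely_integrable_on {a..b}"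
    if ij: "i \<in> Basis" "j \<in> Basis" for i j
  proof (rule set_integrable_bound[OF n])
    have "(\<lambda>t. ((indicator {a..b} t *\<^sub>R x'' t) \<bullet> i) * ((indicator {a..b} t *\<^sub>R x'' t) \<bullet> j)) \<in> borel_measurable lebesgue"
      using m unfolding set_borel_measurable_def
      by (intro borel_measurable_times borel_measurable_inner borel_measurable_const) auto
    moreover have "(\<lambda>t. ((indicator {a..b} t *\<^sub>R x'' t) \<bullet> i) * ((indicator {a..b} t *\<^sub>R x'' t) \<bullet> j)) =
       (\<lambda>t. indicator {a..b} t *\<^sub>R ((x'' t \<bullet> i) * (x'' t \<bullet> j)))" by (auto simp: indicator_def)
    ultimately show "set_borel_measurable lebesgue {a..b} (\<lambda>t. (x'' t \<bullet> i) * (x'' t \<bullet> j))"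
      by (simp add: set_borel_measurable_def)
    have "\<bar>(y \<bullet> i) * (y \<bullet> j)\<bar> \<le> (norm y)\<^sup>2" for y :: 'e
      using Basis_le_norm[OF ij(1), of y] Basis_le_norm[OF ij(2), of y]
      by (simp add: abs_mult power2_eq_square mult_mono)
    then show "AE t in lebesgue. t \<in> {a..b} \<longrightarrow> norm ((x'' t \<bullet> i) * (x'' t \<bullet> j)) \<le> norm ((norm (x'' t))\<^sup>2)"
      by simp
  qed
  ultimately show thesis using that x' by blast
qed

lemma H2_curve_imp_C1_curve:
  assumes "H2_curve A a b q"
  shows "C1_curve A a b q"
  unfolding C1_curve_def C1_on_def
proof (intro conjI ballI allI impI)
  show "continuous_on {a..b} q" using assms by (simp add: H2_curve_def)
  fix c s t assume "c \<in> A" "a \<le> s \<and> s < t \<and> t \<le> b \<and> q ` {s..t} \<subseteq> fst c"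
  then have "H2_on s t (snd c \<circ> q)" using assms by (simp add: H2_curve_def)
  then show "\<exists>x'. continuous_on {s..t} x' \<and>
      (\<forall>u\<in>{s..t}. (snd c \<circ> q has_vector_derivative x' u) (at u within {s..t}))"
    by (rule H2_on_primitive) (blast dest: primitive_on_continuous)
qed

text \<open>
  Near \<open>t\<close> the curve stays in a chart domain on a subinterval that is a neighbourhood
  of \<open>t\<close> relative to \<open>[a,b]\<close>, so one-sided derivatives at the end points
  of \<open>[a,b]\<close> are the same for both intervals.
\<close>

lemma subinterval_in_open:
  fixes q :: "real \<Rightarrow> 'q::topological_space"
  assumes q: "continuous_on {a..b} q" and ab: "a < b" and t: "t \<in> {a..b}" and U: "open U" "q t \<in> U"
  obtains s t' d where "a \<le> s" "s < t'" "t' \<le> b" "s \<le> t" "t \<le> t'" "q ` {s..t'} \<subseteq> U" "d > 0"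
    "{a..b} \<inter> ball t d \<subseteq> {s..t'}"
    "\<forall>u\<in>ball t d. at u within {s..t'} = at u within {a..b}"
proof -
  have "(q \<longlongrightarrow> q t) (at t within {a..b})" using q t by (simp add: continuous_on_def)
  then have "\<forall>\<^sub>F u in at t within {a..b}. q u \<in> U" using U by (rule topological_tendstoD)
  then obtain d0 where d0: "d0 > 0" "\<And>u. u \<in> {a..b} \<Longrightarrow> u \<noteq> t \<Longrightarrow> dist u t < d0 \<Longrightarrow> q u \<in> U"
    unfolding eventually_at by blast
  define d where "d = d0 / 2"
  define s where "s = max a (t - d)"
  define t' where "t' = min b (t + d)"
  have d: "d > 0" using d0 by (simp add: d_def)
  have eq: "{s..t'} \<inter> ball t d = {a..b} \<inter> ball t d"
    by (auto simp: s_def t'_def dist_real_def)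
  have "q u \<in> U" if "u \<in> {s..t'}" for u
    using d0(2)[of u] U(2) d that by (cases "u = t") (auto simp: s_def t'_def d_def dist_real_def)
  moreover have "at u within {s..t'} = at u within {a..b}" if "u \<in> ball t d" for u
    using eq by (intro at_within_nhd[OF that open_ball]) auto
  moreover have "s < t'" using ab t d by (auto simp: s_def t'_def min_def max_def)
  moreover have "a \<le> s" "t' \<le> b" "s \<le> t" "t \<le> t'" using t d by (auto simp: s_def t'_def)
  ultimately show thesis by (intro that[of s t' d]) (use d eq in auto)
qed

lemma at_within_Icc_neq_bot: "a < b \<Longrightarrow> t \<in> {a..b} \<Longrightarrow> at t within {a..b::real} \<noteq> bot"
  using trivial_limit_within[of t "{a..b}"] islimpt_Icc[of a b t] by simp

context riemannian
begin

lemma velocity_eq_tvec_of: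
  assumes t: "t \<in> I" "at t within I \<noteq> bot" and q: "continuous (at t within I) q"
    and c: "c \<in> charts_at A (q t)" and x: "(snd c \<circ> q has_vector_derivative u) (at t within I)"
  shows "velocity A I q t = tvec_of A c (q t) u"
proof
  fix d show "velocity A I q t d = tvec_of A c (q t) u d"
  proof (cases "d \<in> charts_at A (q t)")
    case True
    then show ?thesis
      using transition_has_vector_derivative[OF c True x q t(1)] vector_derivative_within[OF t(2)]
      by (simp add: velocity_def)
  qed (simp add: velocity_def tvec_of_def)
qed

lemma tnorm_tvec_of: "tnorm g p (tvec_of A c p u) = sqrt (metric_comp A g c p u u)"
  by (simp add: tnorm_def metric_comp_def)

lemma tnorm_tvec_of_nonneg: "c \<in> charts_at A p \<Longrightarrow> 0 \<le> tnorm g p (tvec_of A c p u)"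
  and tnorm_tvec_of_power2: "c \<in> charts_at A p \<Longrightarrow> (tnorm g p (tvec_of A c p u))\<^sup>2 = metric_comp A g c p u u"
  using pos_def_form_nonneg[OF metric_comp_pos_def] by (auto simp: tnorm_tvec_of)

text \<open>
  In any chart around \<open>q t\<close>, the stored velocity is a genuine derivative of the
  coordinates and is continuous. At the end points both statements are one-sided.
\<close>

lemma C1_curve_local:
  assumes q: "C1_curve A a b q" and ab: "a < b" and t: "t \<in> {a..b}" and c: "c \<in> charts_at A (q t)"
  shows "(snd c \<circ> q has_vector_derivative velocity A {a..b} q t c) (at t within {a..b})"
    and "continuous (at t within {a..b}) (\<lambda>u. velocity A {a..b} q u c)"
proof -
  have A: "c \<in> A" "q t \<in> fst c" using c by (auto simp: mem_charts_at)
  have qc: "continuous_on {a..b} q" using q by (simp add: C1_curve_def)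
  obtain s t' d where st: "a \<le> s" "s < t'" "t' \<le> b" "s \<le> t" "t \<le> t'" "q ` {s..t'} \<subseteq> fst c" "d > 0"
      and d: "{a..b} \<inter> ball t d \<subseteq> {s..t'}"
      and at: "\<forall>u\<in>ball t d. at u within {s..t'} = at u within {a..b}"
    by (rule subinterval_in_open[OF qc ab t open_chart_domain[OF A(1)] A(2)])
  have "C1_on s t' (snd c \<circ> q)" using q A st by (simp add: C1_curve_def)
  then obtain x' where x': "continuous_on {s..t'} x'"
    "\<And>u. u \<in> {s..t'} \<Longrightarrow> (snd c \<circ> q has_vector_derivative x' u) (at u within {s..t'})"
    by (auto simp: C1_on_def)
  have xu: "(snd c \<circ> q has_vector_derivative x' u) (at u within {a..b})" "velocity A {a..b} q u c = x' u"
    if "u \<in> {a..b}" "dist u t < d" for u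
  proof -
    have u: "u \<in> ball t d" using that by (simp add: dist_commute)
    have us: "u \<in> {s..t'}" using u d that by auto
    show *: "(snd c \<circ> q has_vector_derivative x' u) (at u within {a..b})"
      using x'(2)[OF us] bspec[OF at u] by simp
    have "c \<in> charts_at A (q u)" using us st A by (auto simp: mem_charts_at)
    then show "velocity A {a..b} q u c = x' u"
      using vector_derivative_within[OF at_within_Icc_neq_bot[OF ab that(1)] *] by (simp add: velocity_def)
  qed
  have tt: "dist t t < d" using st by simp
  show "(snd c \<circ> q has_vector_derivative velocity A {a..b} q t c) (at t within {a..b})"
    using xu[OF t tt] by simp
  have "continuous (at t within {s..t'}) x'" using x'(1) st by (simp add: continuous_on_eq_continuous_within)
  then have "continuous (at t within {a..b}) x'" using bspec[OF at, of t] st by simp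
  then show "continuous (at t within {a..b}) (\<lambda>u. velocity A {a..b} q u c)"
    by (rule continuous_transform_within[OF _ st(7) t]) (use xu in auto)
qed

lemma C1_curve_velocity:
  assumes q: "C1_curve A a b q" and ab: "a < b" and t: "t \<in> {a..b}" and c: "c \<in> charts_at A (q t)"
  shows "velocity A {a..b} q t = tvec_of A c (q t) (velocity A {a..b} q t c)"
proof -
  have "continuous (at t within {a..b}) q"
    using q t by (auto simp: C1_curve_def continuous_on_eq_continuous_within)
  then show ?thesis
    by (rule velocity_eq_tvec_of[OF t at_within_Icc_neq_bot[OF ab t] _ c C1_curve_local(1)[OF assms]])
qed

lemma C1_curve_continuous_on_chart:
  assumes q: "C1_curve A a b q" and ab: "a < b" and S: "S \<subseteq> {a..b}" "\<And>t. t \<in> S \<Longrightarrow> q t \<in> fst c" and c: "c \<in> A"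
  shows "continuous_on S (snd c \<circ> q)" "continuous_on S (\<lambda>t. velocity A {a..b} q t c)"
proof -
  have *: "t \<in> {a..b}" "c \<in> charts_at A (q t)" if "t \<in> S" for t using S c that by (auto simp: mem_charts_at)
  show "continuous_on S (\<lambda>t. velocity A {a..b} q t c)" unfolding continuous_on_eq_continuous_within
    using C1_curve_local(2)[OF q ab *] S(1) continuous_within_subset by blast
  show "continuous_on S (snd c \<circ> q)" unfolding continuous_on_eq_continuous_within
    using has_vector_derivative_continuous[OF C1_curve_local(1)[OF q ab *]] S(1) continuous_within_subset by blast
qed

abbreviation speed_within :: "real set \<Rightarrow> (real \<Rightarrow> 'q) \<Rightarrow> real \<Rightarrow> real" where
  "speed_within I q t \<equiv> tnorm g (q t) (velocity A I q t)"

lemma C1_curve_speed_power2: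
  assumes "C1_curve A a b q" "a < b" "t \<in> {a..b}" "c \<in> charts_at A (q t)"
  shows "(speed_within {a..b} q t)\<^sup>2 = metric_form c (snd c (q t)) (velocity A {a..b} q t c) (velocity A {a..b} q t c)"
  using assms tnorm_tvec_of_power2[of c "q t"] C1_curve_velocity[OF assms] by (metis mem_charts_at chart_inv_chart)

lemma C1_curve_speed_nonneg:
  assumes "C1_curve A a b q" "a < b" "t \<in> {a..b}"
  shows "0 \<le> speed_within {a..b} q t"
proof -
  obtain c where "c \<in> charts_at A (q t)" using ex_chart by blast
  then show ?thesis using C1_curve_velocity[OF assms] tnorm_tvec_of_nonneg by metis
qed

lemma C1_curve_continuous_speed:
  assumes q: "C1_curve A a b q" and ab: "a < b"
  shows "continuous_on {a..b} (speed_within {a..b} q)"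
  unfolding continuous_on_eq_continuous_within
proof
  fix t assume t: "t \<in> {a..b}"
  obtain c where c: "c \<in> A" "q t \<in> fst c" using ex_chart mem_charts_at by metis
  have qc: "continuous_on {a..b} q" using q by (simp add: C1_curve_def)
  obtain s t' d where st: "a \<le> s" "s < t'" "t' \<le> b" "s \<le> t" "t \<le> t'" "q ` {s..t'} \<subseteq> fst c" "d > 0"
      and d: "{a..b} \<inter> ball t d \<subseteq> {s..t'}"
      and at: "\<forall>u\<in>ball t d. at u within {s..t'} = at u within {a..b}"
    by (rule subinterval_in_open[OF qc ab t open_chart_domain[OF c(1)] c(2)])
  have sub: "{s..t'} \<subseteq> {a..b}" "\<And>u. u \<in> {s..t'} \<Longrightarrow> q u \<in> fst c" using st by auto
  have "continuous_on {s..t'} (\<lambda>u. sqrt (metric_form c ((snd c \<circ> q) u) (velocity A {a..b} q u c) (velocity A {a..b} q u c)))"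
    using sub c by (intro continuous_intros continuous_on_smooth_form[OF smooth_metric_form[OF c(1)]]
        C1_curve_continuous_on_chart[OF q ab sub c(1)]) auto
  then have "continuous_on {s..t'} (speed_within {a..b} q)"
  proof (rule continuous_on_eq)
    fix u assume u: "u \<in> {s..t'}"
    then have "u \<in> {a..b}" "c \<in> charts_at A (q u)" using sub c by (auto simp: mem_charts_at)
    then show "sqrt (metric_form c ((snd c \<circ> q) u) (velocity A {a..b} q u c) (velocity A {a..b} q u c)) = speed_within {a..b} q u"
      using C1_curve_speed_power2[OF q ab, of u c] C1_curve_speed_nonneg[OF q ab, of u]
      by (metis comp_apply real_sqrt_abs abs_of_nonneg)
  qed
  then have "continuous (at t within {s..t'}) (speed_within {a..b} q)"
    using st by (simp add: continuous_on_eq_continuous_within)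
  then show "continuous (at t within {a..b}) (speed_within {a..b} q)" using bspec[OF at, of t] st by simp
qed

text \<open>
  The family of components that defines the acceleration is a tangent vector: the second derivative
  of the coordinates picks up the Hessian of the coordinate change, and the Christoffel symbols pick
  up its negative. Without this the value of the metric on the acceleration could not be computed in
  a chart.
\<close>

lemma cov_deriv_velocity_eq_tvec_of:
  assumes q: "C1_curve A a b q" and ab: "a < b" and t: "t \<in> {a..b}" and c: "c \<in> charts_at A (q t)"
    and w: "((\<lambda>s. velocity A {a..b} q s c) has_vector_derivative w) (at t within {a..b})"
  shows "cov_deriv A g {a..b} q (velocity A {a..b} q) t =
     tvec_of A c (q t) (w + levi_civita A g c (q t) (velocity A {a..b} q t c) (velocity A {a..b} q t c))"
proof
  fix d
  let ?v = "velocity A {a..b} q" and ?x = "snd c \<circ> q"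
  show "cov_deriv A g {a..b} q ?v t d = tvec_of A c (q t) (w + levi_civita A g c (q t) (?v t c) (?v t c)) d"
  proof (cases "d \<in> charts_at A (q t)")
    case False
    then show ?thesis by (simp add: cov_deriv_def tvec_of_def)
  next
    case d: True
    have A: "c \<in> A" "d \<in> A" "q t \<in> fst c" "q t \<in> fst d" using c d by (auto simp: mem_charts_at)
    have J: "linear (\<lambda>u. tvec_of A c (q t) u d)" by (rule linear_tvec_of[OF c d])
    have cd: "open (fst c \<inter> fst d)" "q t \<in> fst c \<inter> fst d" using A by (auto intro: open_Int open_chart_domain)
    have qc: "continuous_on {a..b} q" using q by (simp add: C1_curve_def)
    obtain s t' e where st: "a \<le> s" "s < t'" "t' \<le> b" "s \<le> t" "t \<le> t'" "q ` {s..t'} \<subseteq> fst c \<inter> fst d" "e > 0"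
      and e: "{a..b} \<inter> ball t e \<subseteq> {s..t'}"
      and at: "\<forall>u\<in>ball t e. at u within {s..t'} = at u within {a..b}"
    by (rule subinterval_in_open[OF qc ab t cd])
    have "((\<lambda>s. frechet_derivative (transition c d) (at (?x s)) (?v s c)) has_vector_derivative
       (frechet_derivative (transition c d) (at (?x t)) w +
        frechet_derivative (\<lambda>y. frechet_derivative (transition c d) (at y) (?v t c)) (at (?x t)) (?v t c)))
       (at t within {a..b})"
      by (rule has_vector_derivative_frechet_derivative_along[OF smooth_transition[OF A(1,2)]
            open_overlap[OF A(1,2)] _ t C1_curve_local(1)[OF q ab t c] w]) (use A in auto)
    then have 1: "((\<lambda>s. frechet_derivative (transition c d) (at (?x s)) (?v s c)) has_vector_derivative
       (tvec_of A c (q t) w d + transition_hessian c d (q t) (?v t c) (?v t c))) (at t within {a..b})"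
      by (simp add: tvec_of_apply[OF d])
    have "((\<lambda>s. ?v s d) has_vector_derivative
       (tvec_of A c (q t) w d + transition_hessian c d (q t) (?v t c) (?v t c))) (at t within {a..b})"
      using 1 unfolding has_vector_derivative_def
    proof (rule has_derivative_transform_within[OF _ st(7) t])
      fix s assume s: "s \<in> {a..b}" "dist s t < e"
      then have "s \<in> {a..b} \<inter> ball t e" by (simp add: dist_commute)
      then have "q s \<in> fst c \<inter> fst d" using st e by blast
      then have "c \<in> charts_at A (q s)" "d \<in> charts_at A (q s)" using A by (auto simp: mem_charts_at)
      then show "frechet_derivative (transition c d) (at (?x s)) (?v s c) = ?v s d"
        using C1_curve_velocity[OF q ab s(1), of c] tvec_of_apply[of d "q s" c "?v s c"] by simp
    qed
    then have "vector_derivative (\<lambda>s. ?v s d) (at t within {a..b}) =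
       tvec_of A c (q t) w d + transition_hessian c d (q t) (?v t c) (?v t c)"
      by (rule vector_derivative_within[OF at_within_Icc_neq_bot[OF ab t]])
    moreover have "?v t d = tvec_of A c (q t) (?v t c) d" using C1_curve_velocity[OF q ab t c] by metis
    ultimately have "cov_deriv A g {a..b} q ?v t d =
       tvec_of A c (q t) w d + (levi_civita A g d (q t) (tvec_of A c (q t) (?v t c) d) (tvec_of A c (q t) (?v t c) d)
         + transition_hessian c d (q t) (?v t c) (?v t c))"
      using d by (simp add: cov_deriv_def)
    then show ?thesis by (simp add: levi_civita_change[OF c d] linear_add[OF J])
  qed
qed

abbreviation accel :: "real set \<Rightarrow> (real \<Rightarrow> 'q) \<Rightarrow> real \<Rightarrow> real" where
  "accel I q t \<equiv> tnorm g (q t) (cov_deriv A g I q (velocity A I q) t)"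

text \<open>
  With \<open>z = x'' + \<Gamma>(x', x')\<close> for the covariant acceleration in the chart, the
  squared acceleration is \<open>B z z\<close> almost everywhere; it is integrable because
  \<open>x''\<close> is square integrable and \<open>x\<close>, \<open>x'\<close> are continuous.
  Compatibility of the connection with the metric turns the derivative of the squared speed \<open>B
  x' x'\<close> into \<open>2 B z x'\<close>, which the Cauchy-Schwarz inequality bounds by twice
  acceleration times speed.
\<close>

lemma H2_curve_energy_on_chart:
  assumes q: "H2_curve A a b q" and st: "a \<le> s" "s < t" "t \<le> b" and c: "c \<in> A" "q ` {s..t} \<subseteq> fst c"
  shows "(\<lambda>u. (accel {a..b} q u)\<^sup>2) absolutely_integrable_on {s..t}"
    and "accel {a..b} q absolutely_integrable_on {s..t}"
    and "\<bar>(speed_within {a..b} q t)\<^sup>2 - (speed_within {a..b} q s)\<^sup>2\<bar>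
       \<le> integral {s..t} (\<lambda>u. 2 * accel {a..b} q u * speed_within {a..b} q u)"
proof -
  let ?v = "velocity A {a..b} q" and ?x = "snd c \<circ> q" and ?W = "speed_within {a..b} q"
  have q1: "C1_curve A a b q" by (rule H2_curve_imp_C1_curve[OF q])
  have ab: "a < b" using st by simp
  have sub: "{s..t} \<subseteq> {a..b}" "\<And>u. u \<in> {s..t} \<Longrightarrow> q u \<in> fst c" using st c by auto
  have ch: "c \<in> charts_at A (q u)" "u \<in> {a..b}" "?x u \<in> snd c ` fst c" if "u \<in> {s..t}" for u
    using sub c that by (auto simp: mem_charts_at)
  have B: "smooth_forms_on (snd c ` fst c) (metric_form c)" by (rule smooth_metric_form[OF c(1)])
  have "H2_on s t ?x" using q st c by (simp add: H2_curve_def)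
  then obtain x' x'' where x': "\<And>u. u \<in> {s..t} \<Longrightarrow> (?x has_vector_derivative x' u) (at u within {s..t})"
    and p: "primitive_on s t x' x''"
    and sq: "\<And>i j. i \<in> Basis \<Longrightarrow> j \<in> Basis \<Longrightarrow> (\<lambda>u. (x'' u \<bullet> i) * (x'' u \<bullet> j)) absolutely_integrable_on {s..t}"
    by (rule H2_on_primitive) blast
  have vx: "?v u c = x' u" if u: "u \<in> {s..t}" for u
  proof -
    have "(?x has_vector_derivative ?v u c) (at u within {s..t})"
      using C1_curve_local(1)[OF q1 ab ch(2)[OF u] ch(1)[OF u]] sub(1) by (rule has_vector_derivative_within_subset)
    then show ?thesis using x'[OF u] vector_derivative_within[OF at_within_Icc_neq_bot[OF st(2) u]] by metis
  qed
  have xc: "continuous_on {s..t} ?x" and vc: "continuous_on {s..t} x'"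
    using C1_curve_continuous_on_chart(1)[OF q1 ab sub c(1)] primitive_on_continuous[OF p] by auto
  define y where "y u = levi_civita A g c (q u) (x' u) (x' u)" for u
  have yc: "continuous_on {s..t} y"
  proof (rule continuous_on_eq)
    show "continuous_on {s..t} (\<lambda>u. levi_civita A g c (chart_inv c (?x u)) (x' u) (x' u))"
      by (rule continuous_on_levi_civita[OF c(1) xc ch(3) vc vc])
  qed (use sub c in \<open>simp add: y_def\<close>)
  define z where "z u = x'' u + y u" for u
  define \<Phi> where "\<Phi> u = metric_form c (?x u) (z u) (z u)" for u
  have bl: "bilinear (metric_form c (?x u))" if "u \<in> {s..t}" for u
    using B ch(3)[OF that] unfolding smooth_forms_on_def by blast
  have zz: "(\<lambda>u. (z u \<bullet> i) * (z u \<bullet> j)) absolutely_integrable_on {s..t}" if "i \<in> Basis" "j \<in> Basis" for i j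
  proof -
    have xi: "(\<lambda>u. x'' u \<bullet> i) absolutely_integrable_on {s..t}" for i
      using primitive_on_inner[OF p, of i] by (simp add: primitive_on_def)
    have yi: "continuous_on {s..t} (\<lambda>u. y u \<bullet> i)" for i by (intro continuous_intros yc)
    have "(\<lambda>u. (x'' u \<bullet> i) * (x'' u \<bullet> j) + (x'' u \<bullet> i) * (y u \<bullet> j) + (y u \<bullet> i) * (x'' u \<bullet> j) + (y u \<bullet> i) * (y u \<bullet> j))
       absolutely_integrable_on {s..t}"
      by (intro set_integral_add sq that absolutely_integrable_times_continuous xi yi
           absolutely_integrable_continuous_real continuous_on_mult)
    then show ?thesis by (simp add: z_def inner_add_left algebra_simps)
  qed
  have "(\<lambda>u. \<Sum>i\<in>Basis. \<Sum>j\<in>Basis. ((z u \<bullet> i) * (z u \<bullet> j)) * metric_form c (?x u) i j) absolutely_integrable_on {s..t}"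
    by (intro absolutely_integrable_sum finite_Basis absolutely_integrable_times_continuous(1) zz
        continuous_on_smooth_form[OF B xc] continuous_on_const ch(3))
  then have \<Phi>i: "\<Phi> absolutely_integrable_on {s..t}"
  proof (rule absolutely_integrable_spike[OF _ negligible_empty])
    fix u assume "u \<in> {s..t} - {}"
    then show "\<Phi> u = (\<Sum>i\<in>Basis. \<Sum>j\<in>Basis. ((z u \<bullet> i) * (z u \<bullet> j)) * metric_form c (?x u) i j)"
      using bilinear_basis_expansion[OF bl[of u], of "z u" "z u"] by (simp add: \<Phi>_def)
  qed
  define N where "N = {u\<in>{s..t}. \<not> (x' has_vector_derivative x'' u) (at u within {s..t})} \<union> {s, t}"
  have N: "negligible N" unfolding N_def using lebesgue_differentiation[OF p] by auto
  have acc: "accel {a..b} q u = sqrt (\<Phi> u)" if u: "u \<in> {s..t} - N" for u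
  proof -
    have us: "u \<in> {s..t}" "u \<in> {s<..<t}" using u by (auto simp: N_def)
    have "(x' has_vector_derivative x'' u) (at u within {s..t})" using u by (auto simp: N_def)
    then have "((\<lambda>u. ?v u c) has_vector_derivative x'' u) (at u within {s..t})"
      unfolding has_vector_derivative_def
      by (rule has_derivative_transform_within[OF _ zero_less_one us(1)]) (simp add: vx)
    moreover have "at u within {s..t} = at u within {a..b}"
      using us st by (intro at_within_nhd[of u "{s<..<t}"]) auto
    ultimately have "((\<lambda>u. ?v u c) has_vector_derivative x'' u) (at u within {a..b})" by simp
    from cov_deriv_velocity_eq_tvec_of[OF q1 ab ch(2)[OF us(1)] ch(1)[OF us(1)] this]
    have "cov_deriv A g {a..b} q ?v u = tvec_of A c (q u) (z u)"
      by (simp add: z_def y_def vx[OF us(1)])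
    then show ?thesis using c sub us by (simp add: tnorm_tvec_of \<Phi>_def)
  qed
  have \<Phi>0: "\<Phi> u \<ge> 0" if "u \<in> {s..t}" for u
    unfolding \<Phi>_def by (rule pos_def_form_nonneg[OF metric_form_pos_def[OF c(1) ch(3)[OF that]]])
  show "(\<lambda>u. (accel {a..b} q u)\<^sup>2) absolutely_integrable_on {s..t}"
    by (rule absolutely_integrable_spike[OF \<Phi>i N]) (use acc \<Phi>0 in auto)
  show ai: "accel {a..b} q absolutely_integrable_on {s..t}"
    by (rule absolutely_integrable_spike[OF absolutely_integrable_sqrt[OF \<Phi>i] N]) (use acc in auto)
  define h where "h u = form_deriv (metric_form c) (?x u) (x' u) (x' u) (x' u)
      + metric_form c (?x u) (x'' u) (x' u) + metric_form c (?x u) (x' u) (x'' u)" for u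
  have W2: "(?W u)\<^sup>2 = metric_form c (?x u) (x' u) (x' u)" if "u \<in> {s..t}" for u
    using C1_curve_speed_power2[OF q1 ab ch(2)[OF that] ch(1)[OF that]] vx[OF that] by simp
  have "primitive_on s t (\<lambda>u. metric_form c (?x u) (x' u) (x' u)) h"
    unfolding h_def by (rule primitive_on_smooth_form[OF B x' vc ch(3) p p])
  then have hI: "(h has_integral ((?W t)\<^sup>2 - (?W s)\<^sup>2)) {s..t}"
    using W2[of s] W2[of t] st by (simp add: primitive_on_def)
  have hz: "h u = 2 * metric_form c (?x u) (z u) (x' u)" if u: "u \<in> {s..t}" for u
  proof -
    have k: "koszul_map (metric_comp A g c (q u)) (metric_comp_deriv A g c (q u)) (levi_civita A g c (q u))"
      by (rule koszul_levi_civita[OF ch(1)[OF u]])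
    have e: "chart_inv c (?x u) = q u" using c sub u by simp
    have sym: "metric_comp A g c (q u) v w = metric_comp A g c (q u) w v" for v w
      using metric_comp_pos_def[OF ch(1)[OF u]] by (simp add: pos_def_form_def)
    have "form_deriv (metric_form c) (?x u) (x' u) (x' u) (x' u) = metric_comp_deriv A g c (q u) (x' u) (x' u) (x' u)"
      by (simp add: metric_comp_deriv_def)
    also have "\<dots> = 2 * metric_comp A g c (q u) (y u) (x' u)"
      using k sym[of "x' u"] by (simp add: koszul_map_def y_def)
    finally show ?thesis
      using bl[OF u] sym[of "x' u" "x'' u"] by (simp add: h_def z_def bilinear_ladd e del: o_apply)
  qed
  have hle: "\<bar>h u\<bar> \<le> 2 * sqrt (\<Phi> u) * ?W u" if u: "u \<in> {s..t}" for u
  proof -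
    have "\<bar>h u\<bar> \<le> 2 * (sqrt (\<Phi> u) * sqrt (metric_form c (?x u) (x' u) (x' u)))"
      using pos_def_form_cauchy_schwarz[OF metric_form_pos_def[OF c(1) ch(3)[OF u]], of "z u" "x' u"]
      by (simp add: hz[OF u] \<Phi>_def abs_mult)
    also have "sqrt (metric_form c (?x u) (x' u) (x' u)) = ?W u"
      using W2[OF u] C1_curve_speed_nonneg[OF q1 ab ch(2)[OF u]] by (metis real_sqrt_abs abs_of_nonneg)
    finally show ?thesis by simp
  qed
  have Wc: "continuous_on {s..t} ?W" using C1_curve_continuous_speed[OF q1 ab] sub(1) by (rule continuous_on_subset)
  have "(\<lambda>u. sqrt (\<Phi> u) * (2 * ?W u)) absolutely_integrable_on {s..t}"
    by (intro absolutely_integrable_times_continuous(1) absolutely_integrable_sqrt \<Phi>i continuous_on_mult continuous_on_const Wc)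
  then have gi: "(\<lambda>u. 2 * sqrt (\<Phi> u) * ?W u) integrable_on {s..t}"
    by (simp add: mult_ac set_lebesgue_integral_eq_integral(1))
  have "\<bar>(?W t)\<^sup>2 - (?W s)\<^sup>2\<bar> \<le> integral {s..t} (\<lambda>u. 2 * sqrt (\<Phi> u) * ?W u)"
    using integral_norm_bound_integral[OF has_integral_integrable[OF hI] gi] hle integral_unique[OF hI] by simp
  also have "\<dots> = integral {s..t} (\<lambda>u. 2 * accel {a..b} q u * ?W u)"
    by (rule integral_spike[OF N]) (simp add: acc)
  finally show "\<bar>(?W t)\<^sup>2 - (?W s)\<^sup>2\<bar> \<le> integral {s..t} (\<lambda>u. 2 * accel {a..b} q u * ?W u)" .
qed

text \<open>
  Integrability and the energy inequality are both additive over adjacent intervals and hold in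
  charts, so they hold on the whole interval by bisection.
\<close>

lemma H2_curve_energy:
  assumes q: "H2_curve A a b q" and ab: "a < b" and t: "t \<in> {a..b}"
  shows "(\<lambda>u. (accel {a..b} q u)\<^sup>2) absolutely_integrable_on {a..t}"
    and "accel {a..b} q absolutely_integrable_on {a..t}"
    and "\<bar>(speed_within {a..b} q t)\<^sup>2 - (speed_within {a..b} q a)\<^sup>2\<bar>
       \<le> integral {a..t} (\<lambda>u. 2 * accel {a..b} q u * speed_within {a..b} q u)"
proof -
  let ?W = "speed_within {a..b} q" and ?\<phi> = "accel {a..b} q"
  let ?I = "\<lambda>s t. integral {s..t} (\<lambda>u. 2 * ?\<phi> u * ?W u)"
  have q1: "C1_curve A a b q" by (rule H2_curve_imp_C1_curve[OF q])
  have qc: "continuous_on {a..b} q" using q by (simp add: H2_curve_def)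
  have Wc: "continuous_on {a..b} ?W" by (rule C1_curve_continuous_speed[OF q1 ab])
  define P where "P s t \<longleftrightarrow> (a \<le> s \<and> t \<le> b \<longrightarrow>
     (\<lambda>u. (?\<phi> u)\<^sup>2) absolutely_integrable_on {s..t} \<and> ?\<phi> absolutely_integrable_on {s..t} \<and>
     \<bar>(?W t)\<^sup>2 - (?W s)\<^sup>2\<bar> \<le> ?I s t)" for s t
  have "P a t"
  proof (rule Bolzano)
    show "a \<le> t" using t by simp
  next
    fix x y z assume P: "P x y" "P y z" and xyz: "x \<le> y" "y \<le> z"
    show "P x z" unfolding P_def
    proof
      assume b: "a \<le> x \<and> z \<le> b"
      have i: "(\<lambda>u. (?\<phi> u)\<^sup>2) absolutely_integrable_on {x..z}" "?\<phi> absolutely_integrable_on {x..z}"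
        using P b xyz by (auto simp: P_def intro!: set_integrable_union_adjacent[where t = y])
      have "continuous_on {x..z} (\<lambda>u. 2 * ?W u)"
        using b by (intro continuous_intros continuous_on_subset[OF Wc]) auto
      from absolutely_integrable_times_continuous(1)[OF i(2) this]
      have "(\<lambda>u. 2 * ?\<phi> u * ?W u) integrable_on {x..z}"
        by (simp add: mult_ac set_lebesgue_integral_eq_integral(1))
      then have "?I x y + ?I y z =
         ?I x z"
        using xyz by (intro Henstock_Kurzweil_Integration.integral_combine) auto
      moreover have "\<bar>(?W y)\<^sup>2 - (?W x)\<^sup>2\<bar> \<le> ?I x y"
        "\<bar>(?W z)\<^sup>2 - (?W y)\<^sup>2\<bar> \<le> ?I y z"
        using P b xyz by (auto simp: P_def)
      ultimately show "(\<lambda>u. (?\<phi> u)\<^sup>2) absolutely_integrable_on {x..z} \<and> ?\<phi> absolutely_integrable_on {x..z} \<and>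
         \<bar>(?W z)\<^sup>2 - (?W x)\<^sup>2\<bar> \<le> ?I x z"
        using i by linarith
    qed
  next
    fix x assume x: "a \<le> x" "x \<le> t"
    then have xab: "x \<in> {a..b}" using t by auto
    obtain c where c: "c \<in> A" "q x \<in> fst c" using ex_chart mem_charts_at by metis
    obtain s t' d where st: "a \<le> s" "s < t'" "t' \<le> b" "s \<le> x" "x \<le> t'" "q ` {s..t'} \<subseteq> fst c" "d > 0"
      and d: "{a..b} \<inter> ball x d \<subseteq> {s..t'}"
      and at: "\<forall>u\<in>ball x d. at u within {s..t'} = at u within {a..b}"
    by (rule subinterval_in_open[OF qc ab xab open_chart_domain[OF c(1)] c(2)])
    have "P p r" if pr: "p \<le> x" "x \<le> r" "r - p < d" for p r
      unfolding P_def
    proof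
      assume b: "a \<le> p \<and> r \<le> b"
      show "(\<lambda>u. (?\<phi> u)\<^sup>2) absolutely_integrable_on {p..r} \<and> ?\<phi> absolutely_integrable_on {p..r} \<and>
         \<bar>(?W r)\<^sup>2 - (?W p)\<^sup>2\<bar> \<le> ?I p r"
      proof (cases "p = r")
        case True
        have "f absolutely_integrable_on {r..r}" for f :: "real \<Rightarrow> real"
          by (rule absolutely_integrable_continuous_real) simp
        with True show ?thesis by simp
      next
        case False
        then have "p < r" using pr by simp
        moreover have "{p..r} \<subseteq> {a..b} \<inter> ball x d" using pr b by (auto simp: dist_real_def)
        then have "q ` {p..r} \<subseteq> fst c" using st d by blast
        ultimately show ?thesis using H2_curve_energy_on_chart[OF q _ _ _ c(1), of p r] b by auto
      qed
    qed
    then show "\<exists>d>0. \<forall>p r. p \<le> x \<and> x \<le> r \<and> r - p < d \<longrightarrow> P p r" using st by blast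
  qed
  then show "(\<lambda>u. (?\<phi> u)\<^sup>2) absolutely_integrable_on {a..t}" "?\<phi> absolutely_integrable_on {a..t}"
    "\<bar>(?W t)\<^sup>2 - (?W a)\<^sup>2\<bar> \<le> ?I a t"
    using t by (auto simp: P_def)
qed

text \<open>
  At the time of maximal speed \<open>w\<close>, the energy inequality reads \<open>w\<^sup>2 \<le>
  w\<^sub>0\<^sup>2 + 2 w F\<close>, where \<open>w\<^sub>0\<close> is the initial speed and
  \<open>F\<close> the integral of the acceleration; hence \<open>w \<le> w\<^sub>0 + 2 F\<close>.
  The elementary inequality \<open>2 x \<le> 1 + x\<^sup>2\<close> bounds \<open>2 F\<close> by
  \<open>b - a\<close> plus the integral of the squared acceleration.
\<close>

lemma H2_curve_speed_bound:
  assumes q: "H2_curve A a b q" and ab: "a < b" and t: "t \<in> {a..b}"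
  shows "speed_within {a..b} q t \<le> speed_within {a..b} q a + (b - a) + integral {a..b} (\<lambda>u. (accel {a..b} q u)\<^sup>2)"
proof -
  let ?W = "speed_within {a..b} q" and ?\<phi> = "accel {a..b} q"
  have q1: "C1_curve A a b q" by (rule H2_curve_imp_C1_curve[OF q])
  have Wc: "continuous_on {a..b} ?W" by (rule C1_curve_continuous_speed[OF q1 ab])
  have W0: "?W u \<ge> 0" if "u \<in> {a..b}" for u by (rule C1_curve_speed_nonneg[OF q1 ab that])
  obtain m where m: "m \<in> {a..b}" "\<And>u. u \<in> {a..b} \<Longrightarrow> ?W u \<le> ?W m"
    using continuous_attains_sup[OF compact_Icc _ Wc] ab by (auto simp: not_less)
  have bb: "b \<in> {a..b}" using ab by simp
  have i2: "(\<lambda>u. (?\<phi> u)\<^sup>2) integrable_on {a..b}"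
    by (rule set_lebesgue_integral_eq_integral(1)[OF H2_curve_energy(1)[OF q ab bb]])
  have i1: "(\<lambda>u. \<bar>?\<phi> u\<bar>) integrable_on {a..b}"
    using H2_curve_energy(2)[OF q ab bb] unfolding absolutely_integrable_on_def real_norm_def by (rule conjunct2)
  define F where "F = integral {a..b} (\<lambda>u. \<bar>?\<phi> u\<bar>)"
  have F0: "F \<ge> 0" unfolding F_def using i1 by (intro Henstock_Kurzweil_Integration.integral_nonneg) auto
  have Fle: "2 * F \<le> (b - a) + integral {a..b} (\<lambda>u. (?\<phi> u)\<^sup>2)"
  proof -
    have "2 * F = integral {a..b} (\<lambda>u. 2 * \<bar>?\<phi> u\<bar>)" by (simp add: F_def)
    also have "\<dots> \<le> integral {a..b} (\<lambda>u. 1 + (?\<phi> u)\<^sup>2)"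
    proof (rule integral_le)
      show "(\<lambda>u. 2 * \<bar>?\<phi> u\<bar>) integrable_on {a..b}" using i1 by (rule integrable_on_mult_right)
      show "(\<lambda>u. 1 + (?\<phi> u)\<^sup>2) integrable_on {a..b}" using i2 by (intro integrable_add) auto
      fix u
      have "0 \<le> (\<bar>?\<phi> u\<bar> - 1)\<^sup>2" by simp
      then show "2 * \<bar>?\<phi> u\<bar> \<le> 1 + (?\<phi> u)\<^sup>2" by (simp add: power2_eq_square algebra_simps)
    qed
    also have "\<dots> = (b - a) + integral {a..b} (\<lambda>u. (?\<phi> u)\<^sup>2)"
      using i2 ab by (subst integral_add) auto
    finally show ?thesis .
  qed
  have "(?W m)\<^sup>2 - (?W a)\<^sup>2 \<le> integral {a..m} (\<lambda>u. 2 * ?\<phi> u * ?W u)"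
    using H2_curve_energy(3)[OF q ab m(1)] by simp
  also have "\<dots> \<le> integral {a..m} (\<lambda>u. 2 * ?W m * \<bar>?\<phi> u\<bar>)"
  proof (rule integral_le)
    have am: "continuous_on {a..m} (\<lambda>u. 2 * ?W u)" using m by (intro continuous_intros continuous_on_subset[OF Wc]) auto
    show "(\<lambda>u. 2 * ?\<phi> u * ?W u) integrable_on {a..m}"
      using absolutely_integrable_times_continuous(1)[OF H2_curve_energy(2)[OF q ab m(1)] am]
      by (simp add: mult_ac set_lebesgue_integral_eq_integral(1))
    show "(\<lambda>u. 2 * ?W m * \<bar>?\<phi> u\<bar>) integrable_on {a..m}"
      using m by (intro integrable_on_mult_right integrable_subinterval_real[OF i1]) auto
    fix u assume u: "u \<in> {a..m}"
    then have "u \<in> {a..b}" using m by auto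
    then have "?\<phi> u * ?W u \<le> \<bar>?\<phi> u\<bar> * ?W m"
      using m(2)[of u] W0[of u] by (intro mult_mono) auto
    then show "2 * ?\<phi> u * ?W u \<le> 2 * ?W m * \<bar>?\<phi> u\<bar>" by (simp add: mult_ac)
  qed
  also have "\<dots> = 2 * ?W m * integral {a..m} (\<lambda>u. \<bar>?\<phi> u\<bar>)" by simp
  also have "\<dots> \<le> 2 * ?W m * F"
    unfolding F_def using W0[OF m(1)] m i1
    by (intro mult_left_mono integral_subset_le integrable_subinterval_real[OF i1]) auto
  finally have *: "?W m * ?W m \<le> ?W a * ?W a + ?W m * (2 * F)" by (simp add: power2_eq_square mult_ac)
  have "?W m \<le> ?W a + 2 * F"
  proof (rule ccontr)
    assume "\<not> ?W m \<le> ?W a + 2 * F"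
    then have gt: "?W a + 2 * F < ?W m" by simp
    have aa: "a \<in> {a..b}" using ab by simp
    have "?W a * ?W a + ?W m * (2 * F) \<le> ?W m * ?W a + ?W m * (2 * F)"
      using W0[OF aa] m(2)[OF aa] by (simp add: mult_right_mono)
    also have "\<dots> = ?W m * (?W a + 2 * F)" by (simp add: algebra_simps)
    also have "\<dots> < ?W m * ?W m" using gt F0 W0[OF aa] by (intro mult_strict_left_mono) auto
    finally show False using * by simp
  qed
  then show ?thesis using m(2)[OF t] Fle by simp
qed

end


section \<open>Length and the Riemannian distance\<close>

lemma C1_curve_subinterval:
  assumes "C1_curve A a b q" "a \<le> s" "t \<le> b"
  shows "C1_curve A s t q"
  using assms continuous_on_subset[of "{a..b}" q "{s..t}"] by (auto simp: C1_curve_def)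

lemma C1_curve_cong:
  assumes "C1_curve A a b q" and eq: "\<And>t. t \<in> {a..b} \<Longrightarrow> q t = q' t"
  shows "C1_curve A a b q'"
  unfolding C1_curve_def
proof (intro conjI ballI allI impI)
  show "continuous_on {a..b} q'"
    using assms by (auto simp: C1_curve_def intro: continuous_on_eq)
  fix c s t assume c: "c \<in> A" and st: "a \<le> s \<and> s < t \<and> t \<le> b \<and> q' ` {s..t} \<subseteq> fst c"
  have eq': "q u = q' u" if "u \<in> {s..t}" for u using eq that st by auto
  then have "q ` {s..t} = q' ` {s..t}" by (intro image_cong) auto
  then have "C1_on s t (snd c \<circ> q)" using assms(1) c st by (simp add: C1_curve_def)
  then obtain x' where x': "continuous_on {s..t} x'"
    "\<And>u. u \<in> {s..t} \<Longrightarrow> (snd c \<circ> q has_vector_derivative x' u) (at u within {s..t})"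
    by (auto simp: C1_on_def)
  have "(snd c \<circ> q' has_vector_derivative x' u) (at u within {s..t})" if u: "u \<in> {s..t}" for u
    using x'(2)[OF u] unfolding has_vector_derivative_def
    by (rule has_derivative_transform_within[OF _ zero_less_one u]) (simp add: eq')
  then show "C1_on s t (snd c \<circ> q')" using x'(1) by (auto simp: C1_on_def)
qed

lemma C1_curve_imp_piecewise:
  assumes q: "C1_curve A a b q"
  shows "piecewise_C1_curve A a b q"
proof -
  have "continuous_on {a..b} q" using q by (simp add: C1_curve_def)
  then show ?thesis
    unfolding piecewise_C1_curve_def using C1_curve_subinterval[OF q] by blast
qed

lemma piecewise_C1_curve_subinterval:
  assumes q: "piecewise_C1_curve A a b q" and st: "a \<le> s" "t \<le> b"
  shows "piecewise_C1_curve A s t q"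
proof -
  obtain D where "finite D"
    and D: "\<And>s t. a \<le> s \<Longrightarrow> s < t \<Longrightarrow> t \<le> b \<Longrightarrow> {s<..<t} \<inter> D = {} \<Longrightarrow> C1_curve A s t q"
    using q by (auto simp: piecewise_C1_curve_def)
  moreover have "continuous_on {s..t} q"
    using q st by (auto simp: piecewise_C1_curve_def intro: continuous_on_subset)
  ultimately show ?thesis
    using st unfolding piecewise_C1_curve_def by (auto intro!: exI[of _ D] D)
qed

text \<open>
  A property that is additive over adjacent intervals and holds on \<open>C\<^sup>1\<close> pieces
  holds on the whole interval: around each time the finitely many break points leave at most one,
  and bisection does the rest.
\<close>

lemma piecewise_C1_curve_induct:
  assumes q: "piecewise_C1_curve A a b q" and ab: "a < b"
    and piece: "\<And>s t. a \<le> s \<Longrightarrow> s < t \<Longrightarrow> t \<le> b \<Longrightarrow> C1_curve A s t q \<Longrightarrow> P s t"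
    and join: "\<And>s t u. a \<le> s \<Longrightarrow> s < t \<Longrightarrow> t < u \<Longrightarrow> u \<le> b \<Longrightarrow> P s t \<Longrightarrow> P t u \<Longrightarrow> P s u"
  shows "P a b"
proof -
  obtain D where D: "finite D"
    "\<And>s t. a \<le> s \<Longrightarrow> s < t \<Longrightarrow> t \<le> b \<Longrightarrow> {s<..<t} \<inter> D = {} \<Longrightarrow> C1_curve A s t q"
    using q by (auto simp: piecewise_C1_curve_def)
  define P' where "P' s t \<longleftrightarrow> (a \<le> s \<and> s < t \<and> t \<le> b \<longrightarrow> P s t)" for s t
  have "P' a b"
  proof (rule Bolzano)
    show "a \<le> b" using ab by simp
  next
    fix x y z assume "P' x y" "P' y z" "x \<le> y" "y \<le> z"
    then show "P' x z" using join[of x y z] unfolding P'_def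
      by (metis le_less less_le_trans order_trans)
  next
    fix x assume x: "a \<le> x" "x \<le> b"
    obtain d where d: "d > 0" "\<forall>y\<in>D. y \<noteq> x \<longrightarrow> d \<le> dist x y" using finite_set_avoid[OF D(1)] by blast
    have "P' p r" if pr: "p \<le> x" "x \<le> r" "r - p < d" for p r
      unfolding P'_def
    proof
      assume b: "a \<le> p \<and> p < r \<and> r \<le> b"
      have "{p<..<x} \<inter> D = {}" "{x<..<r} \<inter> D = {}"
        using d(2) pr by (force simp: dist_real_def)+
      then have px: "p < x \<Longrightarrow> P p x" and xr: "x < r \<Longrightarrow> P x r"
        using b x by (auto intro!: piece D(2))
      show "P p r"
      proof (cases "p < x \<and> x < r")
        case True
        then show ?thesis using px xr b by (intro join[of p x r]) auto
      next
        case False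
        then have "p = x \<or> x = r" using pr by auto
        then show ?thesis using px xr b by blast
      qed
    qed
    then show "\<exists>d>0. \<forall>p r. p \<le> x \<and> x \<le> r \<and> r - p < d \<longrightarrow> P' p r" using d by blast
  qed
  then show ?thesis using ab by (simp add: P'_def)
qed

lemma piecewise_C1_curve_regular_points:
  assumes q: "piecewise_C1_curve A a b q"
  obtains D where "finite D" "\<forall>t\<in>{a<..<b} - D. \<exists>s u. a \<le> s \<and> s < t \<and> t < u \<and> u \<le> b \<and> C1_curve A s u q"
proof -
  obtain D where D: "finite D"
    "\<And>s t. a \<le> s \<Longrightarrow> s < t \<Longrightarrow> t \<le> b \<Longrightarrow> {s<..<t} \<inter> D = {} \<Longrightarrow> C1_curve A s t q"
    using q by (auto simp: piecewise_C1_curve_def)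
  have "\<exists>s u. a \<le> s \<and> s < t \<and> t < u \<and> u \<le> b \<and> C1_curve A s u q" if t: "t \<in> {a<..<b} - D" for t
  proof -
    obtain d where d: "d > 0" "\<forall>y\<in>D. y \<noteq> t \<longrightarrow> d \<le> dist t y" using finite_set_avoid[OF D(1)] by blast
    have "{max a (t - d)<..<min b (t + d)} \<inter> D = {}" using d(2) t by (force simp: dist_real_def)
    then have "C1_curve A (max a (t - d)) (min b (t + d)) q" using t d(1) by (intro D(2)) auto
    then show ?thesis using t d(1) by (intro exI[of _ "max a (t - d)"] exI[of _ "min b (t + d)"]) auto
  qed
  then show thesis using that D(1) by blast
qed

context riemannian
begin

text \<open>
  The speed computed from two-sided derivatives. It does not refer to the parameter interval, so it
  can be integrated over parts of a curve; it agrees with the speed relative to \<open>[a,b]\<close>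
  except at the two end points.
\<close>

abbreviation speed :: "(real \<Rightarrow> 'q) \<Rightarrow> real \<Rightarrow> real" where
  "speed \<equiv> speed_within UNIV"

lemma speed_within_interior: "t \<in> {a<..<b} \<Longrightarrow> speed_within {a..b} q t = speed q t"
  by (simp add: velocity_def at_within_Icc_at)

lemma speed_cong:
  assumes S: "open S" "t \<in> S" and eq: "\<And>s. s \<in> S \<Longrightarrow> q s = q' s"
  shows "speed q t = speed q' t"
proof -
  have ev: "\<forall>\<^sub>F s in nhds t. q s = q' s"
    using eventually_nhds_in_open[OF S] by eventually_elim (rule eq)
  have "vector_derivative (snd c \<circ> q) (at t) = vector_derivative (snd c \<circ> q') (at t)" for c :: "('q, 'e) chart"
    by (rule vector_derivative_cong_eq) (use ev in \<open>auto elim: eventually_mono\<close>)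
  then show ?thesis using eq[OF S(2)] by (simp add: velocity_def)
qed

lemma C1_curve_speed_integral:
  assumes q: "C1_curve A a b q" and ab: "a < b"
  shows "speed q absolutely_integrable_on {a..b}" "0 \<le> integral {a..b} (speed q)"
    "integral {a..b} (speed q) = integral {a..b} (speed_within {a..b} q)"
proof -
  have W: "speed_within {a..b} q absolutely_integrable_on {a..b}"
    by (rule absolutely_integrable_continuous_real[OF C1_curve_continuous_speed[OF q ab]])
  have eq: "speed q t = speed_within {a..b} q t" if "t \<in> {a..b} - {a, b}" for t
    using that by (intro speed_within_interior[symmetric]) auto
  have neg: "negligible {a, b}" by simp
  show "speed q absolutely_integrable_on {a..b}" by (rule absolutely_integrable_spike[OF W neg eq])
  show "integral {a..b} (speed q) = integral {a..b} (speed_within {a..b} q)"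
    by (rule integral_spike[OF neg]) (simp add: eq)
  moreover have "0 \<le> integral {a..b} (speed_within {a..b} q)"
    using C1_curve_speed_nonneg[OF q ab]
    by (intro Henstock_Kurzweil_Integration.integral_nonneg set_lebesgue_integral_eq_integral(1)[OF W])
  ultimately show "0 \<le> integral {a..b} (speed q)" by simp
qed

lemma piecewise_C1_curve_speed_integral:
  assumes q: "piecewise_C1_curve A a b q" and ab: "a < b"
  shows "speed q absolutely_integrable_on {a..b}" "0 \<le> integral {a..b} (speed q)"
    "curve_length A g a b q = integral {a..b} (speed q)"
proof -
  have *: "speed q absolutely_integrable_on {a..b} \<and> 0 \<le> integral {a..b} (speed q)"
  proof (rule piecewise_C1_curve_induct[OF q ab, where P = "\<lambda>a b. speed q absolutely_integrable_on {a..b} \<and> 0 \<le> integral {a..b} (speed q)"])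
    show "speed q absolutely_integrable_on {s..t} \<and> 0 \<le> integral {s..t} (speed q)"
      if "s < t" "C1_curve A s t q" for s t
      using C1_curve_speed_integral(1,2)[OF that(2,1)] by (rule conjI)
    fix s t u
    assume stu: "s < t" "t < u"
      and P: "speed q absolutely_integrable_on {s..t} \<and> 0 \<le> integral {s..t} (speed q)"
        "speed q absolutely_integrable_on {t..u} \<and> 0 \<le> integral {t..u} (speed q)"
    have i: "speed q absolutely_integrable_on {s..u}"
      by (rule set_integrable_union_adjacent[OF conjunct1[OF P(1)] conjunct1[OF P(2)]]) (use stu in auto)
    then have "integral {s..t} (speed q) + integral {t..u} (speed q) = integral {s..u} (speed q)"
      using stu by (intro Henstock_Kurzweil_Integration.integral_combine set_lebesgue_integral_eq_integral(1)[OF i]) auto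
    then show "speed q absolutely_integrable_on {s..u} \<and> 0 \<le> integral {s..u} (speed q)" using i P by linarith
  qed
  then show i: "speed q absolutely_integrable_on {a..b}" and "0 \<le> integral {a..b} (speed q)" by auto
  have eq: "speed_within {a..b} q t = speed q t" if "t \<in> {a..b} - {a, b}" for t
    using that by (intro speed_within_interior) auto
  have neg: "negligible {a, b}" by simp
  have "speed_within {a..b} q absolutely_integrable_on {a..b}" by (rule absolutely_integrable_spike[OF i neg eq])
  then have "curve_length A g a b q = integral {a..b} (speed_within {a..b} q)"
    unfolding curve_length_def by (rule set_lebesgue_integral_eq_integral(2))
  also have "\<dots> = integral {a..b} (speed q)" by (rule integral_spike[OF neg]) (simp add: eq)
  finally show "curve_length A g a b q = integral {a..b} (speed q)" .
qed

lemma C1_curve_affine: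
  assumes q: "C1_curve A a b q" and m: "m \<noteq> 0" and sub: "\<And>u. u \<in> {s..t} \<Longrightarrow> m * u + k \<in> {a..b}"
  shows "C1_curve A s t (\<lambda>u. q (m * u + k))"
  unfolding C1_curve_def
proof (intro conjI ballI allI impI)
  have "continuous_on {a..b} q" using q by (simp add: C1_curve_def)
  then show "continuous_on {s..t} (\<lambda>u. q (m * u + k))"
    by (rule continuous_on_compose2) (use sub in \<open>auto intro!: continuous_intros\<close>)
  fix c s' t' assume c: "c \<in> A" and st: "s \<le> s' \<and> s' < t' \<and> t' \<le> t \<and> (\<lambda>u. q (m * u + k)) ` {s'..t'} \<subseteq> fst c"
  have sub': "m * u + k \<in> {a..b}" "q (m * u + k) \<in> fst c" if "u \<in> {s'..t'}" for u using sub that st by auto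
  have "m * s' + k \<noteq> m * t' + k" using m st by simp
  moreover have "m * s' + k \<in> {a..b}" "m * t' + k \<in> {a..b}" using sub'(1) st by auto
  ultimately have ab: "a < b" unfolding atLeastAtMost_iff by linarith
  let ?\<phi> = "\<lambda>u. m * u + k"
  show "C1_on s' t' (snd c \<circ> (\<lambda>u. q (m * u + k)))"
    unfolding C1_on_def
  proof (intro exI conjI ballI)
    have "continuous_on {u\<in>{a..b}. q u \<in> fst c} (\<lambda>u. velocity A {a..b} q u c)"
      by (rule C1_curve_continuous_on_chart(2)[OF q ab _ _ c]) auto
    then have "continuous_on {s'..t'} (\<lambda>u. velocity A {a..b} q (?\<phi> u) c)"
      by (rule continuous_on_compose2) (use sub' in \<open>auto intro!: continuous_intros\<close>)
    then show "continuous_on {s'..t'} (\<lambda>u. m *\<^sub>R velocity A {a..b} q (?\<phi> u) c)" by (intro continuous_intros)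
    fix u assume u: "u \<in> {s'..t'}"
    have "(?\<phi> has_vector_derivative m) (at u within {s'..t'})"
      by (auto intro!: derivative_eq_intros simp: has_vector_derivative_def)
    moreover have "(snd c \<circ> q has_vector_derivative velocity A {a..b} q (?\<phi> u) c) (at (?\<phi> u) within ?\<phi> ` {s'..t'})"
    proof (rule has_vector_derivative_within_subset[OF C1_curve_local(1)[OF q ab sub'(1)[OF u]]])
      show "c \<in> charts_at A (q (m * u + k))" using sub'[OF u] c by (simp add: mem_charts_at)
      show "?\<phi> ` {s'..t'} \<subseteq> {a..b}" using sub' by blast
    qed
    ultimately have "(snd c \<circ> q \<circ> ?\<phi> has_vector_derivative m *\<^sub>R velocity A {a..b} q (?\<phi> u) c) (at u within {s'..t'})"
      by (rule vector_diff_chain_within)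
    then show "(snd c \<circ> (\<lambda>u. q (m * u + k)) has_vector_derivative m *\<^sub>R velocity A {a..b} q (?\<phi> u) c) (at u within {s'..t'})"
      by (simp add: o_def)
  qed
qed

lemma C1_curve_speed_affine:
  assumes q: "C1_curve A a b q" and u: "m * u + k \<in> {a<..<b}"
  shows "speed (\<lambda>u. q (m * u + k)) u = \<bar>m\<bar> * speed q (m * u + k)"
proof -
  let ?\<phi> = "\<lambda>u. m * u + k"
  have ab: "a < b" and u': "?\<phi> u \<in> {a..b}" using u by auto
  obtain c where c: "c \<in> charts_at A (q (?\<phi> u))" using ex_chart by blast
  define w where "w = velocity A {a..b} q (?\<phi> u) c"
  have at: "at (?\<phi> u) within {a..b} = at (?\<phi> u)" using u by (simp add: at_within_Icc_at)
  have d: "(snd c \<circ> q has_vector_derivative w) (at (?\<phi> u))"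
    using C1_curve_local(1)[OF q ab u' c] at by (simp add: w_def)
  have "continuous (at (?\<phi> u) within {a..b}) q"
    using q u' by (simp add: C1_curve_def continuous_on_eq_continuous_within)
  then have cont: "continuous (at (?\<phi> u)) q" unfolding at .
  have v1: "velocity A UNIV q (?\<phi> u) = tvec_of A c (q (?\<phi> u)) w"
    by (rule velocity_eq_tvec_of) (use c d cont in auto)
  have "(?\<phi> has_vector_derivative m) (at u)"
    by (auto intro!: derivative_eq_intros simp: has_vector_derivative_def)
  then have "(snd c \<circ> q \<circ> ?\<phi> has_vector_derivative m *\<^sub>R w) (at u)"
    using d by (rule vector_diff_chain_at)
  then have d2: "(snd c \<circ> (\<lambda>u. q (?\<phi> u)) has_vector_derivative m *\<^sub>R w) (at u)" by (simp add: o_def)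
  have "continuous (at u) (\<lambda>u. q (?\<phi> u))"
    by (rule isCont_o2[where f = ?\<phi> and g = q and a = u, OF _ cont]) (intro continuous_intros)
  then have v2: "velocity A UNIV (\<lambda>u. q (?\<phi> u)) u = tvec_of A c (q (?\<phi> u)) (m *\<^sub>R w)"
    by (intro velocity_eq_tvec_of) (use c d2 in auto)
  have bl: "bilinear (metric_comp A g c (q (?\<phi> u)))" using metric_comp_pos_def[OF c] by (simp add: pos_def_form_def)
  have "sqrt (m * (m * x)) = \<bar>m\<bar> * sqrt x" for x
    by (metis mult.assoc real_sqrt_abs2 real_sqrt_mult)
  then show ?thesis
    by (simp add: v1 v2 tnorm_tvec_of bilinear_lmul[OF bl] bilinear_rmul[OF bl])
qed

text \<open>
  A negative slope \<open>m\<close> gives the reversed curve, which yields the symmetry of the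
  distance.
\<close>

lemma piecewise_C1_curve_affine:
  assumes q: "piecewise_C1_curve A a b q" and ab: "a < b" and m: "m \<noteq> 0" and st: "s < t"
    and im: "(\<lambda>u. m * u + k) ` {s..t} = {a..b}"
  shows "piecewise_C1_curve A s t (\<lambda>u. q (m * u + k))"
    and "integral {s..t} (speed (\<lambda>u. q (m * u + k))) = integral {a..b} (speed q)"
proof -
  let ?\<phi> = "\<lambda>u. m * u + k"
  have inj: "inj ?\<phi>" using m by (auto intro: injI)
  obtain D where D: "finite D"
    "\<And>s t. a \<le> s \<Longrightarrow> s < t \<Longrightarrow> t \<le> b \<Longrightarrow> {s<..<t} \<inter> D = {} \<Longrightarrow> C1_curve A s t q"
    using q by (auto simp: piecewise_C1_curve_def)
  have sub: "?\<phi> u \<in> {a..b}" if "u \<in> {s..t}" for u using im that by blast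
  show "piecewise_C1_curve A s t (\<lambda>u. q (m * u + k))"
    unfolding piecewise_C1_curve_def
  proof (intro conjI exI[of _ "?\<phi> -` D"] allI impI)
    have "continuous_on {a..b} q" using q by (simp add: piecewise_C1_curve_def)
    then show "continuous_on {s..t} (\<lambda>u. q (m * u + k))"
      by (rule continuous_on_compose2) (use sub in \<open>auto intro!: continuous_intros\<close>)
    show "finite (?\<phi> -` D)" using D(1) inj by (rule finite_vimageI)
    fix s' t' assume *: "s \<le> s' \<and> s' < t' \<and> t' \<le> t \<and> {s'<..<t'} \<inter> ?\<phi> -` D = {}"
    let ?a = "min (?\<phi> s') (?\<phi> t')" and ?b = "max (?\<phi> s') (?\<phi> t')"
    have "?\<phi> s' \<noteq> ?\<phi> t'" using m * by simp
    then have lt: "?a < ?b" by linarith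
    have "{?a<..<?b} \<inter> D = {}"
    proof (rule ccontr)
      assume "{?a<..<?b} \<inter> D \<noteq> {}"
      then obtain y where y: "?a < y" "y < ?b" "y \<in> D" by auto
      define u where "u = (y - k) / m"
      have yu: "y = ?\<phi> u" using m by (simp add: u_def)
      have "u \<in> {s'<..<t'}"
        using y * m unfolding yu by (cases "m > 0") (auto simp: min_def max_def not_less mult_less_cancel_left split: if_splits)
      then show False using y yu * by auto
    qed
    moreover have "a \<le> ?a" "?b \<le> b" using sub[of s'] sub[of t'] * by auto
    ultimately have C: "C1_curve A ?a ?b q" using lt by (intro D(2)) auto
    show "C1_curve A s' t' (\<lambda>u. q (m * u + k))"
    proof (rule C1_curve_affine[OF C m])
      fix u assume u: "u \<in> {s'..t'}"
      show "m * u + k \<in> {?a..?b}"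
        using u by (cases "m > 0") (auto simp: min_le_iff_disj le_max_iff_disj mult_le_cancel_left)
    qed
  qed
  obtain D' where D': "finite D'" "\<forall>t\<in>{a<..<b} - D'. \<exists>s u. a \<le> s \<and> s < t \<and> t < u \<and> u \<le> b \<and> C1_curve A s u q"
    by (rule piecewise_C1_curve_regular_points[OF q])
  let ?N = "?\<phi> -` (insert a (insert b D'))"
  have N: "negligible ?N" using D'(1) inj by (intro negligible_finite finite_vimageI) auto
  have eq: "speed (\<lambda>u. q (?\<phi> u)) u = \<bar>m\<bar> * speed q (?\<phi> u)" if u: "u \<in> {s..t} - ?N" for u
  proof -
    have "?\<phi> u \<in> {a<..<b} - D'" using u sub[of u] by (auto simp: less_le)
    then obtain s' u' where "s' < ?\<phi> u" "?\<phi> u < u'" "C1_curve A s' u' q" using D'(2) by blast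
    then show ?thesis by (intro C1_curve_speed_affine) auto
  qed
  have "(speed q has_integral integral {a..b} (speed q)) (cbox a b)"
    using set_lebesgue_integral_eq_integral(1)[OF piecewise_C1_curve_speed_integral(1)[OF q ab]]
    unfolding box_real(2) by (rule integrable_integral)
  from has_integral_affinity[OF this m, of k]
  have I: "((\<lambda>x. speed q (?\<phi> x)) has_integral (1 / \<bar>m\<bar>) * integral {a..b} (speed q))
     ((\<lambda>x. (1 / m) *\<^sub>R x + - ((1 / m) *\<^sub>R k)) ` {a..b})" by (simp add: cbox_interval)
  have "(\<lambda>x. (1 / m) *\<^sub>R x + - ((1 / m) *\<^sub>R k)) ` {a..b} = {s..t}"
    unfolding im[symmetric] image_image using m by (simp add: field_simps)
  with I have "((\<lambda>x. speed q (?\<phi> x)) has_integral (1 / \<bar>m\<bar>) * integral {a..b} (speed q)) {s..t}" by simp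
  from has_integral_mult_right[OF this, of "\<bar>m\<bar>"]
  have "((\<lambda>x. \<bar>m\<bar> * speed q (?\<phi> x)) has_integral integral {a..b} (speed q)) {s..t}" using m by simp
  then have "integral {s..t} (\<lambda>x. \<bar>m\<bar> * speed q (?\<phi> x)) = integral {a..b} (speed q)" by (rule integral_unique)
  moreover have "integral {s..t} (speed (\<lambda>u. q (?\<phi> u))) = integral {s..t} (\<lambda>x. \<bar>m\<bar> * speed q (?\<phi> x))"
    by (rule integral_spike[OF N]) (simp only: eq)
  ultimately show "integral {s..t} (speed (\<lambda>u. q (m * u + k))) = integral {a..b} (speed q)" by simp
qed

lemma piecewise_C1_curve_join:
  assumes q1: "piecewise_C1_curve A a b q1" and q2: "piecewise_C1_curve A b c q2"
    and eq: "q1 b = q2 b" and abc: "a < b" "b < c"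
  defines "q \<equiv> (\<lambda>t. if t \<le> b then q1 t else q2 t)"
  shows "piecewise_C1_curve A a c q"
    and "integral {a..c} (speed q) = integral {a..b} (speed q1) + integral {b..c} (speed q2)"
proof -
  have e1: "q1 t = q t" if "t \<in> {a..b}" for t using that by (simp add: q_def)
  have e2: "q2 t = q t" if "t \<in> {b..c}" for t using that eq by (auto simp: q_def)
  obtain D1 where D1: "finite D1"
    "\<And>s t. a \<le> s \<Longrightarrow> s < t \<Longrightarrow> t \<le> b \<Longrightarrow> {s<..<t} \<inter> D1 = {} \<Longrightarrow> C1_curve A s t q1"
    using q1 by (auto simp: piecewise_C1_curve_def)
  obtain D2 where D2: "finite D2"
    "\<And>s t. b \<le> s \<Longrightarrow> s < t \<Longrightarrow> t \<le> c \<Longrightarrow> {s<..<t} \<inter> D2 = {} \<Longrightarrow> C1_curve A s t q2"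
    using q2 by (auto simp: piecewise_C1_curve_def)
  show pc: "piecewise_C1_curve A a c q"
    unfolding piecewise_C1_curve_def
  proof (intro conjI exI[of _ "D1 \<union> D2 \<union> {b}"] allI impI)
    have "continuous_on {a..b} q" "continuous_on {b..c} q"
      using q1 q2 e1 e2 by (auto simp: piecewise_C1_curve_def intro: continuous_on_eq)
    then have "continuous_on ({a..b} \<union> {b..c}) q" by (intro continuous_on_closed_Un) auto
    moreover have "{a..b} \<union> {b..c} = {a..c}" using abc by auto
    ultimately show "continuous_on {a..c} q" by simp
    show "finite (D1 \<union> D2 \<union> {b})" using D1 D2 by simp
    fix s t assume *: "a \<le> s \<and> s < t \<and> t \<le> c \<and> {s<..<t} \<inter> (D1 \<union> D2 \<union> {b}) = {}"
    then have "t \<le> b \<or> b \<le> s" by (auto simp: not_le)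
    then show "C1_curve A s t q"
    proof
      assume "t \<le> b"
      then show ?thesis using * e1 by (intro C1_curve_cong[OF D1(2)]) auto
    next
      assume "b \<le> s"
      then show ?thesis using * e2 by (intro C1_curve_cong[OF D2(2)]) auto
    qed
  qed
  have neg: "negligible {b}" by simp
  have s1: "integral {a..b} (speed q) = integral {a..b} (speed q1)"
  proof (rule integral_spike[OF neg])
    fix t assume "t \<in> {a..b} - {b}"
    then show "speed q1 t = speed q t" by (intro speed_cong[of "{..<b}"]) (auto simp: q_def)
  qed
  have s2: "integral {b..c} (speed q) = integral {b..c} (speed q2)"
  proof (rule integral_spike[OF neg])
    fix t assume "t \<in> {b..c} - {b}"
    then show "speed q2 t = speed q t" by (intro speed_cong[of "{b<..}"]) (auto simp: q_def)
  qed
  have "integral {a..b} (speed q) + integral {b..c} (speed q) = integral {a..c} (speed q)"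
    using abc
    by (intro Henstock_Kurzweil_Integration.integral_combine
        set_lebesgue_integral_eq_integral(1)[OF piecewise_C1_curve_speed_integral(1)[OF pc]]) auto
  then show "integral {a..c} (speed q) = integral {a..b} (speed q1) + integral {b..c} (speed q2)"
    using s1 s2 by simp
qed

abbreviation len :: "(real \<Rightarrow> 'q) \<Rightarrow> real" where
  "len q \<equiv> integral {0..1} (speed q)"

definition joining_curves :: "'q \<Rightarrow> 'q \<Rightarrow> (real \<Rightarrow> 'q) set" where
  "joining_curves p p' = {q. piecewise_C1_curve A 0 1 q \<and> q 0 = p \<and> q 1 = p'}"

lemma riem_dist_eq: "riem_dist A g p p' = Inf (len ` joining_curves p p')"
proof -
  have "{curve_length A g 0 1 q | q. piecewise_C1_curve A 0 1 q \<and> q 0 = p \<and> q 1 = p'} =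
     len ` joining_curves p p'"
  proof -
    have "{curve_length A g 0 1 q | q. piecewise_C1_curve A 0 1 q \<and> q 0 = p \<and> q 1 = p'} =
       curve_length A g 0 1 ` joining_curves p p'" by (auto simp: joining_curves_def)
    also have "\<dots> = len ` joining_curves p p'"
      by (intro image_cong refl piecewise_C1_curve_speed_integral(3)) (auto simp: joining_curves_def)
    finally show ?thesis .
  qed
  then show ?thesis by (simp add: riem_dist_def)
qed

lemma bdd_below_lengths: "bdd_below (len ` joining_curves p p')"
  using piecewise_C1_curve_speed_integral(2)[of 0 1]
  by (intro bdd_belowI[of _ 0]) (auto simp: joining_curves_def)

lemma riem_dist_le:
  assumes "q \<in> joining_curves p p'"
  shows "riem_dist A g p p' \<le> len q"
  unfolding riem_dist_eq by (intro cInf_lower bdd_below_lengths imageI assms)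

lemma normalize_curve:
  assumes q: "piecewise_C1_curve A a b q" and ab: "a < b"
  obtains q' where "q' \<in> joining_curves (q a) (q b)" "len q' = integral {a..b} (speed q)"
proof -
  have "(\<lambda>u. (b - a) * u + a) ` {0..1} = {a..b}" using ab by (subst image_affinity_atLeastAtMost) auto
  from piecewise_C1_curve_affine[OF q ab _ zero_less_one this] ab
  show thesis by (intro that[of "\<lambda>u. q ((b - a) * u + a)"]) (auto simp: joining_curves_def)
qed

lemma riem_dist_le_length:
  assumes "piecewise_C1_curve A a b q" and "a < b"
  shows "riem_dist A g (q a) (q b) \<le> integral {a..b} (speed q)"
proof -
  obtain q' where "q' \<in> joining_curves (q a) (q b)" "len q' = integral {a..b} (speed q)"
    by (rule normalize_curve[OF assms])
  then show ?thesis using riem_dist_le by force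
qed

lemma reverse_curve:
  assumes "q \<in> joining_curves p p'"
  shows "(\<lambda>u. q (-1 * u + 1)) \<in> joining_curves p' p"
    "len (\<lambda>u. q (-1 * u + 1)) = len q"
proof -
  have im: "(\<lambda>u. - 1 * u + 1) ` {0..1} = {0..1::real}" by (subst image_affinity_atLeastAtMost) auto
  have q: "piecewise_C1_curve A 0 1 q" using assms by (simp add: joining_curves_def)
  have "-1 \<noteq> (0::real)" by simp
  note a = piecewise_C1_curve_affine[OF q zero_less_one this zero_less_one im]
  show "(\<lambda>u. q (-1 * u + 1)) \<in> joining_curves p' p" using a(1) assms by (simp add: joining_curves_def)
  show "len (\<lambda>u. q (-1 * u + 1)) = len q" by (rule a(2))
qed

lemma riem_dist_sym: "riem_dist A g p p' = riem_dist A g p' p"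
proof -
  have "len ` joining_curves p p' \<subseteq> len ` joining_curves p' p" for p p'
  proof (rule image_subsetI)
    fix q assume q: "q \<in> joining_curves p p'"
    show "len q \<in> len ` joining_curves p' p"
      unfolding reverse_curve(2)[OF q, symmetric] by (rule imageI[OF reverse_curve(1)[OF q]])
  qed
  then show ?thesis unfolding riem_dist_eq by (intro arg_cong[where f = Inf] subset_antisym)
qed

lemma concatenate_curves:
  assumes q1: "q1 \<in> joining_curves p p'" and q2: "q2 \<in> joining_curves p' p''"
  obtains q where "q \<in> joining_curves p p''"
    "len q = len q1 + len q2"
proof -
  have im: "(\<lambda>u. 1 * u + (-1)) ` {1..2} = {0..1::real}" by (subst image_affinity_atLeastAtMost) auto
  have pc: "piecewise_C1_curve A 0 1 q1" "piecewise_C1_curve A 0 1 q2" and ends: "q1 1 = q2 0" "q1 0 = p" "q2 1 = p''"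
    using q1 q2 by (auto simp: joining_curves_def)
  have "1 \<noteq> (0::real)" "1 < (2::real)" by auto
  note a = piecewise_C1_curve_affine[OF pc(2) zero_less_one this im]
  define q where "q = (\<lambda>t. if t \<le> 1 then q1 t else q2 (1 * t + (-1)))"
  have eq: "q1 1 = q2 (1 * 1 + (-1))" using ends by simp
  note j = piecewise_C1_curve_join[OF pc(1) a(1) eq zero_less_one \<open>1 < 2\<close>]
  obtain q' where "q' \<in> joining_curves (q 0) (q 2)" "len q' = integral {0..2} (speed q)"
    unfolding q_def by (rule normalize_curve[OF j(1)]) auto
  moreover have "q 0 = p" "q 2 = p''" using ends by (auto simp: q_def)
  moreover have "integral {0..2} (speed q) = len q1 + len q2"
    unfolding a(2)[symmetric] q_def by (rule j(2))
  ultimately show thesis using that by metis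
qed

text \<open>
  The curve is a straight line in the chart.
\<close>

lemma joining_curve_in_chart:
  assumes c: "c \<in> A" and x: "closed_segment x y \<subseteq> snd c ` fst c"
  shows "joining_curves (chart_inv c x) (chart_inv c y) \<noteq> {}"
proof -
  let ?l = "\<lambda>t. x + t *\<^sub>R (y - x)"
  define q where "q t = chart_inv c (?l t)" for t
  have seg: "?l t \<in> closed_segment x y" if "t \<in> {0..1}" for t
    using that by (auto simp: in_segment algebra_simps)
  have line: "(?l has_vector_derivative (y - x)) (at t within I)" for t I
    by (auto intro!: derivative_eq_intros simp: has_vector_derivative_def)
  have lc: "continuous_on I ?l" for I by (intro continuous_intros)
  have "C1_curve A 0 1 q"
    unfolding C1_curve_def
  proof (intro conjI ballI allI impI)
    show "continuous_on {0..1} q" unfolding q_def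
      by (rule continuous_on_compose2[OF continuous_on_chart_inv[OF c] lc]) (use seg x in auto)
    fix d s t assume d: "d \<in> A" and st: "0 \<le> s \<and> s < t \<and> t \<le> 1 \<and> q ` {s..t} \<subseteq> fst d"
    have ov: "?l u \<in> overlap c d" if "u \<in> {s..t}" for u
    proof -
      have "?l u \<in> snd c ` fst c" using seg[of u] x that st by auto
      moreover have "chart_inv c (?l u) \<in> fst d" using st that by (auto simp: q_def)
      ultimately show ?thesis using c chart_inv_in_domain[OF c] chart_chart_inv[OF c] by (metis IntI imageI)
    qed
    show "C1_on s t (snd d \<circ> q)"
      unfolding C1_on_def
    proof (intro exI conjI ballI)
      show "continuous_on {s..t} (\<lambda>u. frechet_derivative (transition c d) (at (?l u)) (y - x))"
        using ov by (intro continuous_on_frechet_derivative_along[OF smooth_transition[OF c d] lc]) auto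
      fix u assume u: "u \<in> {s..t}"
      have "((\<lambda>u. transition c d (?l u)) has_vector_derivative frechet_derivative (transition c d) (at (?l u)) (y - x)) (at u within {s..t})"
        by (rule has_vector_derivative_chain[OF line smooth_on_has_derivative[OF smooth_transition[OF c d] ov[OF u]]])
      then show "(snd d \<circ> q has_vector_derivative frechet_derivative (transition c d) (at (?l u)) (y - x)) (at u within {s..t})"
        by (simp add: o_def q_def)
    qed
  qed
  then have "q \<in> joining_curves (chart_inv c x) (chart_inv c y)"
    using C1_curve_imp_piecewise by (auto simp: joining_curves_def q_def)
  then show ?thesis by blast
qed

lemma chart_ball_nhd:
  assumes c: "c \<in> charts_at A p" and \<rho>: "\<rho> > 0"
  shows "open {p' \<in> fst c. snd c p' \<in> ball (snd c p) \<rho>}" "p \<in> {p' \<in> fst c. snd c p' \<in> ball (snd c p) \<rho>}"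
proof -
  have A: "c \<in> A" "p \<in> fst c" using c by (auto simp: mem_charts_at)
  have "open (fst c \<inter> snd c -` ball (snd c p) \<rho>)"
    using continuous_on_open_vimage[OF open_chart_domain[OF A(1)]] continuous_on_chart[OF A(1)] by (metis open_ball Int_commute)
  moreover have "fst c \<inter> snd c -` ball (snd c p) \<rho> = {p' \<in> fst c. snd c p' \<in> ball (snd c p) \<rho>}" by auto
  ultimately show "open {p' \<in> fst c. snd c p' \<in> ball (snd c p) \<rho>}" by simp
qed (use assms in \<open>auto simp: mem_charts_at\<close>)

text \<open>
  Being joined by a curve is an equivalence relation with open classes, because coordinate balls are
  joined to their centre by straight lines; so there is one class.
\<close>

lemma joining_curves_nonempty:
  assumes conn: "connected (UNIV :: 'q set)"
  shows "joining_curves p p' \<noteq> {}"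
proof (rule connected_equivalence_relation[OF conn, of p p' "\<lambda>p p'. joining_curves p p' \<noteq> {}"])
  show "p \<in> UNIV" "p' \<in> UNIV" by auto
  fix x y assume "joining_curves x y \<noteq> {}"
  then show "joining_curves y x \<noteq> {}" using reverse_curve(1) by blast
next
  fix x y z assume "joining_curves x y \<noteq> {}" "joining_curves y z \<noteq> {}"
  then show "joining_curves x z \<noteq> {}" using concatenate_curves by (metis ex_in_conv)
next
  fix x :: 'q assume "x \<in> UNIV"
  obtain c where c: "c \<in> charts_at A x" using ex_chart by blast
  then have A: "c \<in> A" "x \<in> fst c" by (auto simp: mem_charts_at)
  obtain \<rho> where \<rho>: "\<rho> > 0" "ball (snd c x) \<rho> \<subseteq> snd c ` fst c"
    using open_chart_image[OF A(1)] A(2) openE by blast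
  let ?N = "{p' \<in> fst c. snd c p' \<in> ball (snd c x) \<rho>}"
  have "joining_curves x y \<noteq> {}" if y: "y \<in> ?N" for y
  proof -
    have "closed_segment (snd c x) (snd c y) \<subseteq> ball (snd c x) \<rho>"
      using y \<rho> by (intro closed_segment_subset convex_ball) auto
    then have "joining_curves (chart_inv c (snd c x)) (chart_inv c (snd c y)) \<noteq> {}"
      using \<rho> by (intro joining_curve_in_chart[OF A(1)]) auto
    then show ?thesis using A y by simp
  qed
  then show "\<exists>T. openin (top_of_set UNIV) T \<and> x \<in> T \<and> (\<forall>y\<in>T. joining_curves x y \<noteq> {})"
    using chart_ball_nhd[OF c \<rho>(1)] by (intro exI[of _ ?N]) auto
qed

text \<open>
  Where the metric dominates \<open>l\<close> times the Euclidean one, speed is at least \<open>sqrt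
  l\<close> times the coordinate speed.
\<close>

lemma coordinate_distance_le_length:
  assumes q: "piecewise_C1_curve A a b q" and ab: "a < b" and c: "c \<in> A"
    and l: "l > 0" and S: "\<And>x w. x \<in> S \<Longrightarrow> l * (norm w)\<^sup>2 \<le> metric_form c x w w"
    and qS: "\<And>t. t \<in> {a..b} \<Longrightarrow> q t \<in> fst c \<and> snd c (q t) \<in> S"
  shows "sqrt l * norm (snd c (q b) - snd c (q a)) \<le> integral {a..b} (speed q)"
proof (rule piecewise_C1_curve_induct[OF q ab, where P = "\<lambda>a b. sqrt l * norm (snd c (q b) - snd c (q a)) \<le> integral {a..b} (speed q)"])
  fix s t assume st: "a \<le> s" "s < t" "t \<le> b" and C: "C1_curve A s t q"
  let ?v = "\<lambda>u. velocity A {s..t} q u c" and ?W = "speed_within {s..t} q"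
  have ch: "c \<in> charts_at A (q u)" "snd c (q u) \<in> S" if "u \<in> {s..t}" for u
    using qS[of u] that st c by (auto simp: mem_charts_at)
  have I: "(?v has_integral (snd c \<circ> q) t - (snd c \<circ> q) s) {s..t}"
    by (rule fundamental_theorem_of_calculus[OF less_imp_le[OF st(2)]])
       (rule C1_curve_local(1)[OF C st(2) _ ch(1)])
  have W: "?W integrable_on {s..t}"
    by (rule integrable_continuous_real[OF C1_curve_continuous_speed[OF C st(2)]])
  have le: "norm (?v u) \<le> (1 / sqrt l) * ?W u" if u: "u \<in> {s..t}" for u
  proof -
    have "l * (norm (?v u))\<^sup>2 \<le> (?W u)\<^sup>2"
      using S[OF ch(2)[OF u], of "?v u"] C1_curve_speed_power2[OF C st(2) u ch(1)[OF u]] by simp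
    then have "sqrt (l * (norm (?v u))\<^sup>2) \<le> sqrt ((?W u)\<^sup>2)" by (rule real_sqrt_le_mono)
    then have "sqrt l * norm (?v u) \<le> ?W u"
      using C1_curve_speed_nonneg[OF C st(2) u] by (simp add: real_sqrt_mult)
    then show ?thesis using l by (simp add: field_simps)
  qed
  have "norm (integral {s..t} ?v) \<le> integral {s..t} (\<lambda>u. (1 / sqrt l) * ?W u)"
    by (rule integral_norm_bound_integral[OF has_integral_integrable[OF I] integrable_on_mult_right[OF W] le])
  then have "norm (snd c (q t) - snd c (q s)) \<le> (1 / sqrt l) * integral {s..t} ?W"
    using integral_unique[OF I] by simp
  then show "sqrt l * norm (snd c (q t) - snd c (q s)) \<le> integral {s..t} (speed q)"
    using l C1_curve_speed_integral(3)[OF C st(2)] by (simp add: field_simps)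
next
  fix s t u assume b: "a \<le> s" "s < t" "t < u" "u \<le> b"
    and *: "sqrt l * norm (snd c (q t) - snd c (q s)) \<le> integral {s..t} (speed q)"
      "sqrt l * norm (snd c (q u) - snd c (q t)) \<le> integral {t..u} (speed q)"
  have "speed q integrable_on {s..u}"
    using b
    by (intro integrable_subinterval_real[OF
        set_lebesgue_integral_eq_integral(1)[OF piecewise_C1_curve_speed_integral(1)[OF q ab]]]) auto
  then have "integral {s..t} (speed q) + integral {t..u} (speed q) = integral {s..u} (speed q)"
    using b by (intro Henstock_Kurzweil_Integration.integral_combine) auto
  moreover have "sqrt l * norm (snd c (q u) - snd c (q s)) \<le> sqrt l * (norm (snd c (q t) - snd c (q s)) + norm (snd c (q u) - snd c (q t)))"
    using l norm_triangle_ineq[of "snd c (q t) - snd c (q s)" "snd c (q u) - snd c (q t)"] by (intro mult_left_mono) auto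
  ultimately show "sqrt l * norm (snd c (q u) - snd c (q s)) \<le> integral {s..u} (speed q)"
    using * by (simp add: distrib_left)
qed

text \<open>
  A curve from \<open>p\<close> to another point leaves a small coordinate ball around
  \<open>p\<close>. Up to the first exit it stays in the closed ball, which lies in the chart, so
  its length is at least a fixed multiple of the radius. The closed coordinate ball is compact,
  hence closed in the manifold, so the curve cannot escape through the boundary of the chart domain.
\<close>

lemma length_bounded_below:
  assumes "p \<noteq> p'"
  obtains e where "e > 0" "\<forall>q\<in>joining_curves p p'. e \<le> len q"
proof -
  obtain c where c: "c \<in> charts_at A p" using ex_chart by blast
  then have A: "c \<in> A" "p \<in> fst c" by (auto simp: mem_charts_at)
  let ?x = "snd c p"
  obtain \<rho>0 l where \<rho>0: "\<rho>0 > 0" "l > 0" "cball ?x \<rho>0 \<subseteq> snd c ` fst c"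
    and l: "\<And>x w. x \<in> cball ?x \<rho>0 \<Longrightarrow> l * (norm w)\<^sup>2 \<le> metric_form c x w w"
    using smooth_form_locally_coercive[OF smooth_metric_form[OF A(1)] metric_form_pos_def[OF A(1)], of ?x] A by blast
  obtain \<rho> where \<rho>: "\<rho> > 0" "\<rho> \<le> \<rho>0" "\<not> (p' \<in> fst c \<and> snd c p' \<in> ball ?x \<rho>)"
  proof (cases "p' \<in> fst c")
    case True
    have "snd c p' \<noteq> ?x" using assms True A chart_inv_chart by metis
    then show thesis using \<rho>0 by (intro that[of "min \<rho>0 (dist ?x (snd c p'))"]) auto
  next
    case False
    then show thesis using \<rho>0 that by blast
  qed
  let ?N = "{y \<in> fst c. snd c y \<in> ball ?x \<rho>}" and ?K = "chart_inv c ` cball ?x \<rho>"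
  have cb: "cball ?x \<rho> \<subseteq> snd c ` fst c" using \<rho> \<rho>0 by auto
  have "compact ?K"
    by (rule compact_continuous_image[OF continuous_on_subset[OF continuous_on_chart_inv[OF A(1)] cb] compact_cball])
  then have K: "closed ?K" by (rule compact_imp_closed)
  have KD: "y \<in> fst c \<and> snd c y \<in> cball ?x \<rho>" if y: "y \<in> ?K" for y
  proof -
    obtain x where x: "x \<in> cball ?x \<rho>" "y = chart_inv c x" using y by blast
    then have "x \<in> snd c ` fst c" using cb by blast
    then show ?thesis using x chart_inv_in_domain[OF A(1)] chart_chart_inv[OF A(1)] by simp
  qed
  have N: "open ?N" "p \<in> ?N" by (rule chart_ball_nhd[OF c \<rho>(1)])+
  have "sqrt l * \<rho> \<le> len q" if q: "q \<in> joining_curves p p'" for q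
  proof -
    have pc: "piecewise_C1_curve A 0 1 q" and ends: "q 0 = p" "q 1 = p'" using q by (auto simp: joining_curves_def)
    have qc: "continuous_on {0..1} q" using pc by (simp add: piecewise_C1_curve_def)
    \<comment> \<open>the first time at which the curve leaves the coordinate ball\<close>
    let ?E = "{0..1} \<inter> q -` (- ?N)"
    have Ec: "closed ?E" using N(1) by (intro continuous_closed_preimage qc closed_atLeastAtMost) (simp add: closed_Compl)
    have "1 \<in> ?E" using \<rho>(3) ends by auto
    have bd: "bdd_below ?E" by (rule bdd_belowI[of _ 0]) auto
    define t where "t = Inf ?E"
    have tE: "t \<in> ?E" unfolding t_def by (rule closed_contains_Inf[OF _ bd Ec]) (use \<open>1 \<in> ?E\<close> in blast)
    have before: "q u \<in> ?N" if "0 \<le> u" "u < t" for u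
    proof (rule ccontr)
      assume "q u \<notin> ?N"
      then have "u \<in> ?E" using that tE by auto
      then show False using cInf_lower[OF _ bd, of u] that by (simp add: t_def)
    qed
    have t0: "0 < t" using tE N(2) ends by (cases "t = 0") auto
    have t1: "t \<le> 1" using tE by auto
    have NK: "?N \<subseteq> ?K"
    proof
      fix y assume y: "y \<in> ?N"
      then have "y = chart_inv c (snd c y)" "snd c y \<in> cball ?x \<rho>" using A(1) by auto
      then show "y \<in> ?K" by (rule image_eqI)
    qed
    have "q t \<in> ?K"
    proof -
      have "closed ({0..t} \<inter> q -` ?K)"
        using t1 by (intro continuous_closed_preimage continuous_on_subset[OF qc] closed_atLeastAtMost K) auto
      moreover have "{0..<t} \<subseteq> {0..t} \<inter> q -` ?K"
      proof
        fix u assume "u \<in> {0..<t}"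
        then have "q u \<in> ?K" "u \<in> {0..t}" using subsetD[OF NK before[of u]] by simp_all
        then show "u \<in> {0..t} \<inter> q -` ?K" by simp
      qed
      ultimately have "closure {0..<t} \<subseteq> {0..t} \<inter> q -` ?K" by (rule closure_minimal[rotated])
      moreover have "t \<in> closure {0..<t}" using t0 by simp
      ultimately show ?thesis by blast
    qed
    then have "q t \<in> fst c" "snd c (q t) \<in> cball ?x \<rho>" using KD by auto
    then have far: "norm (snd c (q t) - ?x) = \<rho>" using tE by (auto simp: dist_norm norm_minus_commute)
    have in_ball: "q u \<in> fst c \<and> snd c (q u) \<in> cball ?x \<rho>0" if "u \<in> {0..t}" for u
      using before[of u] KD[OF \<open>q t \<in> ?K\<close>] that \<rho>(2) by (cases "u = t") auto
    have pct: "piecewise_C1_curve A 0 t q" using t1 by (intro piecewise_C1_curve_subinterval[OF pc]) auto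
    have "sqrt l * norm (snd c (q t) - snd c (q 0)) \<le> integral {0..t} (speed q)"
      by (rule coordinate_distance_le_length[OF pct t0 A(1) \<rho>0(2) l in_ball])
    also have "integral {0..t} (speed q) \<le> len q"
    proof -
      have i: "speed q integrable_on {0..1}"
        by (rule set_lebesgue_integral_eq_integral(1)[OF piecewise_C1_curve_speed_integral(1)[OF pc zero_less_one]])
      show ?thesis
      proof (cases "t = 1")
        case False
        then have lt: "t < 1" using t1 by simp
        have "piecewise_C1_curve A t 1 q"
          using t0 by (intro piecewise_C1_curve_subinterval[OF pc]) auto
        then have "0 \<le> integral {t..1} (speed q)" using lt by (rule piecewise_C1_curve_speed_integral(2))
        moreover have "integral {0..t} (speed q) + integral {t..1} (speed q) = len q"
          using t0 t1 i by (intro Henstock_Kurzweil_Integration.integral_combine) auto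
        ultimately show ?thesis by simp
      qed simp
    qed
    finally show ?thesis using far ends by simp
  qed
  moreover have "sqrt l * \<rho> > 0" using \<rho>0 \<rho> by simp
  ultimately show thesis using that by blast
qed

lemma riem_dist_self: "riem_dist A g p p = 0"
proof -
  have C: "C1_curve A 0 1 (\<lambda>_. p)"
    unfolding C1_curve_def C1_on_def by (auto intro!: exI[of _ "\<lambda>_. 0"] has_vector_derivative_const simp: o_def)
  then have pc: "piecewise_C1_curve A 0 1 (\<lambda>_. p)" by (rule C1_curve_imp_piecewise)
  obtain c where c: "c \<in> charts_at A p" using ex_chart by blast
  have "velocity A UNIV (\<lambda>_. p) t = tvec_of A c p 0" for t
    using c velocity_eq_tvec_of[of t UNIV "\<lambda>_. p" c 0] by (simp add: o_def)
  then have "speed (\<lambda>_. p) t = 0" for t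
    using metric_comp_pos_def[OF c] by (simp add: tnorm_tvec_of pos_def_form_def bilinear_lzero)
  then have "riem_dist A g p p \<le> 0" using riem_dist_le_length[OF pc zero_less_one] by simp
  moreover have "0 \<le> riem_dist A g p p"
    unfolding riem_dist_eq using pc piecewise_C1_curve_speed_integral(2)[of 0 1]
    by (intro cInf_greatest) (auto simp: joining_curves_def)
  ultimately show ?thesis by simp
qed

lemma Metric_space_riem_dist:
  assumes conn: "connected (UNIV :: 'q set)"
  shows "Metric_space UNIV (riem_dist A g)"
proof
  note ne = joining_curves_nonempty[OF conn]
  show "0 \<le> riem_dist A g p p'" for p p'
    unfolding riem_dist_eq using ne piecewise_C1_curve_speed_integral(2)[of 0 1]
    by (intro cInf_greatest) (auto simp: joining_curves_def)
  show "riem_dist A g p p' = riem_dist A g p' p" for p p' by (rule riem_dist_sym)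
  show "(riem_dist A g p p' = 0) = (p = p')" for p p'
  proof (cases "p = p'")
    case False
    obtain e where e: "e > 0" "\<forall>q\<in>joining_curves p p'. e \<le> len q"
      by (rule length_bounded_below[OF False])
    have "e \<le> riem_dist A g p p'" unfolding riem_dist_eq using ne e by (intro cInf_greatest) auto
    then show ?thesis using False e by simp
  qed (simp add: riem_dist_self)
  show "riem_dist A g p p'' \<le> riem_dist A g p p' + riem_dist A g p' p''" for p p' p''
  proof (rule field_le_epsilon)
    fix e :: real assume "e > 0"
    have approx: "\<exists>q\<in>joining_curves x y. len q < riem_dist A g x y + e / 2" for x y
      using cInf_lessD[of "len ` joining_curves x y" "riem_dist A g x y + e / 2"]
        ne[of x y] \<open>e > 0\<close> unfolding riem_dist_eq by auto
    obtain q1 q2 where q: "q1 \<in> joining_curves p p'" "q2 \<in> joining_curves p' p''"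
      and "len q1 < riem_dist A g p p' + e / 2" "len q2 < riem_dist A g p' p'' + e / 2"
      using approx by blast
    moreover obtain q where "q \<in> joining_curves p p''"
      "len q = len q1 + len q2"
      by (rule concatenate_curves[OF q])
    then have "riem_dist A g p p'' \<le> len q1 + len q2"
      using riem_dist_le by force
    ultimately show "riem_dist A g p p'' \<le> riem_dist A g p p' + riem_dist A g p' p'' + e" by linarith
  qed
qed

lemma C1_curve_lipschitz:
  assumes q: "C1_curve A a b q" and M: "\<And>t. t \<in> {a..b} \<Longrightarrow> speed_within {a..b} q t \<le> M"
    and st: "s \<in> {a..b}" "t \<in> {a..b}"
  shows "riem_dist A g (q s) (q t) \<le> M * \<bar>t - s\<bar>"
proof -
  have le: "riem_dist A g (q s) (q t) \<le> M * (t - s)" if st: "a \<le> s" "s < t" "t \<le> b" for s t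
  proof -
    have C: "C1_curve A s t q" using st by (intro C1_curve_subinterval[OF q]) auto
    have neg: "negligible {s, t}" by simp
    have i: "speed q integrable_on {s..t}"
      by (rule set_lebesgue_integral_eq_integral(1)[OF C1_curve_speed_integral(1)[OF C st(2)]])
    have "riem_dist A g (q s) (q t) \<le> integral {s..t} (speed q)"
      by (rule riem_dist_le_length[OF C1_curve_imp_piecewise[OF C] st(2)])
    also have "\<dots> = integral {s..t} (\<lambda>u. if u \<in> {s, t} then M else speed q u)"
      by (rule integral_spike[OF neg]) auto
    also have "\<dots> \<le> integral {s..t} (\<lambda>u. M)"
    proof (rule integral_le)
      show "(\<lambda>u. if u \<in> {s, t} then M else speed q u) integrable_on {s..t}"
        by (rule integrable_spike[OF i neg]) auto
      fix u assume u: "u \<in> {s..t}"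
      then have "speed_within {a..b} q u \<le> M" using st by (intro M) auto
      moreover have "speed_within {a..b} q u = speed q u" if "u \<notin> {s, t}"
        using that u st by (intro speed_within_interior) auto
      ultimately show "(if u \<in> {s, t} then M else speed q u) \<le> M" by auto
    qed auto
    also have "\<dots> = M * (t - s)" using st by simp
    finally show ?thesis .
  qed
  consider "s < t" | "t < s" | "s = t" by linarith
  then show ?thesis
  proof cases
    case 1 then show ?thesis using le[of s t] st by simp
  next
    case 2 then show ?thesis using le[of t s] st riem_dist_sym[of "q s" "q t"] by simp
  next
    case 3 then show ?thesis by (simp add: riem_dist_self)
  qed
qed

end


section \<open>Avoiding the obstacle\<close>

text \<open>
  The bump potential with \<open>k = 1\<close> as a function of the distance \<open>d\<close> to its
  centre.
\<close>

definition bump_profile :: "real \<Rightarrow> real \<Rightarrow> real \<Rightarrow> real" where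
  "bump_profile R \<tau> d = (if d < R then exp 1 * \<tau> * exp (- (1 / (1 - (d / R)\<^sup>2))) else 0)"

lemma bump_potential_eq_profile: "bump_potential A g R \<tau> 1 p x = bump_profile R \<tau> (riem_dist A g p x)"
  by (simp add: bump_potential_def bump_profile_def)

lemma bump_profile_nonneg: "\<tau> \<ge> 0 \<Longrightarrow> 0 \<le> bump_profile R \<tau> d"
  by (simp add: bump_profile_def)

lemma bump_profile_bounded:
  assumes "\<tau> \<ge> 0" "d \<ge> 0"
  shows "bump_profile R \<tau> d \<le> exp 1 * \<tau>"
proof (cases "d < R")
  case True
  then have "(d / R)\<^sup>2 \<le> 1" using assms by (simp add: power_le_one)
  then have "exp (- (1 / (1 - (d / R)\<^sup>2))) \<le> 1" by simp
  then have "exp 1 * \<tau> * exp (- (1 / (1 - (d / R)\<^sup>2))) \<le> exp 1 * \<tau> * 1"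
    using assms by (intro mult_left_mono) auto
  then show ?thesis using True by (simp add: bump_profile_def)
qed (use assms in \<open>simp add: bump_profile_def\<close>)

lemma bump_profile_lower:
  assumes "\<tau> \<ge> 0" "0 \<le> d" "d \<le> s * R" "R > 0" "s < 1"
  shows "exp 1 * \<tau> * exp (- (1 / (1 - s\<^sup>2))) \<le> bump_profile R \<tau> d"
proof -
  have "d / R \<le> s" using assms by (simp add: divide_le_eq)
  moreover have "0 \<le> d / R" using assms by simp
  ultimately have ds: "(d / R)\<^sup>2 \<le> s\<^sup>2" and s0: "0 \<le> s" by (auto intro: power_mono)
  have s1: "s\<^sup>2 < 1" using s0 assms(5) by (simp add: power_less_one_iff)
  have "1 / (1 - (d / R)\<^sup>2) \<le> 1 / (1 - s\<^sup>2)" using ds s1 by (intro divide_left_mono) auto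
  then have "exp (- (1 / (1 - s\<^sup>2))) \<le> exp (- (1 / (1 - (d / R)\<^sup>2)))" by simp
  then have "exp 1 * \<tau> * exp (- (1 / (1 - s\<^sup>2))) \<le> exp 1 * \<tau> * exp (- (1 / (1 - (d / R)\<^sup>2)))"
    using assms by (intro mult_left_mono) auto
  moreover have "d < R" using \<open>d / R \<le> s\<close> assms by (simp add: divide_le_eq) (metis less_le_trans mult_less_cancel_right2 not_le order_trans)
  ultimately show ?thesis by (simp add: bump_profile_def)
qed

lemma bump_profile_measurable: "bump_profile R \<tau> \<in> borel_measurable borel"
  unfolding bump_profile_def by measurable

lemma bump_profile_absolutely_integrable:
  assumes f: "continuous_on {a..b} f" "\<And>t. t \<in> {a..b} \<Longrightarrow> f t \<ge> 0" and \<tau>: "\<tau> \<ge> 0"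
  shows "(\<lambda>t. bump_profile R \<tau> (f t)) absolutely_integrable_on {a..b::real}"
proof (rule measurable_bounded_by_integrable_imp_absolutely_integrable)
  show "(\<lambda>t. bump_profile R \<tau> (f t)) \<in> borel_measurable (lebesgue_on {a..b})"
    by (rule measurable_compose[OF continuous_imp_measurable_on_sets_lebesgue[OF f(1)] bump_profile_measurable]) simp
  show "{a..b} \<in> sets lebesgue" by simp
  show "(\<lambda>t. exp 1 * \<tau>) integrable_on {a..b}" by (rule integrable_const_ivl)
  show "norm (bump_profile R \<tau> (f t)) \<le> exp 1 * \<tau>" if "t \<in> {a..b}" for t
    using bump_profile_bounded[OF \<tau> f(2)[OF that]] bump_profile_nonneg[OF \<tau>] by simp
qed

lemma integral_ge_on_subinterval:
  fixes f :: "real \<Rightarrow> real"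
  assumes f: "f integrable_on {a..b}" "\<And>t. t \<in> {a..b} \<Longrightarrow> 0 \<le> f t"
    and sub: "a \<le> s" "s \<le> t" "t \<le> b" and ge: "\<And>u. u \<in> {s..t} \<Longrightarrow> m \<le> f u"
  shows "m * (t - s) \<le> integral {a..b} f"
proof -
  have i: "f integrable_on {s..t}" using f(1) by (rule integrable_subinterval_real) (use sub in auto)
  have "m * (t - s) = integral {s..t} (\<lambda>_. m)" using sub by simp
  also have "\<dots> \<le> integral {s..t} f" using i ge by (intro integral_le) auto
  also have "\<dots> \<le> integral {a..b} f" using sub f i by (intro integral_subset_le) auto
  finally show ?thesis .
qed

context riemannian
begin

text \<open>
  Integrability matters here: the action of a curve with a non-integrable density would be 0 by the
  convention for the integral, and could not be compared with other curves.
\<close>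

lemma action_H2_curve:
  assumes q: "H2_curve A 0 T q" and T: "T > 0"
    and V: "(\<lambda>t. V (q t)) absolutely_integrable_on {0..T}"
  shows "action A g T V q = (integral {0..T} (\<lambda>t. (accel {0..T} q t)\<^sup>2) + integral {0..T} (\<lambda>t. V (q t))) / 2"
proof -
  have TT: "T \<in> {0..T}" using T by simp
  have a: "(\<lambda>t. (accel {0..T} q t)\<^sup>2) absolutely_integrable_on {0..T}" by (rule H2_curve_energy(1)[OF q T TT])
  have "(\<lambda>t. (accel {0..T} q t)\<^sup>2 + V (q t)) absolutely_integrable_on {0..T}"
    by (rule set_integral_add(1)[OF a V])
  then have "action A g T V q = 1 / 2 * integral {0..T} (\<lambda>t. (accel {0..T} q t)\<^sup>2 + V (q t))"
    unfolding action_def by (simp only: set_lebesgue_integral_eq_integral(2))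
  also have "integral {0..T} (\<lambda>t. (accel {0..T} q t)\<^sup>2 + V (q t)) =
      integral {0..T} (\<lambda>t. (accel {0..T} q t)\<^sup>2) + integral {0..T} (\<lambda>t. V (q t))"
    by (intro integral_add set_lebesgue_integral_eq_integral(1) a V)
  finally show ?thesis by simp
qed

text \<open>
  Along a curve of bounded speed the distances to the centres are Lipschitz functions of time, and
  the potential is a bounded Borel function of them; this makes it integrable along the curve.
\<close>

lemma bump_sum_bounds_along_curve:
  assumes conn: "connected (UNIV :: 'q set)"
    and q: "C1_curve A 0 T q" and M: "\<And>t. t \<in> {0..T} \<Longrightarrow> speed_within {0..T} q t \<le> M"
    and F: "finite F" and \<tau>: "\<tau> \<ge> 0"
    and V_def: "V = (\<lambda>x. \<Sum>p\<in>F. bump_potential A g R \<tau> 1 p x)"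
  shows "(\<lambda>t. V (q t)) absolutely_integrable_on {0..T}" "V (q t) \<ge> 0"
    "p \<in> F \<Longrightarrow> bump_profile R \<tau> (riem_dist A g p (q t)) \<le> V (q t)"
proof -
  interpret Metric_space UNIV "riem_dist A g" by (rule Metric_space_riem_dist[OF conn])
  have "continuous_on {0..T} (\<lambda>t. riem_dist A g p (q t))" for p
  proof (rule continuous_onI)
    fix s e :: real assume s: "s \<in> {0..T}" and e: "e > 0"
    show "\<exists>d>0. \<forall>t\<in>{0..T}. dist t s < d \<longrightarrow> dist (riem_dist A g p (q t)) (riem_dist A g p (q s)) \<le> e"
    proof (intro exI conjI ballI impI)
      show "0 < e / (\<bar>M\<bar> + 1)" using e by simp
      fix t assume t: "t \<in> {0..T}" "dist t s < e / (\<bar>M\<bar> + 1)"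
      have "riem_dist A g p (q t) \<le> riem_dist A g p (q s) + riem_dist A g (q s) (q t)"
        "riem_dist A g p (q s) \<le> riem_dist A g p (q t) + riem_dist A g (q s) (q t)"
        using triangle[of p "q s" "q t"] triangle[of p "q t" "q s"] commute[of "q t" "q s"] by auto
      then have "dist (riem_dist A g p (q t)) (riem_dist A g p (q s)) \<le> riem_dist A g (q s) (q t)"
        unfolding dist_real_def by linarith
      also have "\<dots> \<le> M * \<bar>t - s\<bar>" by (rule C1_curve_lipschitz[OF q M s t(1)])
      also have "\<dots> \<le> (\<bar>M\<bar> + 1) * \<bar>t - s\<bar>" by (intro mult_right_mono) auto
      also have "\<dots> \<le> e" using t(2) by (simp add: dist_real_def field_simps)
      finally show "dist (riem_dist A g p (q t)) (riem_dist A g p (q s)) \<le> e" .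
    qed
  qed
  then show "(\<lambda>t. V (q t)) absolutely_integrable_on {0..T}"
    unfolding V_def bump_potential_eq_profile using F \<tau> nonneg
    by (intro absolutely_integrable_sum bump_profile_absolutely_integrable) auto
  show "V (q t) \<ge> 0"
    unfolding V_def bump_potential_eq_profile by (intro sum_nonneg bump_profile_nonneg \<tau>)
  show "bump_profile R \<tau> (riem_dist A g p (q t)) \<le> V (q t)" if "p \<in> F"
    unfolding V_def bump_potential_eq_profile
    using F that bump_profile_nonneg[OF \<tau>] by (intro member_le_sum) auto
qed

end

theorem proposition3:
  fixes A :: "('q::{t2_space,second_countable_topology}, 'e::euclidean_space) chart set"
    and g :: "('q, 'e) metric_tensor"
    and T h R r :: real
    and q0 qT :: 'q and v0 vT :: "('q, 'e) tvec"
    and P :: "'q set"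
  assumes "riemannian_manifold A g"
    and "connected (UNIV :: 'q set)"
    and "Metric_space.mcomplete UNIV (riem_dist A g)"
    and "T > 0"
    and "v0 \<in> tangent_space A q0" and "vT \<in> tangent_space A qT"
    and "Metric_space.mtotally_bounded UNIV (riem_dist A g) P"
    and "h > 0" and "0 < R" and "R \<le> h"
    and "\<exists>q \<in> admissible_curves A T q0 v0 qT vT. avoids A g T P R q"
    and "0 < r" and "r < R / 2"
  shows "\<exists>rstar \<tau> :: real. \<exists>k :: nat. \<exists>F :: 'q set.
           rstar < R \<and> \<tau> > 0 \<and> k \<ge> 1 \<and> finite F \<and> F \<subseteq> P \<and>
           (\<forall>q. is_minimizer_on
                  (action A g T (\<lambda>x. \<Sum>p\<in>F. bump_potential A g R \<tau> k p x))
                  (admissible_curves A T q0 v0 qT vT) q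
                \<longrightarrow> avoids A g T P r q)"
proof -
  note conn = assms(2) and T = assms(4) and R = assms(9)
  interpret riemannian A g by (rule riemannian.intro) (rule assms(1))
  interpret M: Metric_space UNIV "riem_dist A g" by (rule Metric_space_riem_dist[OF conn])
  let ?adm = "admissible_curves A T q0 v0 qT vT"
  obtain qf where qf: "qf \<in> ?adm" "avoids A g T P R qf" using assms(11) by blast
  have TT: "T \<in> {0..T}" and T0: "0 \<in> {0..T}" using T by auto
  have H2f: "H2_curve A 0 T qf" using qf(1) by (simp add: admissible_curves_def)
  define E where "E = integral {0..T} (\<lambda>t. (accel {0..T} qf t)\<^sup>2)"
  have E0: "E \<ge> 0"
    unfolding E_def
    by (intro Henstock_Kurzweil_Integration.integral_nonneg
        set_lebesgue_integral_eq_integral(1)[OF H2_curve_energy(1)[OF H2f T TT]]) simp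
  have v00: "0 \<le> tnorm g q0 v0"
    using C1_curve_speed_nonneg[OF H2_curve_imp_C1_curve[OF H2f] T T0] qf(1) by (simp add: admissible_curves_def)
  \<comment> \<open>the speed of every minimizer is at most \<open>M\<close>, whatever \<open>\<tau>\<close> and the centres will be\<close>
  define M where "M = tnorm g q0 v0 + T + E"
  have M0: "M > 0" using v00 E0 T by (simp add: M_def)
  have "R / 8 > 0" using R by simp
  from assms(7)[unfolded M.mtotally_bounded_def, rule_format, OF this] obtain F where F: "finite F" "F \<subseteq> P" "P \<subseteq> (\<Union>p\<in>F. M.mball p (R / 8))"
    by (elim exE conjE)
  \<comment> \<open>in time \<open>\<delta>\<close> a curve of speed at most \<open>M\<close> moves by at most \<open>R/8\<close>; moreover \<open>[0,T]\<close> contains an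
    interval of length \<open>\<delta>\<close> that begins or ends at any given time\<close>
  define \<delta> where "\<delta> = min (T / 2) (R / (8 * M))"
  have \<delta>: "\<delta> > 0" "\<delta> \<le> T / 2" "M * \<delta> \<le> R / 8"
  proof -
    show "\<delta> > 0" "\<delta> \<le> T / 2" using T R M0 by (auto simp: \<delta>_def)
    have "M * \<delta> \<le> M * (R / (8 * M))" using M0 by (intro mult_left_mono) (auto simp: \<delta>_def)
    then show "M * \<delta> \<le> R / 8" using M0 by simp
  qed
  define c where "c = exp 1 * exp (- (1 / (1 - (3 / 4)\<^sup>2))) * \<delta>"
  have c: "c > 0" using \<delta> by (simp add: c_def)
  \<comment> \<open>\<open>\<tau> * c\<close> will be a lower bound for the integral of the potential along a curve that comes too close to \<open>P\<close>\<close>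
  define \<tau> where "\<tau> = (E + 1) / c"
  have \<tau>: "\<tau> > 0" using c E0 by (simp add: \<tau>_def)
  define V where "V = (\<lambda>x. \<Sum>p\<in>F. bump_potential A g R \<tau> 1 p x)"
  have Vf: "V (qf t) = 0" if "t \<in> {0..T}" for t
    unfolding V_def
  proof (intro sum.neutral ballI)
    fix p assume "p \<in> F"
    then have "riem_setdist A g (qf t) P \<le> ereal (riem_dist A g (qf t) p)"
      using F unfolding riem_setdist_def by (intro INF_lower) auto
    moreover have "ereal R < riem_setdist A g (qf t) P" using qf(2) that by (simp add: avoids_def)
    ultimately have "R < riem_dist A g (qf t) p" using less_le_trans ereal_less(1) by fastforce
    then show "bump_potential A g R \<tau> 1 p (qf t) = 0"
      using M.commute[of p "qf t"] by (simp add: bump_potential_def)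
  qed
  have "(\<lambda>t. V (qf t)) absolutely_integrable_on {0..T}"
    by (rule absolutely_integrable_spike[where f = "\<lambda>_. 0" and N = "{}"]) (auto simp: Vf)
  moreover have "integral {0..T} (\<lambda>t. V (qf t)) = integral {0..T} (\<lambda>_. 0)"
    by (rule integral_cong) (simp add: Vf)
  ultimately have Jf: "action A g T V qf = E / 2"
    using action_H2_curve[OF H2f T, of V] by (simp add: E_def)
  have "avoids A g T P r q" if "is_minimizer_on (action A g T V) ?adm q" for q
  proof (rule ccontr)
    assume na: "\<not> avoids A g T P r q"
    have q: "q \<in> ?adm" and Jq: "action A g T V q \<le> E / 2"
      using that qf(1) Jf by (auto simp: is_minimizer_on_def)
    have H2: "H2_curve A 0 T q" and q0: "q 0 = q0" "velocity A {0..T} q 0 = v0"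
      using q by (auto simp: admissible_curves_def)
    have C1: "C1_curve A 0 T q" by (rule H2_curve_imp_C1_curve[OF H2])
    let ?K = "integral {0..T} (\<lambda>t. (accel {0..T} q t)\<^sup>2)" and ?W = "integral {0..T} (\<lambda>t. V (q t))"
    have sp: "speed_within {0..T} q t \<le> tnorm g q0 v0 + T + ?K" if "t \<in> {0..T}" for t
      using H2_curve_speed_bound[OF H2 T that] q0 by simp
    note V = bump_sum_bounds_along_curve[OF conn C1 sp F(1) less_imp_le[OF \<tau>] V_def]
    have Vi: "(\<lambda>t. V (q t)) integrable_on {0..T}" by (rule set_lebesgue_integral_eq_integral(1)[OF V(1)])
    have W0: "?W \<ge> 0" using Vi V(2) by (intro Henstock_Kurzweil_Integration.integral_nonneg) auto
    have K0: "?K \<ge> 0"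
      by (intro Henstock_Kurzweil_Integration.integral_nonneg
          set_lebesgue_integral_eq_integral(1)[OF H2_curve_energy(1)[OF H2 T TT]]) simp
    have "?K + ?W \<le> E" using Jq action_H2_curve[OF H2 T V(1)] by simp
    then have KE: "?K \<le> E" and WE: "?W \<le> E" using W0 K0 by auto
    have spM: "speed_within {0..T} q t \<le> M" if "t \<in> {0..T}" for t
      using sp[OF that] KE by (simp add: M_def)
    obtain t0 where t0: "t0 \<in> {0..T}" "riem_setdist A g (q t0) P \<le> ereal r"
      using na by (auto simp: avoids_def not_less)
    then have "riem_setdist A g (q t0) P < ereal (R / 2)"
      using assms(13) by (metis ereal_less(2) le_less_trans less_ereal.simps(1))
    then obtain p where p: "p \<in> P" "riem_dist A g (q t0) p < R / 2"
      unfolding riem_setdist_def INF_less_iff by auto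
    then obtain x where x: "x \<in> F" "riem_dist A g x p < R / 8" using F(3) by (auto simp: M.in_mball)
    \<comment> \<open>\<open>R/8 + R/2 + R/8 = 3R/4\<close>\<close>
    have near: "riem_dist A g x (q t) \<le> 3 / 4 * R" if t: "t \<in> {0..T}" "\<bar>t - t0\<bar> \<le> \<delta>" for t
    proof -
      have "riem_dist A g (q t0) (q t) \<le> M * \<bar>t - t0\<bar>" by (rule C1_curve_lipschitz[OF C1 spM t0(1) t(1)])
      also have "\<dots> \<le> M * \<delta>" using t M0 by (intro mult_left_mono) auto
      finally have "riem_dist A g (q t0) (q t) \<le> R / 8" using \<delta> by simp
      moreover have "riem_dist A g x (q t) \<le> riem_dist A g x p + riem_dist A g p (q t)"
        "riem_dist A g p (q t) \<le> riem_dist A g p (q t0) + riem_dist A g (q t0) (q t)"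
        by (rule M.triangle; simp)+
      ultimately show ?thesis using x(2) p(2) M.commute[of p "q t0"] R by linarith
    qed
    \<comment> \<open>the interval follows \<open>t0\<close> in the first half of \<open>[0,T]\<close> and precedes it in the second half\<close>
    obtain s where s: "0 \<le> s" "s + \<delta> \<le> T" "\<And>u. u \<in> {s..s + \<delta>} \<Longrightarrow> \<bar>u - t0\<bar> \<le> \<delta>"
    proof (cases "t0 \<le> T / 2")
      case True
      then show thesis using t0 \<delta> by (intro that[of t0]) auto
    next
      case False
      then show thesis using t0 \<delta> by (intro that[of "t0 - \<delta>"]) auto
    qed
    have "exp 1 * \<tau> * exp (- (1 / (1 - (3 / 4)\<^sup>2))) * ((s + \<delta>) - s) \<le> ?W"
    proof (rule integral_ge_on_subinterval[OF Vi V(2) s(1) _ s(2)])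
      show "s \<le> s + \<delta>" using \<delta> by simp
      fix u assume u: "u \<in> {s..s + \<delta>}"
      then have "u \<in> {0..T}" using s by auto
      then have "exp 1 * \<tau> * exp (- (1 / (1 - (3 / 4)\<^sup>2))) \<le> bump_profile R \<tau> (riem_dist A g x (q u))"
        using near[of u] s(3)[OF u] \<tau> R by (intro bump_profile_lower) auto
      also have "\<dots> \<le> V (q u)" by (rule V(3)[OF _ x(1)])
      finally show "exp 1 * \<tau> * exp (- (1 / (1 - (3 / 4)\<^sup>2))) \<le> V (q u)" .
    qed
    then have "\<tau> * c \<le> ?W" by (simp add: c_def mult_ac)
    moreover have "\<tau> * c = E + 1" using c by (simp add: \<tau>_def)
    ultimately show False using WE by simp
  qed
  then show ?thesis
    using R \<tau> F(1,2) unfolding V_def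
    by (intro exI[of _ 0] exI[of _ \<tau>] exI[of _ "1::nat"] exI[of _ F]) auto
qed

end
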